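(* Let $(M,g)$ be a compact Riemannian manifold with boundary, $g(t)$ ($t$ in an open interval $I\ni 0$) a differentiable variation of the metric $g=g(0)$, and $\eta:I\times M\to\mathbb{R}$ a differentiable function, with $\eta(t)=\eta(t,\cdot)$, $\eta=\eta(0)$. Let $\phi_i(t)\in C^\infty(M)$ be differentiable families of functions and $\lambda_i(t)$ differentiable families of real numbers, $i=1,\dots,m$, such that $\lambda_i(0)=\lambda$ for each $i$ and, for all $t$, $$-\bar L_t\phi_i(t)=\lambda_i(t)\phi_i(t)\ \text{ in } M,\qquad \phi_i(t)=0\ \text{ on }\partial M,$$ with $\langle\phi_i(t),\phi_j(t)\rangle_{L^2(M,\mathrm{dm}_t)}=\delta_{ij}$. Then the derivative at $t=0$ of $t\mapsto(\lambda_i(t)+\lambda_j(t))\delta_{ij}$ is given by $$(\lambda_i+\lambda_j)'\delta_{ij}=\int_M\Big\langle\tfrac12 L(\phi_i\phi_j)\,g-2\,d\phi_i\otimes d\phi_j,\,H\Big\rangle\,\mathrm{dm}+\int_M\langle\nabla\dot\eta,\nabla(\phi_i\phi_j)\rangle\,\mathrm{dm},$$ where $\phi_i=\phi_i(0)$, for all $i,j\in\{1,\dots,m\}$.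
   Context: All manifolds are oriented. $\bar L_t f=\Delta_{g(t)}f-g(t)(\nabla\eta(t),\nabla f)$, where $\Delta_{g(t)}$ is the Laplace-Beltrami operator (the trace of the Hessian) and $\nabla$ here is the gradient with respect to $g(t)$. $L=\bar L_0$, i.e. $Lf=\Delta_g f-g(\nabla\eta,\nabla f)$. The weighted measures are $\mathrm{dm}_t=e^{-\eta(t)}dV_{g(t)}$ and $\mathrm{dm}=\mathrm{dm}_0=e^{-\eta}dV_g$. $H$ is the symmetric $(0,2)$-tensor $H_{ij}=\frac{d}{dt}\big|_{t=0}g_{ij}(t)$ and $\dot\eta=\frac{d}{dt}\big|_{t=0}\eta(t)$. On $(0,2)$-tensors, $\langle T,S\rangle=\sum_{i,j,k,l}g^{ik}g^{jl}T_{ij}S_{kl}$; on vector fields, $\langle\cdot,\cdot\rangle=g$. In the conclusion $\nabla$ is taken with respect to $g$, and the prime denotes $\frac{d}{dt}\big|_{t=0}$. *)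

theory Defs
  imports "HOL-Analysis.Analysis"
begin

definition partial :: "(real^'n::finite) set \<Rightarrow> 'n \<Rightarrow> (real^'n \<Rightarrow> real) \<Rightarrow> real^'n \<Rightarrow> real" where
  "partial S i f x = frechet_derivative f (at x within S) (axis i 1)"

definition smooth_on_open :: "(real^'n::finite) set \<Rightarrow> (real^'n \<Rightarrow> real) \<Rightarrow> bool" where
  "smooth_on_open W F \<longleftrightarrow> open W \<and> (\<forall>is. foldr (partial W) is F differentiable_on W)"

text \<open>On an arbitrary set, smoothness means the existence of smooth local extensions.\<close>

definition smooth_on :: "(real^'n::finite) set \<Rightarrow> (real^'n \<Rightarrow> real) \<Rightarrow> bool" where
  "smooth_on S f \<longleftrightarrow>
     (\<forall>x\<in>S. \<exists>W F. x \<in> W \<and> smooth_on_open W F \<and> (\<forall>y\<in>S \<inter> W. F y = f y))"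

text \<open>A chart is a pair of a domain and a coordinate map.\<close>

type_synonym ('a, 'n) chart = "'a set \<times> ('a \<Rightarrow> real^'n)"

definition chart_image :: "('a, 'n::finite) chart \<Rightarrow> (real^'n) set" where
  "chart_image c = snd c ` fst c"

definition chart_inv :: "('a, 'n::finite) chart \<Rightarrow> real^'n \<Rightarrow> 'a" where
  "chart_inv c = inv_into (fst c) (snd c)"

definition smooth_in_chart :: "('a, 'n::finite) chart \<Rightarrow> ('a \<Rightarrow> real) \<Rightarrow> bool" where
  "smooth_in_chart c f \<longleftrightarrow> smooth_on (chart_image c) (f \<circ> chart_inv c)"

text \<open>Coordinate derivative of a function on the manifold. Chart images are relatively open
  in half-spaces, where the derivative within the image is unique also at boundary points.\<close>

definition pd :: "('a, 'n::finite) chart \<Rightarrow> 'n \<Rightarrow> ('a \<Rightarrow> real) \<Rightarrow> 'a \<Rightarrow> real" where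
  "pd c i f p = partial (chart_image c) i (f \<circ> chart_inv c) (snd c p)"

text \<open>Entry \<open>(a, i)\<close> is the derivative of the \<open>a\<close>-th coordinate of \<open>c'\<close> in the direction of
  the \<open>i\<close>-th coordinate of \<open>c\<close>.\<close>

definition jacobian :: "('a, 'n::finite) chart \<Rightarrow> ('a, 'n) chart \<Rightarrow> 'a \<Rightarrow> real^'n^'n" where
  "jacobian c c' p = (\<chi> a i. pd c i (\<lambda>q. snd c' q $ a) p)"

text \<open>Charts take values in half-spaces \<open>{x. 0 \<le> b \<bullet> x}\<close>; for \<open>b = 0\<close> this is the whole space,
  which gives the ordinary interior charts. The half-space may depend on the chart, so that
  oriented atlases exist also for one-dimensional manifolds such as \<open>[0, 1]\<close>.\<close>

definition manifold_with_boundary ::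
  "'a::{second_countable_topology, t2_space} set \<Rightarrow> ('a, 'n::finite) chart set \<Rightarrow> bool" where
  "manifold_with_boundary M A \<longleftrightarrow>
     M = (\<Union>c\<in>A. fst c) \<and>
     (\<forall>c\<in>A. openin (top_of_set M) (fst c) \<and>
        homeomorphism (fst c) (chart_image c) (snd c) (chart_inv c) \<and>
        (\<exists>b. openin (top_of_set {x. 0 \<le> b \<bullet> x}) (chart_image c))) \<and>
     (\<forall>c\<in>A. \<forall>c'\<in>A. \<forall>a.
        smooth_on (snd c ` (fst c \<inter> fst c')) (\<lambda>x. snd c' (chart_inv c x) $ a))"

definition oriented_atlas :: "('a, 'n::finite) chart set \<Rightarrow> bool" where
  "oriented_atlas A \<longleftrightarrow> (\<forall>c\<in>A. \<forall>c'\<in>A. \<forall>p\<in>fst c \<inter> fst c'. 0 < det (jacobian c c' p))"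

text \<open>Since \<open>chart_image c\<close> is relatively open in a half-space \<open>{x. 0 \<le> b \<bullet> x}\<close>, its points
  outside its interior are exactly those on the bounding hyperplane (if \<open>b \<noteq> 0\<close>).\<close>

definition manifold_boundary :: "('a, 'n::finite) chart set \<Rightarrow> 'a set" where
  "manifold_boundary A = {p. \<exists>c\<in>A. p \<in> fst c \<and> snd c p \<notin> interior (chart_image c)}"

definition smooth_fun :: "('a, 'n::finite) chart set \<Rightarrow> ('a \<Rightarrow> real) \<Rightarrow> bool" where
  "smooth_fun A f \<longleftrightarrow> (\<forall>c\<in>A. smooth_in_chart c f)"

text \<open>Vector fields and \<open>(0,2)\<close>-tensor fields are given by their components in each chart.\<close>

type_synonym ('a, 'n) vec_field = "('a, 'n) chart \<Rightarrow> 'a \<Rightarrow> real^'n"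
type_synonym ('a, 'n) tensor2 = "('a, 'n) chart \<Rightarrow> 'a \<Rightarrow> real^'n^'n"

definition tensor_field2 :: "('a, 'n::finite) chart set \<Rightarrow> ('a, 'n) tensor2 \<Rightarrow> bool" where
  "tensor_field2 A T \<longleftrightarrow>
     (\<forall>c\<in>A. \<forall>c'\<in>A. \<forall>p\<in>fst c \<inter> fst c'.
        T c p = transpose (jacobian c c' p) ** T c' p ** jacobian c c' p)"

definition riemannian_metric :: "('a, 'n::finite) chart set \<Rightarrow> ('a, 'n) tensor2 \<Rightarrow> bool" where
  "riemannian_metric A g \<longleftrightarrow>
     tensor_field2 A g \<and>
     (\<forall>c\<in>A. \<forall>i j. smooth_in_chart c (\<lambda>p. g c p $ i $ j)) \<and>
     (\<forall>c\<in>A. \<forall>p\<in>fst c. transpose (g c p) = g c p \<and> (\<forall>v. v \<noteq> 0 \<longrightarrow> 0 < v \<bullet> (g c p *v v)))"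

text \<open>Scalars built invariantly from tensors are evaluated in some chart around the point.\<close>

definition chart_at :: "('a, 'n) chart set \<Rightarrow> 'a \<Rightarrow> ('a, 'n) chart" where
  "chart_at A p = (SOME c. c \<in> A \<and> p \<in> fst c)"

definition metric_inverse :: "('a, 'n::finite) tensor2 \<Rightarrow> ('a, 'n) chart \<Rightarrow> 'a \<Rightarrow> real^'n^'n" where
  "metric_inverse g c p = matrix_inv (g c p)"

definition inner_vec ::
  "('a, 'n::finite) chart set \<Rightarrow> ('a, 'n) tensor2 \<Rightarrow> ('a, 'n) vec_field \<Rightarrow> ('a, 'n) vec_field \<Rightarrow> 'a \<Rightarrow> real" where
  "inner_vec A g X Y p =
     (let c = chart_at A p in \<Sum>i\<in>UNIV. \<Sum>j\<in>UNIV. g c p $ i $ j * X c p $ i * Y c p $ j)"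

definition inner_tensor ::
  "('a, 'n::finite) chart set \<Rightarrow> ('a, 'n) tensor2 \<Rightarrow> ('a, 'n) tensor2 \<Rightarrow> ('a, 'n) tensor2 \<Rightarrow> 'a \<Rightarrow> real" where
  "inner_tensor A g T S p =
     (let c = chart_at A p; G = metric_inverse g c p in
        \<Sum>i\<in>UNIV. \<Sum>j\<in>UNIV. \<Sum>k\<in>UNIV. \<Sum>l\<in>UNIV. G $ i $ k * G $ j $ l * T c p $ i $ j * S c p $ k $ l)"

definition tensor_trace ::
  "('a, 'n::finite) chart set \<Rightarrow> ('a, 'n) tensor2 \<Rightarrow> ('a, 'n) tensor2 \<Rightarrow> 'a \<Rightarrow> real" where
  "tensor_trace A g T p =
     (let c = chart_at A p in \<Sum>i\<in>UNIV. \<Sum>j\<in>UNIV. metric_inverse g c p $ i $ j * T c p $ i $ j)"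

definition gradient :: "('a, 'n::finite) tensor2 \<Rightarrow> ('a \<Rightarrow> real) \<Rightarrow> ('a, 'n) vec_field" where
  "gradient g f c p = (\<chi> i. \<Sum>j\<in>UNIV. metric_inverse g c p $ i $ j * pd c j f p)"

definition diff_tensor_diff :: "('a \<Rightarrow> real) \<Rightarrow> ('a \<Rightarrow> real) \<Rightarrow> ('a, 'n::finite) tensor2" where
  "diff_tensor_diff f h c p = (\<chi> i j. pd c i f p * pd c j h p)"

definition christoffel ::
  "('a, 'n::finite) tensor2 \<Rightarrow> ('a, 'n) chart \<Rightarrow> 'n \<Rightarrow> 'n \<Rightarrow> 'n \<Rightarrow> 'a \<Rightarrow> real" where
  "christoffel g c k i j p = 1/2 * (\<Sum>l\<in>UNIV. metric_inverse g c p $ k $ l *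
     (pd c i (\<lambda>q. g c q $ j $ l) p + pd c j (\<lambda>q. g c q $ i $ l) p - pd c l (\<lambda>q. g c q $ i $ j) p))"

definition hessian :: "('a, 'n::finite) tensor2 \<Rightarrow> ('a \<Rightarrow> real) \<Rightarrow> ('a, 'n) tensor2" where
  "hessian g f c p =
     (\<chi> i j. pd c i (pd c j f) p - (\<Sum>k\<in>UNIV. christoffel g c k i j p * pd c k f p))"

definition laplace_beltrami ::
  "('a, 'n::finite) chart set \<Rightarrow> ('a, 'n) tensor2 \<Rightarrow> ('a \<Rightarrow> real) \<Rightarrow> 'a \<Rightarrow> real" where
  "laplace_beltrami A g f = tensor_trace A g (hessian g f)"

definition drift_laplacian ::
  "('a, 'n::finite) chart set \<Rightarrow> ('a, 'n) tensor2 \<Rightarrow> ('a \<Rightarrow> real) \<Rightarrow> ('a \<Rightarrow> real) \<Rightarrow> 'a \<Rightarrow> real" where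
  "drift_laplacian A g \<eta> f p =
     laplace_beltrami A g f p - inner_vec A g (gradient g \<eta>) (gradient g f) p"

text \<open>The unique Borel measure on the manifold with density \<open>sqrt (det g)\<close> with respect to
  Lebesgue measure in every chart.\<close>

definition riemannian_volume ::
  "'a::{second_countable_topology, t2_space} set \<Rightarrow> ('a, 'n::finite) chart set \<Rightarrow> ('a, 'n) tensor2 \<Rightarrow> 'a measure" where
  "riemannian_volume M A g = (THE \<mu>. sets \<mu> = sets (restrict_space borel M) \<and>
     (\<forall>c\<in>A. \<forall>E\<in>sets \<mu>. E \<subseteq> fst c \<longrightarrow>
        emeasure \<mu> E = (\<integral>\<^sup>+x\<in>snd c ` E. ennreal (sqrt (det (g c (chart_inv c x)))) \<partial>lborel)))"

definition weighted_measure ::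
  "'a::{second_countable_topology, t2_space} set \<Rightarrow> ('a, 'n::finite) chart set \<Rightarrow> ('a, 'n) tensor2 \<Rightarrow>
     ('a \<Rightarrow> real) \<Rightarrow> 'a measure" where
  "weighted_measure M A g \<eta> = density (riemannian_volume M A g) (\<lambda>p. ennreal (exp (- \<eta> p)))"

text \<open>In a chart, a family is differentiable if it is differentiable as a curve in the Frechet
  space of smooth functions: the difference quotients converge, with all spatial derivatives,
  uniformly on compact sets to a smooth function. Jointly smooth functions of parameter and point
  have this property, also at boundary points.\<close>

definition differentiable_family_in_chart ::
  "real set \<Rightarrow> ('a::topological_space, 'n::finite) chart \<Rightarrow> (real \<Rightarrow> 'a \<Rightarrow> real) \<Rightarrow> bool" where
  "differentiable_family_in_chart I c u \<longleftrightarrow>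
     (\<forall>t\<in>I. smooth_in_chart c (u t) \<and>
        (\<exists>u'. smooth_in_chart c u' \<and>
          (\<forall>is K. compact K \<longrightarrow> K \<subseteq> fst c \<longrightarrow>
            uniform_limit K
              (\<lambda>s p. (foldr (pd c) is (u s) p - foldr (pd c) is (u t) p) / (s - t))
              (foldr (pd c) is u') (at t))))"

definition differentiable_family ::
  "real set \<Rightarrow> ('a::topological_space, 'n::finite) chart set \<Rightarrow> (real \<Rightarrow> 'a \<Rightarrow> real) \<Rightarrow> bool" where
  "differentiable_family I A u \<longleftrightarrow> (\<forall>c\<in>A. differentiable_family_in_chart I c u)"

definition metric_variation ::
  "real set \<Rightarrow> ('a::topological_space, 'n::finite) chart set \<Rightarrow> (real \<Rightarrow> ('a, 'n) tensor2) \<Rightarrow> bool" where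
  "metric_variation I A g \<longleftrightarrow>
     (\<forall>t\<in>I. riemannian_metric A (g t)) \<and>
     (\<forall>c\<in>A. \<forall>i j. differentiable_family_in_chart I c (\<lambda>t p. g t c p $ i $ j))"

definition metric_derivative :: "(real \<Rightarrow> ('a, 'n::finite) tensor2) \<Rightarrow> ('a, 'n) tensor2" where
  "metric_derivative g c p = (\<chi> i j. deriv (\<lambda>t. g t c p $ i $ j) 0)"

end

theory Submission
  imports Defs
begin

text \<open>Write \<open>L\<^sub>t\<close> for the drift Laplacian and \<open>a\<^sub>t(f, h) = \<integral> \<langle>\<nabla>f, \<nabla>h\<rangle>\<^sub>t dm\<^sub>t\<close>, \<open>b\<^sub>t(f, h) = \<integral> f h dm\<^sub>t\<close>.
  For eigenfunctions \<open>u\<^sub>t = \<phi>\<^sub>i(t)\<close>, \<open>v\<^sub>t = \<phi>\<^sub>j(t)\<close> vanishing on the boundary, Green's identity gives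
  \<open>a\<^sub>t(u\<^sub>t, v\<^sub>0) = \<lambda>\<^sub>i(t) b\<^sub>t(u\<^sub>t, v\<^sub>0)\<close> and \<open>a\<^sub>0(u\<^sub>t, v\<^sub>0) = \<lambda> b\<^sub>0(u\<^sub>t, v\<^sub>0)\<close>. In the derivative of the difference
  only the variations of metric and weight survive: with \<open>\<theta>' = tr H / 2 - \<eta>'\<close>,
  \<open>\<lambda>\<^sub>i' \<delta>\<^sub>i\<^sub>j = \<integral> \<theta>' (\<langle>\<nabla>u, \<nabla>v\<rangle> - \<lambda> u v) - H(\<nabla>u, \<nabla>v) dm\<close>. The right-hand side is symmetric in \<open>i\<close> and \<open>j\<close>,
  and \<open>L(u v) = 2 (\<langle>\<nabla>u, \<nabla>v\<rangle> - \<lambda> u v)\<close>; the term with \<open>\<eta>' L(u v)\<close> is integrated by parts once more.\<close>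

section \<open>Functions of class C1 on relatively open subsets of half-spaces\<close>

text \<open>The difference a_t(u_t, v_0) - a_0(u_t, v_0) is used because the derivative of u_t
  enters both terms in the same way and cancels at t = 0; no equation for it is needed, and the
  multiplicity of the eigenvalue is irrelevant. To differentiate over one fixed measure, integrals
  against dm_t are rewritten against dm_0 with a density \<theta>, a quotient of chart weights. The
  main obstacle is that scalars are evaluated in a chart picked separately at each point by
  \<open>SOME\<close>, so that not even their continuity is visible. Each is therefore first shown
  to agree with its expression in an arbitrary fixed chart. The volume is a definite description, so
  its existence and uniqueness must be proved, from a finite cover and the change of variables
  formula. Boundary integrals never occur: every divergence that is integrated carries a factor
  vanishing on the boundary and hence extends by zero to a Lipschitz function. One continuous
  derivative of the weights, fluxes and cut-off functions is enough for all of this, so the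
  partition of unity is only of class C1.\<close>

definition hs_open :: "(real^'n::finite) set \<Rightarrow> bool" where
  "hs_open S \<longleftrightarrow> (\<exists>b. openin (top_of_set {x. 0 \<le> b \<bullet> x}) S)"

lemma hs_open_openin:
  assumes "hs_open S" and "openin (top_of_set S) T"
  shows "hs_open T"
  using assms unfolding hs_open_def by (meson openin_trans)

text \<open>A derivative within a set is unique as soon as each direction can be followed a little,
  forwards or backwards, inside the set. In a half-space one of the two signs always works, also at
  boundary points.\<close>

lemma hs_open_directions:
  assumes S: "hs_open S" "x \<in> S" and "e > (0::real)"
  shows "\<exists>d. 0 < \<bar>d\<bar> \<and> \<bar>d\<bar> < e \<and> x + d *\<^sub>R i \<in> S"
proof -
  obtain b where b: "openin (top_of_set {x. 0 \<le> b \<bullet> x}) S" using S by (auto simp: hs_open_def)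
  then obtain e' where e': "0 < e'" "ball x e' \<inter> {x. 0 \<le> b \<bullet> x} \<subseteq> S" and sub: "S \<subseteq> {x. 0 \<le> b \<bullet> x}"
    using S(2) unfolding openin_contains_ball by blast
  \<comment> \<open>The summand 1 covers the case i = 0, and halving makes both inequalities for
    \<open>r\<close> strict.\<close>
  define r where "r = min e (e' / (norm i + 1)) / 2"
  have ni: "0 < norm i + 1" by (smt (verit) norm_ge_zero)
  have r: "0 < r" "r < e" using \<open>0 < e'\<close> \<open>e > 0\<close> ni by (auto simp: r_def min_def field_simps)
  have "0 < e' / (norm i + 1)" using \<open>0 < e'\<close> ni by simp
  then have "r < e' / (norm i + 1)" using \<open>e > 0\<close> unfolding r_def by (smt (verit) field_sum_of_halves min.cobounded2 r(1) r_def)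
  then have "r * (norm i + 1) < e'" using ni by (simp add: field_simps)
  then have rn: "r * norm i < e'" using r by (simp add: algebra_simps)
  \<comment> \<open>The sign is chosen so that \<open>b \<bullet> x\<close> does not
    decrease.\<close>
  define d where "d = (if 0 \<le> b \<bullet> i then r else - r)"
  have d: "\<bar>d\<bar> = r" using r by (simp add: d_def)
  have "0 \<le> b \<bullet> x" using sub S by auto
  moreover have "0 \<le> d * (b \<bullet> i)" using r by (auto simp: d_def mult_nonneg_nonpos)
  ultimately have "0 \<le> b \<bullet> (x + d *\<^sub>R i)" by (simp add: inner_add_right)
  moreover have "x + d *\<^sub>R i \<in> ball x e'" using rn d by (simp add: dist_norm)
  ultimately show ?thesis using e' d r by (intro exI[of _ d]) auto
qed

lemma hs_open_has_derivative_unique: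
  assumes "hs_open S" "x \<in> S" "(f has_derivative f') (at x within S)" "(f has_derivative f'') (at x within S)"
  shows "f' = f''"
  using frechet_derivative_unique_within[OF assms(3,4)] hs_open_directions[OF assms(1,2)] by blast

lemma hs_open_frechet_derivative:
  assumes "hs_open S" "x \<in> S" "(f has_derivative f') (at x within S)"
  shows "frechet_derivative f (at x within S) = f'"
  using assms hs_open_has_derivative_unique by (metis differentiable_def frechet_derivative_works)

definition grad :: "(real^'n::finite) set \<Rightarrow> (real^'n \<Rightarrow> real) \<Rightarrow> real^'n \<Rightarrow> real^'n" where
  "grad S f x = (\<chi> i. partial S i f x)"

lemma grad_nth [simp]: "grad S f x $ i = partial S i f x"
  by (simp add: grad_def)

lemma grad_eq:
  assumes "hs_open S" "x \<in> S" "(f has_derivative (\<lambda>h. v \<bullet> h)) (at x within S)"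
  shows "grad S f x = v"
  using hs_open_frechet_derivative[OF assms]
  by (simp add: vec_eq_iff partial_def inner_axis)

lemma differentiable_grad:
  assumes "f differentiable (at x within S)"
  shows "(f has_derivative (\<lambda>h. grad S f x \<bullet> h)) (at x within S)"
proof -
  let ?D = "frechet_derivative f (at x within S)"
  have D: "(f has_derivative ?D) (at x within S)" using assms by (simp add: frechet_derivative_works)
  then have "linear ?D" by (rule has_derivative_linear)
  have "?D h = grad S f x \<bullet> h" for h
  proof -
    have "?D h = ?D (\<Sum>i\<in>UNIV. (h $ i) *\<^sub>R axis i 1)"
      using basis_expansion[of h] by (simp add: scalar_mult_eq_scaleR)
    also have "\<dots> = (\<Sum>i\<in>UNIV. h $ i * ?D (axis i 1))"
      using \<open>linear ?D\<close> by (simp add: linear_sum linear_cmul)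
    also have "\<dots> = grad S f x \<bullet> h" by (simp add: Finite_Cartesian_Product.inner_vec_def partial_def mult.commute)
    finally show ?thesis .
  qed
  then have "?D = (\<lambda>h. grad S f x \<bullet> h)" by blast
  then show ?thesis using D by simp
qed

text \<open>The working regularity class. The local extensions behind \<open>smooth_on\<close> are
  awkward under products, roots and quotients, whereas one continuous derivative within the set is
  stable under them and enough for the divergence theorem.\<close>

definition C1 :: "(real^'n::finite) set \<Rightarrow> (real^'n \<Rightarrow> real) \<Rightarrow> bool" where
  "C1 S f \<longleftrightarrow> (\<forall>x\<in>S. f differentiable (at x within S)) \<and> continuous_on S (grad S f)"

lemma C1_has_derivative:
  "C1 S f \<Longrightarrow> x \<in> S \<Longrightarrow> (f has_derivative (\<lambda>h. grad S f x \<bullet> h)) (at x within S)"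
  by (simp add: C1_def differentiable_grad)

lemma C1_continuous_partial: "C1 S f \<Longrightarrow> continuous_on S (partial S i f)"
  unfolding C1_def using continuous_on_component[of S "grad S f" i] by simp

lemma C1_continuous: "C1 S f \<Longrightarrow> continuous_on S f"
  unfolding C1_def continuous_on_eq_continuous_within
  using differentiable_imp_continuous_within by blast

text \<open>Uniqueness of the derivative on half-space domains identifies any representing field
  \<open>D\<close> with the gradient, so continuity can be checked on \<open>D\<close>.\<close>

lemma C1I:
  assumes "hs_open S" "\<And>x. x \<in> S \<Longrightarrow> (f has_derivative (\<lambda>h. D x \<bullet> h)) (at x within S)" "continuous_on S D"
  shows "C1 S f"
proof -
  have "grad S f x = D x" if "x \<in> S" for x using grad_eq assms that by blast
  then have "continuous_on S (grad S f)" using assms(3) continuous_on_cong by metis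
  then show ?thesis using assms(2) unfolding C1_def differentiable_def by blast
qed

lemma frechet_derivative_cong:
  assumes "\<And>y. y \<in> S \<Longrightarrow> f y = g y" "x \<in> S"
  shows "frechet_derivative f (at x within S) = frechet_derivative g (at x within S)"
proof -
  have "(f has_derivative f') (at x within S) \<longleftrightarrow> (g has_derivative f') (at x within S)" for f'
    using assms has_derivative_transform[of x S] by metis
  then show ?thesis unfolding frechet_derivative_def by simp
qed

lemma partial_cong:
  assumes "\<And>y. y \<in> S \<Longrightarrow> f y = g y" "x \<in> S"
  shows "partial S i f x = partial S i g x"
  using frechet_derivative_cong[OF assms] by (simp add: partial_def)

lemma differentiable_within_cong:
  assumes "\<And>y. y \<in> S \<Longrightarrow> f y = g y" "x \<in> S"
  shows "f differentiable (at x within S) \<longleftrightarrow> g differentiable (at x within S)"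
proof -
  have "(f has_derivative f') (at x within S) \<longleftrightarrow> (g has_derivative f') (at x within S)" for f'
    using assms has_derivative_transform[of x S] by metis
  then show ?thesis unfolding differentiable_def by simp
qed

lemma C1_cong:
  assumes "\<And>y. y \<in> S \<Longrightarrow> f y = g y"
  shows "C1 S f \<longleftrightarrow> C1 S g"
proof -
  have "grad S f x = grad S g x" if "x \<in> S" for x
    using partial_cong[of S f g x] assms that by (simp add: vec_eq_iff)
  then have "continuous_on S (grad S f) \<longleftrightarrow> continuous_on S (grad S g)" by (intro continuous_on_cong) auto
  then show ?thesis unfolding C1_def using differentiable_within_cong[of S f g] assms by blast
qed

lemma at_within_openin:
  assumes "openin (top_of_set S) T" "x \<in> T"
  shows "at x within T = at x within S"
proof -
  obtain W where "open W" "T = S \<inter> W" using assms(1) by (auto simp: openin_open)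
  then show ?thesis using assms(2) by (metis IntE at_within_nhd inf.idem inf_assoc)
qed

lemma partial_openin:
  assumes "openin (top_of_set S) T" "x \<in> T"
  shows "partial T i f x = partial S i f x"
  using at_within_openin[OF assms] by (simp add: partial_def)

lemma C1_openin:
  assumes "C1 S f" "openin (top_of_set S) T"
  shows "C1 T f"
proof -
  have T: "T \<subseteq> S" using assms(2) openin_imp_subset by blast
  have g: "grad T f x = grad S f x" if "x \<in> T" for x
    using partial_openin[OF assms(2) that] by (simp add: vec_eq_iff)
  have "continuous_on T (grad S f)" using assms T continuous_on_subset C1_def by blast
  then have "continuous_on T (grad T f)" using g continuous_on_cong by (metis (no_types, lifting))
  then show ?thesis using assms T at_within_openin[OF assms(2)] unfolding C1_def by (metis subsetD)
qed

text \<open>The filter \<open>at x within S\<close> only sees a relative neighbourhood of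
  \<open>x\<close>. This glues functions known near their support and known to vanish
  elsewhere.\<close>

lemma C1_local:
  assumes "\<And>x. x \<in> S \<Longrightarrow> \<exists>T. openin (top_of_set S) T \<and> x \<in> T \<and> C1 T f"
  shows "C1 S f"
  unfolding C1_def continuous_on_eq_continuous_within
proof (intro conjI ballI)
  fix x assume "x \<in> S"
  then obtain T where T: "openin (top_of_set S) T" "x \<in> T" "C1 T f" using assms by blast
  show "f differentiable (at x within S)"
    using T at_within_openin[OF T(1,2)] by (metis C1_def)
  have g: "grad T f y = grad S f y" if "y \<in> T" for y
    using partial_openin[OF T(1) that] by (simp add: vec_eq_iff)
  have "continuous_on T (grad S f)" using T(3) g continuous_on_cong C1_def by (metis (no_types, lifting))
  then have "continuous (at x within T) (grad S f)" using T(2) continuous_on_eq_continuous_within by blast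
  then show "continuous (at x within S) (grad S f)" using at_within_openin[OF T(1,2)] by simp
qed

lemma C1_const [simp]: "hs_open S \<Longrightarrow> C1 S (\<lambda>x. c)"
  by (rule C1I[where D="\<lambda>x. 0"]) (auto intro!: derivative_eq_intros)

lemma C1_add:
  assumes "hs_open S" "C1 S f" "C1 S g"
  shows "C1 S (\<lambda>x. f x + g x)"
  by (rule C1I[where D="\<lambda>x. grad S f x + grad S g x", OF assms(1)])
    (use assms in \<open>auto intro!: derivative_eq_intros C1_has_derivative continuous_intros simp: inner_add_left C1_def[of S]\<close>)

lemma C1_mult:
  assumes "hs_open S" "C1 S f" "C1 S g"
  shows "C1 S (\<lambda>x. f x * g x)"
  by (rule C1I[where D="\<lambda>x. f x *\<^sub>R grad S g x + g x *\<^sub>R grad S f x", OF assms(1)])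
    (use assms in \<open>auto intro!: derivative_eq_intros C1_has_derivative continuous_intros C1_continuous
       simp: inner_add_left C1_def[of S]\<close>)

lemma has_derivative_real_comp:
  assumes "(f has_derivative (\<lambda>h. v \<bullet> h)) (at x within S)" "(k has_real_derivative k') (at (f x))"
  shows "((\<lambda>x. k (f x)) has_derivative (\<lambda>h. (k' *\<^sub>R v) \<bullet> h)) (at x within S)"
proof -
  have "(k has_derivative (\<lambda>y. k' * y)) (at (f x))"
    using assms(2) by (simp add: has_field_derivative_def)
  from has_derivative_compose[OF assms(1) this] show ?thesis by simp
qed

lemma C1_compose_real:
  assumes "hs_open S" "C1 S f" "\<And>x. x \<in> S \<Longrightarrow> (k has_real_derivative k' (f x)) (at (f x))"
    "continuous_on (f ` S) k'"
  shows "C1 S (\<lambda>x. k (f x))"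
proof (rule C1I[where D="\<lambda>x. k' (f x) *\<^sub>R grad S f x", OF assms(1)])
  fix x assume "x \<in> S"
  then show "((\<lambda>x. k (f x)) has_derivative (\<bullet>) (k' (f x) *\<^sub>R grad S f x)) (at x within S)"
    using has_derivative_real_comp C1_has_derivative assms by metis
next
  have "continuous_on S (\<lambda>x. k' (f x))"
    using continuous_on_compose[OF C1_continuous[OF assms(2)] assms(4)] by (simp add: o_def)
  then show "continuous_on S (\<lambda>x. k' (f x) *\<^sub>R grad S f x)"
    using assms(2) by (auto simp: C1_def intro!: continuous_intros)
qed

lemma C1_sum:
  assumes "hs_open S" "\<And>k. k \<in> K \<Longrightarrow> C1 S (f k)"
  shows "C1 S (\<lambda>x. \<Sum>k\<in>K. f k x)"
  using assms(2) by (induction K rule: infinite_finite_induct) (auto simp: assms(1) intro!: C1_add)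

lemma C1_prod:
  assumes "hs_open S" "\<And>k. k \<in> K \<Longrightarrow> C1 S (f k)"
  shows "C1 S (\<lambda>x. \<Prod>k\<in>K. f k x)"
  using assms(2) by (induction K rule: infinite_finite_induct) (auto simp: assms(1) intro!: C1_mult)

lemma C1_exp:
  assumes "hs_open S" "C1 S f"
  shows "C1 S (\<lambda>x. exp (f x))"
  by (rule C1_compose_real[OF assms, where k'=exp]) (auto intro!: DERIV_exp continuous_intros)

lemma C1_minus:
  assumes "hs_open S" "C1 S f"
  shows "C1 S (\<lambda>x. - f x)"
  using C1_mult[OF assms(1) C1_const[OF assms(1), of "-1"] assms(2)] by simp

lemma C1_inverse:
  assumes "hs_open S" "C1 S f" "\<And>x. x \<in> S \<Longrightarrow> f x \<noteq> 0"
  shows "C1 S (\<lambda>x. inverse (f x))"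
proof (rule C1_compose_real[OF assms(1,2), where k'="\<lambda>y. - (inverse y ^ 2)"])
  show "(inverse has_real_derivative - (inverse (f x))\<^sup>2) (at (f x))" if "x \<in> S" for x
    using DERIV_inverse[OF assms(3)[OF that]] by (simp add: power2_eq_square)
  show "continuous_on (f ` S) (\<lambda>y. - (inverse y)\<^sup>2)"
    using assms(3) by (auto intro!: continuous_intros)
qed

lemma C1_sqrt:
  assumes "hs_open S" "C1 S f" "\<And>x. x \<in> S \<Longrightarrow> f x > 0"
  shows "C1 S (\<lambda>x. sqrt (f x))"
proof (rule C1_compose_real[OF assms(1,2), where k'="\<lambda>y. inverse (sqrt y) / 2"])
  show "(sqrt has_real_derivative inverse (sqrt (f x)) / 2) (at (f x))" if "x \<in> S" for x
    using DERIV_real_sqrt[OF assms(3)[OF that]] .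
  show "continuous_on (f ` S) (\<lambda>y. inverse (sqrt y) / 2)"
    using assms(3) by (force intro!: continuous_intros)
qed

lemma partial_mult:
  assumes "hs_open S" "x \<in> S" "f differentiable (at x within S)" "g differentiable (at x within S)"
  shows "partial S i (\<lambda>x. f x * g x) x = f x * partial S i g x + g x * partial S i f x"
proof -
  have "((\<lambda>x. f x * g x) has_derivative (\<lambda>h. (f x *\<^sub>R grad S g x + g x *\<^sub>R grad S f x) \<bullet> h)) (at x within S)"
    using differentiable_grad[OF assms(3)] differentiable_grad[OF assms(4)]
    by (auto intro!: derivative_eq_intros simp: inner_add_left)
  from arg_cong[OF grad_eq[OF assms(1,2) this], of "\<lambda>v. v $ i"] show ?thesis by simp
qed

lemma partial_add:
  assumes "hs_open S" "x \<in> S" "f differentiable (at x within S)" "g differentiable (at x within S)"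
  shows "partial S i (\<lambda>x. f x + g x) x = partial S i f x + partial S i g x"
proof -
  have "((\<lambda>x. f x + g x) has_derivative (\<lambda>h. (grad S f x + grad S g x) \<bullet> h)) (at x within S)"
    using differentiable_grad[OF assms(3)] differentiable_grad[OF assms(4)]
    by (auto intro!: derivative_eq_intros simp: inner_add_left)
  from arg_cong[OF grad_eq[OF assms(1,2) this], of "\<lambda>v. v $ i"] show ?thesis by simp
qed

lemma partial_const [simp]: "hs_open S \<Longrightarrow> x \<in> S \<Longrightarrow> partial S i (\<lambda>x. c) x = 0"
  using arg_cong[OF grad_eq[of S x "\<lambda>x. c" 0], of "\<lambda>v. v $ i"] by simp

lemma partial_sum:
  assumes "hs_open S" "x \<in> S" "\<And>k. k \<in> K \<Longrightarrow> f k differentiable (at x within S)"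
  shows "partial S i (\<lambda>x. \<Sum>k\<in>K. f k x) x = (\<Sum>k\<in>K. partial S i (f k) x)"
  using assms(3)
proof (induction K rule: infinite_finite_induct)
  case (insert a F)
  then have "(\<lambda>x. \<Sum>k\<in>F. f k x) differentiable (at x within S)" by auto
  then show ?case using insert by (simp add: partial_add[OF assms(1,2)])
qed (auto simp: assms)

lemma partial_compose_real:
  assumes "hs_open S" "x \<in> S" "f differentiable (at x within S)" "(k has_real_derivative k') (at (f x))"
  shows "partial S i (\<lambda>x. k (f x)) x = k' * partial S i f x"
  using arg_cong[OF grad_eq[OF assms(1,2)
        has_derivative_real_comp[OF differentiable_grad[OF assms(3)] assms(4)]], of "\<lambda>v. v $ i"]
  by simp

lemma C1_differentiable: "C1 S f \<Longrightarrow> x \<in> S \<Longrightarrow> f differentiable (at x within S)"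
  by (simp add: C1_def)

text \<open>The chain rule with derivatives within sets: since \<open>f\<close> is differentiable
  only within \<open>S\<close>, its derivative is first restricted to the image of
  \<open>\<tau>\<close>. It is applied to transition maps.\<close>

lemma C1_compose:
  fixes \<tau> :: "real^'n::finite \<Rightarrow> real^'n"
  assumes U: "hs_open U" and \<tau>: "\<And>a. C1 U (\<lambda>x. \<tau> x $ a)" "\<tau> ` U \<subseteq> S" and f: "C1 S f"
  shows "C1 U (\<lambda>x. f (\<tau> x))"
    and "x \<in> U \<Longrightarrow> partial U i (\<lambda>x. f (\<tau> x)) x
          = (\<Sum>a\<in>UNIV. partial S a f (\<tau> x) * partial U i (\<lambda>x. \<tau> x $ a) x)"
proof -
  define D where "D x = (\<chi> i. \<Sum>a\<in>UNIV. partial S a f (\<tau> x) * partial U i (\<lambda>x. \<tau> x $ a) x)" for x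
  have \<tau>d: "(\<tau> has_derivative (\<lambda>h. \<chi> a. grad U (\<lambda>x. \<tau> x $ a) x \<bullet> h)) (at x within U)" if "x \<in> U" for x
  proof -
    have "((\<lambda>y. \<chi> a. \<tau> y $ a) has_derivative (\<lambda>h. \<chi> a. grad U (\<lambda>x. \<tau> x $ a) x \<bullet> h)) (at x within U)"
      using C1_has_derivative[OF \<tau>(1) that]
      unfolding has_derivative_componentwise_within[of "\<lambda>y. \<chi> a. \<tau> y $ a"]
      by (auto simp: Basis_vec_def inner_axis)
    then show ?thesis by simp
  qed
  have D: "((\<lambda>x. f (\<tau> x)) has_derivative (\<lambda>h. D x \<bullet> h)) (at x within U)" if "x \<in> U" for x
  proof -
    have "(f has_derivative (\<lambda>h. grad S f (\<tau> x) \<bullet> h)) (at (\<tau> x) within \<tau> ` U)"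
      using C1_has_derivative[OF f] \<tau>(2) that by (meson has_derivative_subset image_eqI subsetD)
    from has_derivative_in_compose[OF \<tau>d[OF that] this]
    have "((\<lambda>x. f (\<tau> x)) has_derivative (\<lambda>h. grad S f (\<tau> x) \<bullet> (\<chi> a. grad U (\<lambda>x. \<tau> x $ a) x \<bullet> h))) (at x within U)" .
    moreover have "grad S f (\<tau> x) \<bullet> (\<chi> a. grad U (\<lambda>x. \<tau> x $ a) x \<bullet> h) = D x \<bullet> h" for h
    proof -
      have "D x \<bullet> h = (\<Sum>i\<in>UNIV. \<Sum>a\<in>UNIV. partial S a f (\<tau> x) * partial U i (\<lambda>x. \<tau> x $ a) x * h $ i)"
        by (simp add: D_def Finite_Cartesian_Product.inner_vec_def sum_distrib_right)
      also have "\<dots> = (\<Sum>a\<in>UNIV. \<Sum>i\<in>UNIV. partial S a f (\<tau> x) * partial U i (\<lambda>x. \<tau> x $ a) x * h $ i)"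
        by (rule sum.swap)
      finally show ?thesis by (simp add: Finite_Cartesian_Product.inner_vec_def sum_distrib_left mult.assoc)
    qed
    ultimately show ?thesis by simp
  qed
  have ct: "continuous_on U \<tau>"
    using C1_continuous[OF \<tau>(1)] continuous_on_vec_lambda[of U "\<lambda>a x. \<tau> x $ a"] by simp
  have cf: "continuous_on U (\<lambda>x. partial S a f (\<tau> x))" for a
    using continuous_on_compose2[OF C1_continuous_partial[OF f] ct \<tau>(2)] .
  have "continuous_on U D" unfolding D_def
    by (intro continuous_on_vec_lambda continuous_on_sum continuous_on_mult cf C1_continuous_partial \<tau>)
  then show "C1 U (\<lambda>x. f (\<tau> x))" using C1I[OF U D] by blast
  show "x \<in> U \<Longrightarrow> partial U i (\<lambda>x. f (\<tau> x)) x
          = (\<Sum>a\<in>UNIV. partial S a f (\<tau> x) * partial U i (\<lambda>x. \<tau> x $ a) x)"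
    using arg_cong[OF grad_eq[OF U _ D], of x "\<lambda>v. v $ i"] by (simp add: D_def)
qed

section \<open>Smooth functions given by local extensions\<close>

lemma smooth_on_open_partial: "smooth_on_open W F \<Longrightarrow> smooth_on_open W (partial W i F)"
proof -
  assume F: "smooth_on_open W F"
  \<comment> \<open>The first derivative is the innermost one in the \<open>foldr\<close>, so it
    corresponds to appending \<open>i\<close> at the end of the word.\<close>
  have "foldr (partial W) is (partial W i F) differentiable_on W" for "is"
    using F[unfolded smooth_on_open_def, THEN conjunct2, rule_format, of "is @ [i]"] by simp
  then show ?thesis using F unfolding smooth_on_open_def by simp
qed

lemma smooth_on_open_continuous: "smooth_on_open W F \<Longrightarrow> continuous_on W F"
  unfolding smooth_on_open_def using differentiable_imp_continuous_on by (metis foldr.simps(1) id_apply)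

lemma smooth_on_open_C1:
  assumes "smooth_on_open W F"
  shows "C1 W F"
  unfolding C1_def
proof
  show "\<forall>x\<in>W. F differentiable (at x within W)"
    using assms[unfolded smooth_on_open_def] by (metis differentiable_on_def foldr.simps(1) id_apply)
  have "continuous_on W (\<lambda>x. \<chi> i. partial W i F x)"
    by (intro continuous_on_vec_lambda smooth_on_open_continuous smooth_on_open_partial assms)
  then show "continuous_on W (grad W F)" by (simp add: grad_def[abs_def])
qed

text \<open>The derivative of the extension, restricted to \<open>S \<inter> W\<close>, is a
  derivative of \<open>f\<close> there, and by uniqueness it is the only one. Hence partial
  derivatives at boundary points do not depend on the extension.\<close>

lemma smooth_on_extension:
  assumes S: "hs_open S" and F: "smooth_on_open W F" "\<And>y. y \<in> S \<inter> W \<Longrightarrow> F y = f y"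
  shows "C1 (S \<inter> W) f" and "x \<in> S \<inter> W \<Longrightarrow> partial S i f x = partial W i F x"
proof -
  have "open W" using F(1) by (simp add: smooth_on_open_def)
  then have o: "openin (top_of_set S) (S \<inter> W)" by (simp add: openin_open_Int)
  have hs: "hs_open (S \<inter> W)" using hs_open_openin[OF S o] .
  have D: "(f has_derivative (\<lambda>h. grad W F x \<bullet> h)) (at x within S \<inter> W)" if "x \<in> S \<inter> W" for x
  proof -
    have "(F has_derivative (\<lambda>h. grad W F x \<bullet> h)) (at x within S \<inter> W)"
      using C1_has_derivative[OF smooth_on_open_C1[OF F(1)], of x] that has_derivative_subset by blast
    then show ?thesis using has_derivative_transform[of x "S \<inter> W" f F] F(2) that by metis
  qed
  have "continuous_on (S \<inter> W) (grad W F)"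
    using smooth_on_open_C1[OF F(1)] by (meson C1_def continuous_on_subset inf_le2)
  then show "C1 (S \<inter> W) f" using C1I[OF hs D] by blast
  assume x: "x \<in> S \<inter> W"
  have "partial (S \<inter> W) i f x = partial W i F x"
    using arg_cong[OF grad_eq[OF hs x D[OF x]], of "\<lambda>v. v $ i"] by simp
  then show "partial S i f x = partial W i F x" using partial_openin[OF o x] by simp
qed

lemma smooth_on_C1:
  assumes "hs_open S" "smooth_on S f"
  shows "C1 S f"
proof (rule C1_local)
  fix x assume x: "x \<in> S"
  then obtain W F where F: "x \<in> W" "smooth_on_open W F" "\<forall>y\<in>S \<inter> W. F y = f y"
    using assms(2) unfolding smooth_on_def by meson
  then have "C1 (S \<inter> W) f" using smooth_on_extension(1)[OF assms(1) F(2)] by blast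
  moreover have "openin (top_of_set S) (S \<inter> W)"
    using F(2) by (simp add: openin_open_Int smooth_on_open_def)
  ultimately show "\<exists>T. openin (top_of_set S) T \<and> x \<in> T \<and> C1 T f" using x F(1) by blast
qed

lemma smooth_on_partial:
  assumes "hs_open S" "smooth_on S f"
  shows "smooth_on S (partial S i f)"
  unfolding smooth_on_def
proof
  fix x assume x: "x \<in> S"
  then obtain W F where F: "x \<in> W" "smooth_on_open W F" "\<forall>y\<in>S \<inter> W. F y = f y"
    using assms(2) unfolding smooth_on_def by meson
  then have "\<forall>y\<in>S \<inter> W. partial W i F y = partial S i f y"
    using smooth_on_extension(2)[OF assms(1) F(2)] by fastforce
  then show "\<exists>W F. x \<in> W \<and> smooth_on_open W F \<and> (\<forall>y\<in>S \<inter> W. F y = partial S i f y)"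
    using F smooth_on_open_partial by blast
qed

section \<open>The divergence theorem for compactly supported functions on half-spaces\<close>

lemma integrable_const_cball:
  "integrable lborel (\<lambda>x::'a::euclidean_space. C * indicator (cball 0 R) x :: real)"
proof -
  have "emeasure lborel (cball (0::'a) R) < \<infinity>" by (rule emeasure_bounded_finite) simp
  then show ?thesis by (intro integrable_mult_right integrable_real_indicator) simp_all
qed

lemma integrable_indicator_compact_bound:
  fixes f :: "'a::euclidean_space \<Rightarrow> real"
  assumes "f \<in> borel_measurable borel" "\<And>x. \<bar>f x\<bar> \<le> C * indicator (cball 0 R) x"
  shows "integrable lborel f"
proof (rule Bochner_Integration.integrable_bound)
  show "integrable lborel (\<lambda>x. C * indicator (cball 0 R) x :: real)"
    by (rule integrable_const_cball)
  show "AE x in lborel. norm (f x) \<le> norm (C * indicator (cball 0 R) x)"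
    using assms(2) by (intro AE_I2) (metis abs_ge_self order_trans real_norm_def)
qed (use assms in simp)

text \<open>On the relatively open set \<open>S - K\<close> the function is constantly 0, and on
  \<open>K\<close> compactness bounds the gradient. The bound becomes the Lipschitz constant of the
  extension by zero.\<close>

lemma C1_compact_support_grad:
  assumes S: "hs_open S" and F: "C1 S F" and K: "compact K" "K \<subseteq> S" "\<And>x. x \<in> S - K \<Longrightarrow> F x = 0"
  obtains B where "B \<ge> 0" "\<And>x. x \<in> S \<Longrightarrow> norm (grad S F x) \<le> B" "\<And>x. x \<in> S - K \<Longrightarrow> grad S F x = 0"
proof -
  have o: "openin (top_of_set S) (S - K)"
    using K(1) by (metis Diff_Int2 Int_absorb compact_imp_closed open_Compl openin_open_Int Diff_eq inf_commute)
  have z: "grad S F x = 0" if x: "x \<in> S - K" for x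
  proof -
    have hs: "hs_open (S - K)" using hs_open_openin[OF S o] .
    have "partial S i F x = 0" for i
    proof -
      have "partial S i F x = partial (S - K) i F x" using partial_openin[OF o x] by simp
      also have "\<dots> = partial (S - K) i (\<lambda>x. 0) x" by (rule partial_cong) (use K x in auto)
      also have "\<dots> = 0" using hs x by simp
      finally show ?thesis .
    qed
    then show ?thesis by (simp add: vec_eq_iff)
  qed
  have "compact (grad S F ` K)"
    using F K by (meson C1_def compact_continuous_image continuous_on_subset)
  then obtain B where B: "\<And>x. x \<in> K \<Longrightarrow> norm (grad S F x) \<le> B"
    by (metis bounded_iff compact_imp_bounded imageI)
  show ?thesis
  proof (rule that[of "max B 0"])
    fix x assume "x \<in> S"
    then show "norm (grad S F x) \<le> max B 0" using B z by (cases "x \<in> K") (auto simp: le_max_iff_disj)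
  qed (use z in auto)
qed

text \<open>Inside the closed half-space, which is convex, the mean value inequality gives the
  Lipschitz bound. A segment leaving the half-space crosses the hyperplane, where the extension is 0
  by the boundary condition. On the hyperplane itself the extension may have a corner, so
  differentiability is claimed only away from it.\<close>

lemma extend_by_zero_lipschitz:
  fixes b :: "real^'n::finite"
  assumes S: "openin (top_of_set {x. 0 \<le> b \<bullet> x}) S" and F: "C1 S F"
    and K: "compact K" "K \<subseteq> S" "\<And>x. x \<in> S - K \<Longrightarrow> F x = 0"
    and bd: "\<And>x. x \<in> S \<Longrightarrow> x \<notin> interior S \<Longrightarrow> F x = 0"
  defines "E \<equiv> \<lambda>x. if x \<in> S then F x else 0" and "G \<equiv> \<lambda>x. if x \<in> S then grad S F x else 0"
  obtains B where "B \<ge> 0" "\<And>x y. \<bar>E x - E y\<bar> \<le> B * norm (x - y)"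
    "\<And>x. b = 0 \<or> b \<bullet> x \<noteq> 0 \<Longrightarrow> (E has_derivative (\<lambda>h. G x \<bullet> h)) (at x)"
proof -
  let ?H = "{x. 0 \<le> b \<bullet> x}"
  have hs: "hs_open S" using S by (auto simp: hs_open_def)
  obtain B where B: "B \<ge> 0" "\<And>x. x \<in> S \<Longrightarrow> norm (grad S F x) \<le> B" "\<And>x. x \<in> S - K \<Longrightarrow> grad S F x = 0"
    using C1_compact_support_grad[OF hs F K] by metis
  have SH: "S \<subseteq> ?H" using S openin_imp_subset by blast
  have Kz: "E y = 0" if "y \<notin> K" for y using K that by (auto simp: E_def)
  have offK: "(E has_derivative (\<lambda>h. G x \<bullet> h)) (at x)" if "x \<notin> K" for x
  proof -
    have "G x = 0" using that B(3) by (auto simp: G_def)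
    moreover have "(E has_derivative (\<lambda>h. 0)) (at x)"
      by (rule has_derivative_transform_within_open[of "\<lambda>x. 0" _ _ _ "- K"])
        (use that Kz compact_imp_closed[OF K(1)] in auto)
    ultimately show ?thesis by simp
  qed
  have DH: "(E has_derivative (\<lambda>h. G x \<bullet> h)) (at x within ?H)" if x: "x \<in> ?H" for x
  proof (cases "x \<in> S")
    case True
    have "(E has_derivative (\<lambda>h. grad S F x \<bullet> h)) (at x within S)"
      by (rule has_derivative_transform[OF True _ C1_has_derivative[OF F True]]) (simp add: E_def)
    then show ?thesis using at_within_openin[OF S True] True by (simp add: G_def)
  next
    case False
    then show ?thesis using offK K(2) has_derivative_at_withinI by blast
  qed
  have LH: "\<bar>E x - E y\<bar> \<le> B * norm (x - y)" if "x \<in> ?H" "y \<in> ?H" for x y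
  proof -
    have "norm (E x - E y) \<le> B * norm (x - y)"
    proof (rule differentiable_bound[OF _ DH])
      show "convex ?H" by (rule convex_halfspace_ge)
      show "onorm ((\<bullet>) (G x)) \<le> B" for x
      proof (rule onorm_le)
        fix v :: "real^'n"
        have "norm (G x) \<le> B" using B by (simp add: G_def)
        then have "norm (G x) * norm v \<le> B * norm v" by (intro mult_right_mono) auto
        then show "norm (G x \<bullet> v) \<le> B * norm v" using Cauchy_Schwarz_ineq2[of "G x" v] by simp
      qed
    qed (use that in auto)
    then show ?thesis by simp
  qed
  have L1: "\<bar>E x\<bar> \<le> B * norm (x - y)" if x: "x \<in> ?H" and y: "y \<notin> ?H" for x y
  proof -
    have b: "b \<noteq> 0" using y by auto
    \<comment> \<open>The parameter at which the segment from \<open>x\<close> to \<open>y\<close>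
      meets the hyperplane.\<close>
    define t where "t = b \<bullet> x / (b \<bullet> x - b \<bullet> y)"
    have t: "0 \<le> t" "t \<le> 1" using x y by (auto simp: t_def divide_simps)
    define z where "z = x + t *\<^sub>R (y - x)"
    have "b \<bullet> x - b \<bullet> y > 0" using x y by auto
    then have "t * (b \<bullet> x - b \<bullet> y) = b \<bullet> x" by (simp add: t_def)
    then have bz: "b \<bullet> z = 0" by (simp add: z_def algebra_simps inner_add_right inner_diff_right)
    have "E z = 0"
    proof (cases "z \<in> S")
      case True
      \<comment> \<open>A point of the hyperplane is not interior to the half-space, hence not
        interior to \<open>S\<close>, so the boundary condition applies to it.\<close>
      have "z \<notin> interior ?H" using bz by (simp add: interior_halfspace_ge[OF b])
      then have "z \<notin> interior S" using interior_mono[OF SH] by blast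
      then show ?thesis using bd True by (simp add: E_def)
    qed (simp add: E_def)
    then have "\<bar>E x\<bar> \<le> B * norm (x - z)" using LH[OF x, of z] bz by simp
    also have "norm (x - z) = t * norm (x - y)" using t by (simp add: z_def norm_minus_commute)
    also have "B * (t * norm (x - y)) \<le> B * norm (x - y)"
      using t B(1) by (intro mult_left_mono) (auto simp: mult_left_le_one_le)
    finally show ?thesis .
  qed
  have Eo: "E x = 0" if "x \<notin> ?H" for x using SH that by (auto simp: E_def)
  show ?thesis
  proof (rule that[OF B(1)])
    fix x y
    show "\<bar>E x - E y\<bar> \<le> B * norm (x - y)"
    proof (cases "x \<in> ?H")
      case x: True
      show ?thesis
      proof (cases "y \<in> ?H")
        case True then show ?thesis using LH x by blast
      next
        case False then show ?thesis using L1[OF x False] Eo[OF False] by simp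
      qed
    next
      case x: False
      show ?thesis
      proof (cases "y \<in> ?H")
        case True then show ?thesis using L1[OF True x] Eo[OF x] by (simp add: norm_minus_commute)
      next
        case False then show ?thesis using Eo[OF x] Eo[OF False] B(1) by simp
      qed
    qed
  next
    fix x assume x: "b = 0 \<or> b \<bullet> x \<noteq> 0"
    show "(E has_derivative (\<lambda>h. G x \<bullet> h)) (at x)"
    proof (cases "x \<in> ?H")
      case True
      have "x \<in> interior ?H"
      proof (cases "b = 0")
        case False
        then show ?thesis using x True by (simp only: interior_halfspace_ge) simp
      qed simp
      then have "at x within ?H = at x" by (rule at_within_interior)
      then show ?thesis using DH[OF True] by metis
    next
      case False
      then show ?thesis using offK K SH by blast
    qed
  qed
qed

text \<open>No Fubini argument is needed: the extension by zero is Lipschitz, so by dominated convergence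
  the integral of its partial derivative is the limit of integrals of difference quotients, which
  vanish by translation invariance.\<close>

lemma integral_partial_eq_0:
  fixes b :: "real^'n::finite"
  assumes S: "openin (top_of_set {x. 0 \<le> b \<bullet> x}) S" and F: "C1 S F"
    and K: "compact K" "K \<subseteq> S" "\<And>x. x \<in> S - K \<Longrightarrow> F x = 0"
    and bd: "\<And>x. x \<in> S \<Longrightarrow> x \<notin> interior S \<Longrightarrow> F x = 0"
  shows "integrable lborel (\<lambda>x. indicator S x * partial S i F x)"
    and "(\<integral>x. indicator S x * partial S i F x \<partial>lborel) = 0"
proof -
  define E where "E \<equiv> \<lambda>x. if x \<in> S then F x else 0"
  define G where "G \<equiv> \<lambda>x. if x \<in> S then grad S F x else 0"
  obtain B where B: "B \<ge> 0" "\<forall>x y. \<bar>E x - E y\<bar> \<le> B * norm (x - y)"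
    "\<forall>x. b = 0 \<or> b \<bullet> x \<noteq> 0 \<longrightarrow> (E has_derivative (\<lambda>h. G x \<bullet> h)) (at x)"
  proof (rule extend_by_zero_lipschitz[OF S F K bd])
    fix B
    assume "B \<ge> 0" "\<And>x y. \<bar>(if x \<in> S then F x else 0) - (if y \<in> S then F y else 0)\<bar> \<le> B * norm (x - y)"
      "\<And>x. b = 0 \<or> b \<bullet> x \<noteq> 0 \<Longrightarrow> ((\<lambda>x. if x \<in> S then F x else 0) has_derivative
        (\<lambda>h. (if x \<in> S then grad S F x else 0) \<bullet> h)) (at x)"
    then show thesis by (intro that[of B]) (simp_all add: E_def G_def)
  qed
  obtain R where R: "R > 0" "K \<subseteq> cball 0 R"
    using bounded_subset_ballD[OF compact_imp_bounded[OF K(1)], of 0] ball_subset_cball by blast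
  have Kz: "E y = 0" if "y \<notin> K" for y using K that by (auto simp: E_def)
  have "continuous_on UNIV E"
  proof (rule lipschitz_on_continuous_on)
    show "B-lipschitz_on UNIV E" using B by (intro lipschitz_onI) (auto simp: dist_norm)
  qed
  then have Em: "E \<in> borel_measurable borel" by (rule borel_measurable_continuous_onI)
  have "compact (E ` K)" using \<open>continuous_on UNIV E\<close> K(1) by (meson compact_continuous_image continuous_on_subset subset_UNIV)
  then obtain C where C: "\<And>x. x \<in> K \<Longrightarrow> \<bar>E x\<bar> \<le> C"
    by (metis bounded_iff compact_imp_bounded imageI real_norm_def)
  have Ei: "integrable lborel E"
  proof (rule integrable_indicator_compact_bound[OF Em, of "max C 0" R])
    fix x show "\<bar>E x\<bar> \<le> max C 0 * indicator (cball 0 R) x"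
    proof (cases "x \<in> K")
      case True
      then have "x \<in> cball 0 R" using R by blast
      then show ?thesis using C[OF True] by (simp add: indicator_def)
    next
      case False then show ?thesis using Kz by (simp add: indicator_def)
    qed
  qed
  define e where "e = (axis i 1 :: real^'n)"
  have ne: "norm e = 1" by (simp add: e_def)
  define h where "h n = inverse (real (Suc n))" for n
  have h: "h n > 0" "h n \<le> 1" for n by (auto simp: h_def inverse_le_1_iff)
  have h0: "h \<longlonglongrightarrow> 0" unfolding h_def by (rule LIMSEQ_inverse_real_of_nat)
  define q where "q n x = (E (h n *\<^sub>R e + x) - E x) / h n" for n x
  have tr: "integrable lborel (\<lambda>x. E (c + x))" "(\<integral>x. E (c + x) \<partial>lborel) = (\<integral>x. E x \<partial>lborel)" for c
  proof -
    have "integrable (distr lborel borel ((+) c)) E" using Ei by (simp add: lborel_distr_plus)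
    then show "integrable lborel (\<lambda>x. E (c + x))" by (subst (asm) integrable_distr_eq) (use Em in auto)
    have "(\<integral>x. E x \<partial>distr lborel borel ((+) c)) = (\<integral>x. E (c + x) \<partial>lborel)"
      by (rule integral_distr) (use Em in auto)
    then show "(\<integral>x. E (c + x) \<partial>lborel) = (\<integral>x. E x \<partial>lborel)" by (simp add: lborel_distr_plus)
  qed
  have q0: "(\<integral>x. q n x \<partial>lborel) = 0" for n
    unfolding q_def using tr Ei by simp
  have qm: "q n \<in> borel_measurable borel" for n
    unfolding q_def using Em by measurable
  let ?D = "\<lambda>x. indicator S x * partial S i F x"
  have Dm: "?D \<in> borel_measurable lborel"
  proof -
    have "S \<in> sets borel"
    proof -
      obtain T where "open T" "S = {x. 0 \<le> b \<bullet> x} \<inter> T" using S by (auto simp: openin_open)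
      then show ?thesis using closed_halfspace_ge[of 0 b] by auto
    qed
    then have "(\<lambda>x. indicator S x *\<^sub>R partial S i F x) \<in> borel_measurable borel"
      using C1_continuous_partial[OF F] by (rule borel_measurable_continuous_on_indicator)
    then show ?thesis by simp
  qed
  \<comment> \<open>The Lipschitz constant bounds the quotients. Since the step is at most 1 and
    \<open>K\<close> lies in the ball of radius \<open>R\<close>, all of them vanish outside the
    ball of radius \<open>R + 1\<close>.\<close>
  have qb: "norm (q n x) \<le> B * indicator (cball 0 (R + 1)) x" for n x
  proof (cases "x \<in> cball 0 (R + 1)")
    case True
    have "\<bar>E (h n *\<^sub>R e + x) - E x\<bar> \<le> B * h n" using B(2)[rule_format, of "h n *\<^sub>R e + x" x] ne h[of n] by simp
    then show ?thesis using True h[of n] by (simp add: q_def field_simps)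
  next
    case False
    then have "norm x > R + 1" by simp
    moreover have "norm x \<le> norm (h n *\<^sub>R e + x) + norm (h n *\<^sub>R e)"
      by (metis add.commute add_diff_cancel norm_triangle_sub norm_minus_commute add_diff_cancel_left')
    ultimately have "norm (h n *\<^sub>R e + x) > R" using ne h[of n] by simp
    then have "h n *\<^sub>R e + x \<notin> K" "x \<notin> K" using R \<open>norm x > R + 1\<close> by auto
    then show ?thesis using Kz B(1) by (simp add: q_def indicator_def)
  qed
  have lim: "(\<lambda>n. q n x) \<longlonglongrightarrow> ?D x" if x: "b = 0 \<or> b \<bullet> x \<noteq> 0" for x
  proof -
    have "((\<lambda>y. E (x + y *\<^sub>R e)) has_derivative (\<lambda>y. G x \<bullet> (y *\<^sub>R e))) (at 0)"
      by (rule has_derivative_compose[of "\<lambda>y. x + y *\<^sub>R e" "\<lambda>y. y *\<^sub>R e" 0 UNIV E])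
        (use B(3) x in \<open>auto intro!: derivative_eq_intros\<close>)
    then have "((\<lambda>y. E (x + y *\<^sub>R e)) has_field_derivative (G x \<bullet> e)) (at 0)"
      by (simp add: has_field_derivative_def mult_commute_abs)
    then have "((\<lambda>y. (E (x + y *\<^sub>R e) - E x) / y) \<longlongrightarrow> G x \<bullet> e) (at 0)"
      by (simp add: has_field_derivative_iff)
    moreover have "filterlim h (at 0) sequentially"
      using h0 h(1) by (intro filterlim_atI) (auto simp: less_imp_neq[symmetric])
    ultimately have "(\<lambda>n. (E (x + h n *\<^sub>R e) - E x) / h n) \<longlonglongrightarrow> G x \<bullet> e"
      by (rule filterlim_compose)
    moreover have "G x \<bullet> e = ?D x" by (simp add: G_def e_def inner_axis)
    ultimately show ?thesis by (simp add: q_def add.commute)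
  qed
  \<comment> \<open>Pointwise convergence can fail only on the bounding hyperplane, which is a null
    set.\<close>
  have AE: "AE x in lborel. (\<lambda>n. q n x) \<longlonglongrightarrow> ?D x"
  proof (cases "b = 0")
    case True then show ?thesis using lim by simp
  next
    case False
    then have "negligible {x. b \<bullet> x = 0}" by (intro negligible_hyperplane) auto
    then have "{x. b \<bullet> x = 0} \<in> null_sets lebesgue" by (simp add: negligible_iff_null_sets)
    moreover have "{x. b \<bullet> x = 0} \<in> sets borel" using closed_hyperplane[of b 0] by (rule borel_closed)
    ultimately have "{x. b \<bullet> x = 0} \<in> null_sets lborel" by (simp add: null_sets_def)
    then have "AE x in lborel. x \<notin> {x. b \<bullet> x = 0}" by (rule AE_not_in)
    then show ?thesis by (rule eventually_mono) (rule lim, simp)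
  qed
  have w: "integrable lborel (\<lambda>x. B * indicator (cball 0 (R + 1)) x :: real)"
    by (rule integrable_const_cball)
  have qm': "\<And>n. q n \<in> borel_measurable lborel" using qm by simp
  note dc = integral_dominated_convergence[OF Dm qm' w AE] integrable_dominated_convergence[OF Dm qm' w AE]
  show "integrable lborel ?D" using dc(2) qb by simp
  have "(\<lambda>n. \<integral>x. q n x \<partial>lborel) \<longlonglongrightarrow> (\<integral>x. ?D x \<partial>lborel)" using dc(1) qb by simp
  then show "(\<integral>x. ?D x \<partial>lborel) = 0" using q0 by (simp add: LIMSEQ_const_iff)
qed

section \<open>Determinants and inverses of matrix families\<close>

lemma matrix_inv_right_left:
  fixes A :: "real^'n::finite^'n"
  assumes "det A \<noteq> 0"
  shows "A ** matrix_inv A = mat 1" and "matrix_inv A ** A = mat 1"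
proof -
  have "invertible A" using assms by (simp add: invertible_det_nz)
  then have "A ** matrix_inv A = mat 1 \<and> matrix_inv A ** A = mat 1"
    unfolding invertible_def matrix_inv_def by (rule someI_ex)
  then show "A ** matrix_inv A = mat 1" "matrix_inv A ** A = mat 1" by auto
qed

lemma matrix_inv_eqI:
  fixes A :: "real^'n::finite^'n"
  assumes "A ** B = mat 1"
  shows "matrix_inv A = B"
proof -
  have "det A * det B = 1" using assms by (metis det_I det_mul)
  then have "det A \<noteq> 0" by auto
  then have "matrix_inv A ** (A ** B) = B"
    using matrix_inv_right_left(2)[of A] by (simp add: matrix_mul_assoc)
  then show ?thesis using assms by simp
qed

lemma matrix_inv_transpose_symmetric:
  fixes A :: "real^'n::finite^'n"
  assumes "det A \<noteq> 0" "transpose A = A"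
  shows "transpose (matrix_inv A) = matrix_inv A"
proof -
  have "A ** transpose (matrix_inv A) = transpose (matrix_inv A ** A)"
    using assms(2) by (simp add: matrix_transpose_mul)
  then have "A ** transpose (matrix_inv A) = mat 1"
    using matrix_inv_right_left(2)[OF assms(1)] by simp
  then show ?thesis using matrix_inv_eqI by metis
qed

lemma matrix_inv_sums:
  fixes A :: "real^'n::finite^'n"
  assumes "det A \<noteq> 0"
  shows "(\<Sum>k\<in>UNIV. A $ i $ k * matrix_inv A $ k $ j) = (if i = j then 1 else 0)"
    and "(\<Sum>k\<in>UNIV. matrix_inv A $ i $ k * A $ k $ j) = (if i = j then 1 else 0)"
  using matrix_inv_right_left[OF assms]
  by (auto simp: matrix_matrix_mult_def mat_def vec_eq_iff)

text \<open>Cramer's rule exhibits the entries of the inverse as quotients of polynomials in the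
  entries of \<open>A\<close>. Class C1, differentiability in a parameter and Lipschitz bounds all
  pass to the inverse through this formula.\<close>

lemma matrix_inv_cramer:
  fixes A :: "real^'n::finite^'n"
  assumes "det A \<noteq> 0"
  shows "matrix_inv A $ i $ j = det (\<chi> r s. if s = i then (if r = j then 1 else 0) else A $ r $ s) / det A"
proof -
  define x where "x = (\<chi> k. matrix_inv A $ k $ j)"
  have "A *v x = axis j 1"
    using matrix_inv_sums(1)[OF assms, of _ j]
    by (simp add: matrix_vector_mult_def x_def vec_eq_iff axis_def)
  then have "x = (\<chi> k. det (\<chi> r s. if s = k then axis j 1 $ r else A $ r $ s) / det A)"
    using cramer[OF assms] by blast
  then have "x $ i = det (\<chi> r s. if s = i then axis j 1 $ r else A $ r $ s) / det A" by simp
  moreover have "(\<chi> r s. if s = i then axis j 1 $ r else A $ r $ s)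
      = (\<chi> r s. if s = i then (if r = j then 1 else 0) else A $ r $ s)"
    by (simp add: axis_def vec_eq_iff)
  ultimately show ?thesis by (simp add: x_def)
qed

lemma C1_det:
  assumes "hs_open S" "\<And>i j. C1 S (\<lambda>x. A x $ i $ j)"
  shows "C1 S (\<lambda>x. det (A x))"
  unfolding det_def by (intro C1_sum C1_mult C1_prod C1_const assms)

lemma C1_matrix_inv:
  assumes "hs_open S" "\<And>i j. C1 S (\<lambda>x. A x $ i $ j)" "\<And>x. x \<in> S \<Longrightarrow> det (A x) \<noteq> 0"
  shows "C1 S (\<lambda>x. matrix_inv (A x) $ i $ j)"
proof -
  have e: "C1 S (\<lambda>x. (\<chi> r s. if s = i then (if r = j then 1 else 0) else A x $ r $ s) $ a $ b)" for a b
    using assms(1,2) by (cases "b = i"; cases "a = j") simp_all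
  have "C1 S (\<lambda>x. det (\<chi> r s. if s = i then (if r = j then 1 else 0) else A x $ r $ s) * inverse (det (A x)))"
    by (intro C1_mult C1_det C1_inverse assms e)
  then show ?thesis
    by (subst C1_cong[where g = "\<lambda>x. det (\<chi> r s. if s = i then (if r = j then 1 else 0) else A x $ r $ s) * inverse (det (A x))"])
      (simp_all add: matrix_inv_cramer assms(3) divide_inverse)
qed

text \<open>Write \<open>v\<close> as a combination of the rows of \<open>A\<close>, with
  coefficients \<open>y\<close> read off from the inverse. Only the multiple of row \<open>i\<close>
  contributes to the determinant.\<close>

lemma det_replace_row:
  fixes A :: "real^'n::finite^'n"
  assumes "det A \<noteq> 0"
  shows "det (\<chi> r. if r = i then v else A $ r) = det A * (\<Sum>j\<in>UNIV. matrix_inv A $ j $ i * v $ j)"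
proof -
  define y where "y = (\<chi> r. \<Sum>j\<in>UNIV. matrix_inv A $ j $ r * v $ j)"
  have "(\<Sum>r\<in>UNIV. y $ r *s row r A) $ s = v $ s" for s
  proof -
    have "(\<Sum>r\<in>UNIV. y $ r *s row r A) $ s = (\<Sum>r\<in>UNIV. \<Sum>j\<in>UNIV. v $ j * (matrix_inv A $ j $ r * A $ r $ s))"
      by (simp add: y_def row_def sum_distrib_right sum_distrib_left mult_ac)
    also have "\<dots> = (\<Sum>j\<in>UNIV. v $ j * (\<Sum>r\<in>UNIV. matrix_inv A $ j $ r * A $ r $ s))"
      by (subst sum.swap) (simp add: sum_distrib_left)
    also have "\<dots> = v $ s" by (simp add: matrix_inv_sums(2)[OF assms] if_distrib sum.delta cong: if_cong)
    finally show ?thesis .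
  qed
  then have v: "(\<Sum>r\<in>UNIV. y $ r *s row r A) = v" by (simp add: vec_eq_iff)
  have "(\<chi> r. if r = i then v else A $ r) = (\<chi> r. if r = i then v else row r A)"
    by (simp add: row_def vec_eq_iff)
  then have "det (\<chi> r. if r = i then v else A $ r) = y $ i * det A"
    using cramer_lemma_transpose[of i y A] unfolding v by simp
  then show ?thesis by (simp add: y_def)
qed

text \<open>Jacobi's formula. The product rule in the Leibniz expansion yields one determinant per
  row, with that row replaced by its derivative. The domain is an arbitrary normed space so that
  both spatial derivatives and the derivative in t are covered.\<close>

lemma has_derivative_det:
  fixes A :: "'a::real_normed_vector \<Rightarrow> real^'n::finite^'n"
  assumes A: "\<And>i j. ((\<lambda>x. A x $ i $ j) has_derivative A' i j) (at x within S)" and d: "det (A x) \<noteq> 0"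
  shows "((\<lambda>x. det (A x)) has_derivative
    (\<lambda>h. det (A x) * (\<Sum>i\<in>UNIV. \<Sum>j\<in>UNIV. matrix_inv (A x) $ j $ i * A' i j h))) (at x within S)"
proof -
  let ?P = "{p. p permutes (UNIV :: 'n set)}"
  have "((\<lambda>x. det (A x)) has_derivative
    (\<lambda>h. \<Sum>p\<in>?P. of_int (sign p) * (\<Sum>i\<in>UNIV. A' i (p i) h * (\<Prod>j\<in>UNIV - {i}. A x $ j $ p j)))) (at x within S)"
    unfolding det_def by (intro has_derivative_sum has_derivative_mult_right has_derivative_prod A)
  moreover have "(\<Sum>p\<in>?P. of_int (sign p) * (\<Sum>i\<in>UNIV. A' i (p i) h * (\<Prod>j\<in>UNIV - {i}. A x $ j $ p j)))
     = det (A x) * (\<Sum>i\<in>UNIV. \<Sum>j\<in>UNIV. matrix_inv (A x) $ j $ i * A' i j h)" for h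
  proof -
    have "(\<Sum>p\<in>?P. of_int (sign p) * (\<Sum>i\<in>UNIV. A' i (p i) h * (\<Prod>j\<in>UNIV - {i}. A x $ j $ p j)))
      = (\<Sum>i\<in>UNIV. \<Sum>p\<in>?P. of_int (sign p) * (A' i (p i) h * (\<Prod>j\<in>UNIV - {i}. A x $ j $ p j)))"
      by (subst sum.swap) (simp add: sum_distrib_left)
    also have "\<dots> = (\<Sum>i\<in>UNIV. det (\<chi> r. if r = i then (\<chi> j. A' i j h) else A x $ r))"
    proof (rule sum.cong[OF refl])
      fix i :: 'n
      have "(\<Prod>r\<in>UNIV. (\<chi> r. if r = i then (\<chi> j. A' i j h) else A x $ r) $ r $ p r)
        = A' i (p i) h * (\<Prod>j\<in>UNIV - {i}. A x $ j $ p j)" for p :: "'n \<Rightarrow> 'n"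
        by (subst prod.remove[of UNIV i]) (auto intro!: prod.cong)
      then show "(\<Sum>p\<in>?P. of_int (sign p) * (A' i (p i) h * (\<Prod>j\<in>UNIV - {i}. A x $ j $ p j)))
        = det (\<chi> r. if r = i then (\<chi> j. A' i j h) else A x $ r)"
        unfolding det_def by (metis (no_types, lifting))
    qed
    finally show ?thesis by (simp add: det_replace_row[OF d] sum_distrib_left)
  qed
  ultimately show ?thesis by simp
qed

text \<open>The hypothesis \<open>eq\<close> is the differentiated identity of \<open>A\<close>
  times its inverse with the unit matrix, in entries; multiplying by the inverse from the left
  solves it for \<open>D\<close>.\<close>

lemma matrix_inv_derivative_algebra:
  fixes A :: "real^'n::finite^'n" and D A' :: "'n \<Rightarrow> 'n \<Rightarrow> real"
  assumes d: "det A \<noteq> 0"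
    and eq: "\<And>i j. (\<Sum>k\<in>UNIV. A $ i $ k * D k j + matrix_inv A $ k $ j * A' i k) = 0"
  shows "D i j = - (\<Sum>a\<in>UNIV. \<Sum>b\<in>UNIV. matrix_inv A $ i $ a * A' a b * matrix_inv A $ b $ j)"
proof -
  have eq': "(\<Sum>k\<in>UNIV. A $ a $ k * D k j) = - (\<Sum>b\<in>UNIV. A' a b * matrix_inv A $ b $ j)" for a
    using eq[of a j] by (simp add: sum.distrib mult.commute[of "matrix_inv A $ _ $ j"] eq_neg_iff_add_eq_0)
  have "D i j = (\<Sum>k\<in>UNIV. (\<Sum>a\<in>UNIV. matrix_inv A $ i $ a * A $ a $ k) * D k j)"
    by (simp add: matrix_inv_sums(2)[OF d] if_distrib[of "\<lambda>x. x * _"] sum.delta cong: if_cong)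
  also have "\<dots> = (\<Sum>a\<in>UNIV. matrix_inv A $ i $ a * (\<Sum>k\<in>UNIV. A $ a $ k * D k j))"
    by (simp add: sum_distrib_left sum_distrib_right mult.assoc) (rule sum.swap)
  also have "\<dots> = - (\<Sum>a\<in>UNIV. \<Sum>b\<in>UNIV. matrix_inv A $ i $ a * A' a b * matrix_inv A $ b $ j)"
    by (simp add: eq' sum_distrib_left sum_negf mult.assoc)
  finally show ?thesis .
qed

lemma partial_det:
  fixes A :: "real^'n::finite \<Rightarrow> real^'n^'n"
  assumes S: "hs_open S" "x \<in> S" and A: "\<And>i j. C1 S (\<lambda>x. A x $ i $ j)" and d: "det (A x) \<noteq> 0"
  shows "partial S k (\<lambda>x. det (A x)) x
    = det (A x) * (\<Sum>i\<in>UNIV. \<Sum>j\<in>UNIV. matrix_inv (A x) $ j $ i * partial S k (\<lambda>x. A x $ i $ j) x)"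
proof -
  have "((\<lambda>x. det (A x)) has_derivative (\<lambda>h. det (A x) * (\<Sum>i\<in>UNIV. \<Sum>j\<in>UNIV. matrix_inv (A x) $ j $ i *
      (grad S (\<lambda>x. A x $ i $ j) x \<bullet> h)))) (at x within S)"
    by (rule has_derivative_det[OF C1_has_derivative[OF A S(2)] d])
  from hs_open_frechet_derivative[OF S this] show ?thesis
    unfolding partial_def[of S k "\<lambda>x. det (A x)"] by (simp add: inner_axis)
qed

lemma partial_matrix_inv:
  fixes A :: "real^'n::finite \<Rightarrow> real^'n^'n"
  assumes S: "hs_open S" "x \<in> S" and A: "\<And>i j. C1 S (\<lambda>x. A x $ i $ j)" and d: "\<And>x. x \<in> S \<Longrightarrow> det (A x) \<noteq> 0"
  shows "partial S k (\<lambda>x. matrix_inv (A x) $ i $ j) x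
    = - (\<Sum>a\<in>UNIV. \<Sum>b\<in>UNIV. matrix_inv (A x) $ i $ a * partial S k (\<lambda>x. A x $ a $ b) x * matrix_inv (A x) $ b $ j)"
proof (rule matrix_inv_derivative_algebra[OF d[OF S(2)]])
  fix i j :: 'n
  have B: "C1 S (\<lambda>x. matrix_inv (A x) $ i $ j)" for i j by (rule C1_matrix_inv[OF S(1) A d])
  have "0 = partial S k (\<lambda>x. (if i = j then 1 else 0)) x" using S by simp
  also have "\<dots> = partial S k (\<lambda>x. \<Sum>l\<in>UNIV. A x $ i $ l * matrix_inv (A x) $ l $ j) x"
    by (rule partial_cong[OF _ S(2)]) (simp add: matrix_inv_sums(1)[OF d])
  also have "\<dots> = (\<Sum>l\<in>UNIV. partial S k (\<lambda>x. A x $ i $ l * matrix_inv (A x) $ l $ j) x)"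
    by (rule partial_sum[OF S]) (intro C1_differentiable[OF _ S(2)] C1_mult S A B)
  also have "\<dots> = (\<Sum>l\<in>UNIV. A x $ i $ l * partial S k (\<lambda>x. matrix_inv (A x) $ l $ j) x
      + matrix_inv (A x) $ l $ j * partial S k (\<lambda>x. A x $ i $ l) x)"
    by (rule sum.cong[OF refl], rule partial_mult[OF S]) (rule C1_differentiable[OF _ S(2)], rule A B)+
  finally show "(\<Sum>l\<in>UNIV. A x $ i $ l * partial S k (\<lambda>x. matrix_inv (A x) $ l $ j) x
      + matrix_inv (A x) $ l $ j * partial S k (\<lambda>x. A x $ i $ l) x) = 0" by simp
qed

lemma has_real_derivative_det:
  fixes A :: "real \<Rightarrow> real^'n::finite^'n"
  assumes A: "\<And>i j. ((\<lambda>t. A t $ i $ j) has_real_derivative A' i j) (at t)" and d: "det (A t) \<noteq> 0"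
  shows "((\<lambda>t. det (A t)) has_real_derivative
    det (A t) * (\<Sum>i\<in>UNIV. \<Sum>j\<in>UNIV. matrix_inv (A t) $ j $ i * A' i j)) (at t)"
proof -
  have "((\<lambda>t. det (A t)) has_derivative (\<lambda>h. det (A t) * (\<Sum>i\<in>UNIV. \<Sum>j\<in>UNIV. matrix_inv (A t) $ j $ i * (A' i j * h)))) (at t)"
    using has_derivative_det[of A "\<lambda>i j h. A' i j * h" t UNIV] A d by (simp add: has_field_derivative_def)
  then show ?thesis
    unfolding has_field_derivative_def
    by (rule has_derivative_eq_rhs) (simp add: fun_eq_iff sum_distrib_left sum_distrib_right mult_ac)
qed

text \<open>Existence and value are separate matters: Cramer's rule gives differentiability, and
  then differentiating the product of \<open>A\<close> and its inverse determines the value.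
  Invertibility on the open set \<open>I\<close> makes that product constant near
  \<open>t\<close>.\<close>

lemma has_real_derivative_matrix_inv:
  fixes A :: "real \<Rightarrow> real^'n::finite^'n"
  assumes A: "\<And>i j. ((\<lambda>t. A t $ i $ j) has_real_derivative A' i j) (at t)"
    and I: "open I" "t \<in> I" and d: "\<And>s. s \<in> I \<Longrightarrow> det (A s) \<noteq> 0"
  shows "((\<lambda>t. matrix_inv (A t) $ i $ j) has_real_derivative
    - (\<Sum>a\<in>UNIV. \<Sum>b\<in>UNIV. matrix_inv (A t) $ i $ a * A' a b * matrix_inv (A t) $ b $ j)) (at t)"
proof -
  have "\<exists>D. ((\<lambda>t. matrix_inv (A t) $ i $ j) has_real_derivative D) (at t)" for i j
  proof -
    let ?C = "\<lambda>t. (\<chi> r s. if s = i then (if r = j then 1 else 0) else A t $ r $ s) :: real^'n^'n"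
    have e: "(\<lambda>t. ?C t $ a $ b) differentiable (at t)" for a b
      using A[of a b] by (cases "b = i"; cases "a = j") (auto simp: real_differentiable_def)
    have dd: "(\<lambda>t. det (B t)) differentiable (at t)" if "\<And>a b. (\<lambda>t. B t $ a $ b) differentiable (at t)" for B :: "real \<Rightarrow> real^'n^'n"
    proof -
      have "(\<lambda>t. \<Prod>a\<in>R. B t $ a $ p a) differentiable (at t)" for p and R :: "'n set"
        by (induction R rule: infinite_finite_induct) (auto intro!: differentiable_mult that)
      then show ?thesis unfolding det_def by (intro differentiable_sum differentiable_mult) auto
    qed
    have "(\<lambda>t. det (?C t) / det (A t)) differentiable (at t)"
      by (intro differentiable_divide dd e d I) (use A in \<open>auto simp: real_differentiable_def\<close>)
    then obtain D where "((\<lambda>t. det (?C t) / det (A t)) has_real_derivative D) (at t)"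
      by (auto simp: real_differentiable_def)
    then have "((\<lambda>t. matrix_inv (A t) $ i $ j) has_real_derivative D) (at t)"
      by (rule has_field_derivative_transform_within_open[OF _ I]) (simp add: matrix_inv_cramer[OF d])
    then show ?thesis ..
  qed
  then obtain D where D: "\<And>i j. ((\<lambda>t. matrix_inv (A t) $ i $ j) has_real_derivative D i j) (at t)" by metis
  have "D i j = - (\<Sum>a\<in>UNIV. \<Sum>b\<in>UNIV. matrix_inv (A t) $ i $ a * A' a b * matrix_inv (A t) $ b $ j)" for i j
  proof (rule matrix_inv_derivative_algebra[OF d[OF I(2)]])
    fix i j
    have "((\<lambda>t. \<Sum>k\<in>UNIV. A t $ i $ k * matrix_inv (A t) $ k $ j) has_real_derivative
       (\<Sum>k\<in>UNIV. A t $ i $ k * D k j + matrix_inv (A t) $ k $ j * A' i k)) (at t)"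
      by (auto intro!: DERIV_sum derivative_eq_intros A D)
    moreover have "((\<lambda>t. \<Sum>k\<in>UNIV. A t $ i $ k * matrix_inv (A t) $ k $ j) has_real_derivative 0) (at t)"
      by (rule has_field_derivative_transform_within_open[OF DERIV_const[of "if i = j then 1 else 0"] I])
        (simp add: matrix_inv_sums(1)[OF d])
    ultimately show "(\<Sum>k\<in>UNIV. A t $ i $ k * D k j + matrix_inv (A t) $ k $ j * A' i k) = 0"
      by (rule DERIV_unique)
  qed
  then show ?thesis using D by metis
qed

text \<open>The segment from the unit matrix to \<open>A\<close> consists of positive definite,
  hence invertible matrices, so the determinant cannot change sign along it.\<close>

lemma det_pos_of_positive_definite:
  fixes A :: "real^'n::finite^'n"
  assumes "\<And>v. v \<noteq> 0 \<Longrightarrow> 0 < v \<bullet> (A *v v)"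
  shows "0 < det A"
proof (rule ccontr)
  assume "\<not> 0 < det A"
  define B where "B s = (\<chi> i j. (1 - s) * (mat 1 :: real^'n^'n) $ i $ j + s * A $ i $ j)" for s
  have "continuous_on {0..1} (\<lambda>s. det (B s))"
    unfolding det_def B_def by (auto intro!: continuous_intros)
  moreover have "det (B 1) \<le> 0" using \<open>\<not> 0 < det A\<close> by (simp add: B_def)
  moreover have "B 0 = mat 1" by (simp add: B_def vec_eq_iff)
  then have "0 \<le> det (B 0)" by simp
  ultimately obtain s where s: "0 \<le> s" "s \<le> 1" "det (B s) = 0"
    using IVT2'[of "\<lambda>s. det (B s)" 1 0 0] by auto
  then have "\<not> invertible (B s)" by (simp add: invertible_det_nz)
  then obtain v where v: "v \<noteq> 0" "B s *v v = 0"
    by (metis invertible_left_inverse matrix_left_invertible_ker)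
  have "B s *v v = (1 - s) *\<^sub>R v + s *\<^sub>R (A *v v)"
  proof -
    have "B s = (1 - s) *\<^sub>R mat 1 + s *\<^sub>R A" by (simp add: B_def vec_eq_iff)
    then show ?thesis
      by (simp add: matrix_vector_mult_add_rdistrib scaleR_matrix_vector_assoc[symmetric])
  qed
  then have "0 = (1 - s) * (v \<bullet> v) + s * (v \<bullet> (A *v v))"
    using v(2) by (metis inner_add_right inner_scaleR_right inner_zero_right)
  moreover have "0 < v \<bullet> v" "0 < v \<bullet> (A *v v)" using v assms by auto
  ultimately show False using s
    by (smt (verit) mult_nonneg_nonneg mult_pos_pos)
qed

text \<open>Here \<open>G\<close> is the inverse metric, \<open>D i a b\<close> the i-th derivative
  of the metric entry (a, b), and \<open>f\<close> the differential of a function. The left side is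
  the trace of the Christoffel part of the Hessian. On the right stand, up to sign, the terms
  produced by differentiating the inverse metric and the logarithm of sqrt (det g). This identity
  puts the Laplacian into divergence form.\<close>

lemma christoffel_trace_algebra:
  fixes G :: "'n::finite \<Rightarrow> 'n \<Rightarrow> real" and D :: "'n \<Rightarrow> 'n \<Rightarrow> 'n \<Rightarrow> real"
  assumes G: "\<And>i j. G i j = G j i" and D: "\<And>i j l. D i j l = D i l j"
  shows "(\<Sum>i\<in>UNIV. \<Sum>j\<in>UNIV. G i j * (\<Sum>k\<in>UNIV. (1/2 * (\<Sum>l\<in>UNIV. G k l * (D i j l + D j i l - D l i j))) * f k))
    = (\<Sum>i\<in>UNIV. \<Sum>j\<in>UNIV. (\<Sum>a\<in>UNIV. \<Sum>b\<in>UNIV. G i a * D i a b * G b j) * f j)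
      - (\<Sum>i\<in>UNIV. 1/2 * (\<Sum>a\<in>UNIV. \<Sum>b\<in>UNIV. G b a * D i a b) * (\<Sum>j\<in>UNIV. G i j * f j))"
proof -
  define y where "y l = (\<Sum>k\<in>UNIV. G l k * f k)" for l
  have 1: "(\<Sum>k\<in>UNIV. (1/2 * (\<Sum>l\<in>UNIV. G k l * (D i j l + D j i l - D l i j))) * f k)
      = 1/2 * (\<Sum>l\<in>UNIV. (D i j l + D j i l - D l i j) * y l)" for i j
  proof -
    have "(\<Sum>k\<in>UNIV. (1/2 * (\<Sum>l\<in>UNIV. G k l * (D i j l + D j i l - D l i j))) * f k)
      = (\<Sum>k\<in>UNIV. \<Sum>l\<in>UNIV. 1/2 * ((D i j l + D j i l - D l i j) * (G l k * f k)))"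
      by (simp add: sum_distrib_left sum_distrib_right mult_ac G)
    also have "\<dots> = (\<Sum>l\<in>UNIV. \<Sum>k\<in>UNIV. 1/2 * ((D i j l + D j i l - D l i j) * (G l k * f k)))"
      by (rule sum.swap)
    finally show ?thesis by (simp add: y_def sum_distrib_left)
  qed
  define X where "X = (\<Sum>i\<in>UNIV. \<Sum>j\<in>UNIV. \<Sum>l\<in>UNIV. G i j * D i j l * y l)"
  define Z where "Z = (\<Sum>i\<in>UNIV. \<Sum>j\<in>UNIV. \<Sum>l\<in>UNIV. G i j * D l i j * y l)"
  \<comment> \<open>Exchanging i and j shows that two of the three terms of the Christoffel symbol
    have the same trace.\<close>
  have X2: "(\<Sum>i\<in>UNIV. \<Sum>j\<in>UNIV. \<Sum>l\<in>UNIV. G i j * D j i l * y l) = X"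
    unfolding X_def by (subst sum.swap) (simp add: G)
  have "(\<Sum>i\<in>UNIV. \<Sum>j\<in>UNIV. G i j * (1/2 * (\<Sum>l\<in>UNIV. (D i j l + D j i l - D l i j) * y l)))
     = 1/2 * (\<Sum>i\<in>UNIV. \<Sum>j\<in>UNIV. \<Sum>l\<in>UNIV. G i j * D i j l * y l + G i j * D j i l * y l - G i j * D l i j * y l)"
    by (simp add: sum_distrib_left algebra_simps)
  also have "\<dots> = 1/2 * (X + X - Z)"
    by (simp only: sum.distrib sum_subtractf X2) (simp add: X_def Z_def)
  also have "\<dots> = X - 1/2 * Z" by simp
  also have "X = (\<Sum>i\<in>UNIV. \<Sum>j\<in>UNIV. (\<Sum>a\<in>UNIV. \<Sum>b\<in>UNIV. G i a * D i a b * G b j) * f j)"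
  proof -
    have "(\<Sum>j\<in>UNIV. \<Sum>l\<in>UNIV. G i j * D i j l * y l) = (\<Sum>j\<in>UNIV. (\<Sum>a\<in>UNIV. \<Sum>b\<in>UNIV. G i a * D i a b * G b j) * f j)" for i
    proof -
      have "(\<Sum>j\<in>UNIV. (\<Sum>a\<in>UNIV. \<Sum>b\<in>UNIV. G i a * D i a b * G b j) * f j)
         = (\<Sum>j\<in>UNIV. \<Sum>a\<in>UNIV. \<Sum>b\<in>UNIV. G i a * D i a b * (G b j * f j))"
        by (simp add: sum_distrib_right mult.assoc)
      also have "\<dots> = (\<Sum>a\<in>UNIV. \<Sum>j\<in>UNIV. \<Sum>b\<in>UNIV. G i a * D i a b * (G b j * f j))" by (rule sum.swap)
      also have "\<dots> = (\<Sum>a\<in>UNIV. \<Sum>b\<in>UNIV. \<Sum>j\<in>UNIV. G i a * D i a b * (G b j * f j))"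
        by (intro sum.cong refl sum.swap)
      finally show ?thesis by (simp add: y_def sum_distrib_left)
    qed
    then show ?thesis by (simp add: X_def)
  qed
  also have "1/2 * Z = (\<Sum>i\<in>UNIV. 1/2 * (\<Sum>a\<in>UNIV. \<Sum>b\<in>UNIV. G b a * D i a b) * (\<Sum>j\<in>UNIV. G i j * f j))"
  proof -
    have "Z = (\<Sum>i\<in>UNIV. \<Sum>l\<in>UNIV. \<Sum>j\<in>UNIV. G i j * D l i j * y l)"
      unfolding Z_def by (intro sum.cong refl sum.swap)
    also have "\<dots> = (\<Sum>l\<in>UNIV. \<Sum>i\<in>UNIV. \<Sum>j\<in>UNIV. G i j * D l i j * y l)" by (rule sum.swap)
    finally have "Z = (\<Sum>l\<in>UNIV. (\<Sum>i\<in>UNIV. \<Sum>j\<in>UNIV. G j i * D l i j) * y l)"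
      by (simp add: sum_distrib_right G)
    then have "1/2 * Z = (\<Sum>l\<in>UNIV. 1/2 * ((\<Sum>i\<in>UNIV. \<Sum>j\<in>UNIV. G j i * D l i j) * y l))"
      by (simp only: sum_distrib_left)
    then show ?thesis by (simp only: y_def mult.assoc)
  qed
  finally show ?thesis by (simp only: 1)
qed

section \<open>Change of variables\<close>

text \<open>The change of variables theorem of the library is restricted to well-ordered index types;
  it is transferred to arbitrary finite index types along an enumeration.\<close>

typedef 'a ordered = "UNIV :: 'a set"
  morphisms unord ord ..

definition ord_rank :: "'a::finite \<Rightarrow> nat" where
  "ord_rank = (SOME f. inj f)"

lemma inj_ord_rank: "inj (ord_rank :: 'a::finite \<Rightarrow> nat)"
proof -
  have "\<exists>f :: 'a \<Rightarrow> nat. inj f"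
    using finite_imp_inj_to_nat_seg[of "UNIV :: 'a set"] by auto
  then show ?thesis unfolding ord_rank_def by (rule someI_ex)
qed

instantiation ordered :: (finite) linorder
begin
definition less_eq_ordered :: "'a ordered \<Rightarrow> 'a ordered \<Rightarrow> bool" where
  "less_eq_ordered x y \<longleftrightarrow> ord_rank (unord x) \<le> ord_rank (unord y)"
definition less_ordered :: "'a ordered \<Rightarrow> 'a ordered \<Rightarrow> bool" where
  "less_ordered x y \<longleftrightarrow> ord_rank (unord x) < ord_rank (unord y)"
instance
proof
  fix x y z :: "'a ordered"
  show "x < y \<longleftrightarrow> x \<le> y \<and> \<not> y \<le> x" "x \<le> x" "x \<le> y \<Longrightarrow> y \<le> z \<Longrightarrow> x \<le> z" "x \<le> y \<or> y \<le> x"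
    by (auto simp: less_eq_ordered_def less_ordered_def)
  show "x = y" if "x \<le> y" "y \<le> x"
  proof -
    have "ord_rank (unord x) = ord_rank (unord y)" using that by (simp add: less_eq_ordered_def)
    then have "unord x = unord y" by (rule injD[OF inj_ord_rank])
    then show ?thesis by (simp add: unord_inject)
  qed
qed
end

instance ordered :: (finite) finite
proof
  have "x \<in> range ord" for x :: "'a ordered" by (metis rangeI unord_inverse)
  then have "(UNIV :: 'a ordered set) = range ord" by (intro set_eqI) simp
  moreover have "finite (range (ord :: 'a \<Rightarrow> 'a ordered))" by (intro finite_imageI finite_class.finite_UNIV)
  ultimately show "finite (UNIV :: 'a ordered set)" by metis
qed

instance ordered :: (finite) wellorder
proof
  fix P :: "'a ordered \<Rightarrow> bool" and a
  assume step: "\<And>x. (\<And>y. y < x \<Longrightarrow> P y) \<Longrightarrow> P x"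
  show "P a"
  proof (induction "ord_rank (unord a)" arbitrary: a rule: less_induct)
    case less
    show ?case by (rule step, rule less) (simp add: less_ordered_def)
  qed
qed

lemma bij_unord: "bij (unord :: 'a ordered \<Rightarrow> 'a)"
  by (rule bijI') (auto simp: unord_inject intro: unord_cases)

text \<open>Relabelling rows and columns simultaneously conjugates the permutations of the Leibniz
  formula by \<open>f\<close>, which preserves their signs.\<close>

lemma det_reindex:
  fixes A :: "real^'n::finite^'n"
  assumes f: "bij (f :: 'm::finite \<Rightarrow> 'n)"
  shows "det (\<chi> a b. A $ f a $ f b) = det A"
proof -
  let ?F = "\<lambda>\<pi> x. f (\<pi> (inv f x))"
  have F: "bij_betw ?F {\<pi>. \<pi> permutes UNIV} {\<pi>. \<pi> permutes UNIV}"
    using bij_betw_permutations[OF f] by simp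
  have inv: "inv f (f x) = x" for x using f by (simp add: bij_is_inj)
  have sg: "sign (?F p) = sign p" if "p permutes UNIV" for p
  proof -
    have "map_permutation UNIV f p = ?F p"
      using f by (auto simp: map_permutation_def restrict_id_def fun_eq_iff bij_is_surj)
    then show ?thesis using sign_map_permutation[of f UNIV p] f that by (simp add: bij_is_inj)
  qed
  have "det A = (\<Sum>p\<in>{\<pi>. \<pi> permutes UNIV}. of_int (sign (?F p)) * (\<Prod>i\<in>UNIV. A $ i $ ?F p i))"
    unfolding det_def by (rule sum.reindex_bij_betw[OF F, symmetric])
  also have "\<dots> = (\<Sum>p\<in>{\<pi>. \<pi> permutes UNIV}. of_int (sign p) * (\<Prod>a\<in>UNIV. A $ f a $ f (p a)))"
  proof (rule sum.cong[OF refl])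
    fix p :: "'m \<Rightarrow> 'm" assume p: "p \<in> {\<pi>. \<pi> permutes UNIV}"
    have "(\<Prod>i\<in>UNIV. A $ i $ ?F p i) = (\<Prod>a\<in>UNIV. A $ f a $ ?F p (f a))"
      by (rule prod.reindex_bij_betw[OF f, symmetric])
    then show "of_int (sign (?F p)) * (\<Prod>i\<in>UNIV. A $ i $ ?F p i)
        = of_int (sign p) * (\<Prod>a\<in>UNIV. A $ f a $ f (p a))"
      using sg p inv by simp
  qed
  finally show ?thesis by (simp add: det_def)
qed

definition vec_reindex :: "('m \<Rightarrow> 'n) \<Rightarrow> real^'n \<Rightarrow> real^'m" where
  "vec_reindex f x = (\<chi> a. x $ f a)"

lemma vec_reindex_nth [simp]: "vec_reindex f x $ a = x $ f a"
  by (simp add: vec_reindex_def)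

lemma linear_vec_reindex: "linear (vec_reindex f)"
  by (rule linearI) (simp_all add: vec_eq_iff)

lemma vec_reindex_inv:
  assumes "bij f"
  shows "vec_reindex (inv f) (vec_reindex f x) = x" and "vec_reindex f (vec_reindex (inv f) y) = y"
  using assms by (simp_all add: vec_eq_iff bij_is_inj bij_is_surj surj_f_inv_f)

lemma prod_Basis_vec: "(\<Prod>b\<in>Basis. (u - l) \<bullet> b) = (\<Prod>i\<in>UNIV. u $ i - (l::real^'n::finite) $ i)"
proof -
  have "bij_betw (\<lambda>i. axis i 1 :: real^'n) UNIV Basis"
    by (auto simp: bij_betw_def inj_def axis_eq_axis Basis_vec_def)
  then have "(\<Prod>i\<in>UNIV. (u - l) \<bullet> axis i 1) = (\<Prod>b\<in>Basis. (u - l) \<bullet> b)"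
    by (rule prod.reindex_bij_betw)
  then show ?thesis by (simp add: inner_axis)
qed

text \<open>A relabelling of coordinates maps boxes to boxes with the same side lengths, and
  Lebesgue measure is determined by its values on boxes.\<close>

lemma lborel_vec_reindex:
  fixes f :: "'m::finite \<Rightarrow> 'n::finite"
  assumes f: "bij f"
  shows "distr lborel borel (vec_reindex f) = lborel"
proof (rule lborel_eqI[symmetric])
  fix l u :: "real^'m" assume lu: "\<And>b. b \<in> Basis \<Longrightarrow> l \<bullet> b \<le> u \<bullet> b"
  let ?r = "vec_reindex (inv f)"
  have m: "vec_reindex f \<in> borel_measurable borel"
    using linear_vec_reindex[of f]
    by (intro borel_measurable_continuous_onI linear_continuous_on) (simp add: linear_conv_bounded_linear)
  have lu': "l $ a \<le> u $ a" for a using lu[of "axis a 1"] by (simp add: inner_axis axis_in_Basis_iff)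
  have "vec_reindex f -` box l u = box (?r l) (?r u)"
    by (auto simp: mem_box_cart) (metis f bij_inv_eq_iff)+
  moreover have "(\<And>b. b \<in> Basis \<Longrightarrow> ?r l \<bullet> b \<le> ?r u \<bullet> b)"
    using lu' by (auto simp: Basis_vec_def inner_axis)
  ultimately have "emeasure (distr lborel borel (vec_reindex f)) (box l u) = (\<Prod>i\<in>UNIV. ?r u $ i - ?r l $ i)"
    using m by (simp add: emeasure_distr prod_Basis_vec)
  also have "(\<Prod>i\<in>UNIV. ?r u $ i - ?r l $ i) = (\<Prod>a\<in>UNIV. u $ a - l $ a)"
    by (simp) (rule prod.reindex_bij_betw[OF bij_betw_inv_into[OF f]])
  finally show "emeasure (distr lborel borel (vec_reindex f)) (box l u) = (\<Prod>b\<in>Basis. (u - l) \<bullet> b)"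
    by (simp add: prod_Basis_vec)
qed simp

text \<open>The version for nonnegative functions follows from the one for absolutely integrable
  functions: finiteness of either side gives integrability of its integrand and hence equality;
  otherwise both sides are infinite.\<close>

lemma nn_integral_change_of_variables_wellorder:
  fixes f :: "real^'m::{finite,wellorder} \<Rightarrow> real" and \<tau> :: "real^'m::{finite,wellorder} \<Rightarrow> real^'m::{finite,wellorder}"
  assumes U: "U \<in> sets borel" and \<tau>: "\<And>x. x \<in> U \<Longrightarrow> (\<tau> has_derivative (\<lambda>h. J x *v h)) (at x within U)"
    and inj: "inj_on \<tau> U" and f0: "\<And>y. 0 \<le> f y"
    and m1: "(\<lambda>x. indicator U x * (\<bar>det (J x)\<bar> * f (\<tau> x))) \<in> borel_measurable borel"
    and m2: "(\<lambda>y. indicator (\<tau> ` U) y * f y) \<in> borel_measurable borel"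
  shows "(\<integral>\<^sup>+y. ennreal (indicator (\<tau> ` U) y * f y) \<partial>lborel)
    = (\<integral>\<^sup>+x. ennreal (indicator U x * (\<bar>det (J x)\<bar> * f (\<tau> x))) \<partial>lborel)"
    (is "?L = ?R")
proof -
  let ?h = "\<lambda>x. \<bar>det (J x)\<bar> * f (\<tau> x)"
  have h0: "0 \<le> ?h x" for x using f0 by simp
  have cv: "?h absolutely_integrable_on U \<and> integral U ?h = b \<longleftrightarrow> f absolutely_integrable_on (\<tau> ` U) \<and> integral (\<tau> ` U) f = b" for b
  proof -
    \<comment> \<open>The theorem applied here concerns vector-valued functions, so real values are
      embedded as vectors of length 1.\<close>
    have "(\<lambda>x. \<bar>det (matrix (\<lambda>h. J x *v h))\<bar> *\<^sub>R (vec (f (\<tau> x)) :: real^1)) absolutely_integrable_on U \<and>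
           integral U (\<lambda>x. \<bar>det (matrix (\<lambda>h. J x *v h))\<bar> *\<^sub>R (vec (f (\<tau> x)) :: real^1)) = vec b
     \<longleftrightarrow> (\<lambda>y. vec (f y) :: real^1) absolutely_integrable_on (\<tau> ` U) \<and> integral (\<tau> ` U) (\<lambda>y. vec (f y) :: real^1) = vec b"
      by (rule has_absolute_integral_change_of_variables[OF _ \<tau> inj]) (use U in auto)
    then show ?thesis by (simp add: absolutely_integrable_on_1_iff integral_on_1_eq)
  qed
  have ai: "k absolutely_integrable_on V"
    if "(\<lambda>x. indicator V x * k x) \<in> borel_measurable borel" "\<And>x. 0 \<le> k x"
      "(\<integral>\<^sup>+x. ennreal (indicator V x * k x) \<partial>lborel) < \<infinity>" for k :: "real^'m::{finite,wellorder} \<Rightarrow> real" and V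
  proof -
    have "integrable lborel (\<lambda>x. indicator V x * k x)"
      by (rule integrableI_nonneg) (use that in auto)
    then have "integrable lebesgue (\<lambda>x. indicator V x * k x)"
      by (subst integrable_completion) (use that in auto)
    then show ?thesis by (simp add: set_integrable_def)
  qed
  have nn: "(\<integral>\<^sup>+x. ennreal (indicator V x * k x) \<partial>lborel) = ennreal (integral V k)"
    if "k absolutely_integrable_on V" "\<And>x. 0 \<le> k x" for k :: "real^'m::{finite,wellorder} \<Rightarrow> real" and V
    using nn_integral_has_integral_lebesgue[of V k] that set_lebesgue_integral_eq_integral(1)[OF that(1)]
    by (simp add: integrable_integral)
  show ?thesis
  proof (cases "?L < \<infinity>")
    case True
    then have fi: "f absolutely_integrable_on (\<tau> ` U)" using ai[OF m2 f0] by blast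
    then have hi: "?h absolutely_integrable_on U" "integral U ?h = integral (\<tau> ` U) f"
      using cv[of "integral (\<tau> ` U) f"] by blast+
    show ?thesis using nn[OF fi f0] nn[OF hi(1) h0] hi(2) by simp
  next
    case False
    have "\<not> ?R < \<infinity>"
    proof
      assume "?R < \<infinity>"
      then have "?h absolutely_integrable_on U" using ai[OF m1 h0] by blast
      then have "f absolutely_integrable_on (\<tau> ` U)" using cv by blast
      from nn[OF this f0] show False using False by simp
    qed
    then show ?thesis using False by (simp add: less_top[symmetric])
  qed
qed

lemma nn_integral_change_of_variables:
  fixes f :: "real^'n::finite \<Rightarrow> real" and \<tau> :: "real^'n \<Rightarrow> real^'n"
  assumes U: "U \<in> sets borel" and \<tau>: "\<And>x. x \<in> U \<Longrightarrow> (\<tau> has_derivative (\<lambda>h. J x *v h)) (at x within U)"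
    and inj: "inj_on \<tau> U" and f0: "\<And>y. 0 \<le> f y"
    and m1: "(\<lambda>x. indicator U x * (\<bar>det (J x)\<bar> * f (\<tau> x))) \<in> borel_measurable borel"
    and m2: "(\<lambda>y. indicator (\<tau> ` U) y * f y) \<in> borel_measurable borel"
  shows "(\<integral>\<^sup>+y. ennreal (indicator (\<tau> ` U) y * f y) \<partial>lborel)
    = (\<integral>\<^sup>+x. ennreal (indicator U x * (\<bar>det (J x)\<bar> * f (\<tau> x))) \<partial>lborel)"
proof -
  let ?r = "vec_reindex (unord :: 'n ordered \<Rightarrow> 'n)" and ?s = "vec_reindex (inv (unord :: 'n ordered \<Rightarrow> 'n))"
  note sr = vec_reindex_inv(1)[OF bij_unord] and rs = vec_reindex_inv(2)[OF bij_unord]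
  have lin: "bounded_linear ?r" "bounded_linear ?s"
    using linear_vec_reindex linear_conv_bounded_linear by blast+
  have cr: "?r \<in> borel_measurable borel" "?s \<in> borel_measurable borel"
    using lin by (auto intro!: borel_measurable_continuous_onI linear_continuous_on)
  have img: "?r ` V = ?s -` V" for V
  proof (intro set_eqI iffI)
    fix y assume "y \<in> ?s -` V"
    then have "?s y \<in> V" by simp
    then have "?r (?s y) \<in> ?r ` V" by (rule imageI)
    then show "y \<in> ?r ` V" by (simp only: rs)
  qed (auto simp: sr)
  have ind: "indicator (?r ` V) y = (indicator V (?s y) :: real)" for V y
    by (simp add: img indicator_def)
  have trans: "(\<integral>\<^sup>+x. k x \<partial>lborel) = (\<integral>\<^sup>+y. k (?s y) \<partial>lborel)"
    if "k \<in> borel_measurable borel" for k :: "real^'n \<Rightarrow> ennreal"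
  proof -
    have "(\<integral>\<^sup>+y. k (?s y) \<partial>lborel) = (\<integral>\<^sup>+y. k (?s y) \<partial>distr lborel borel ?r)"
      using lborel_vec_reindex[OF bij_unord] by metis
    also have "\<dots> = (\<integral>\<^sup>+x. k (?s (?r x)) \<partial>lborel)"
      by (rule nn_integral_distr) (use that cr in measurable)
    finally show ?thesis by (simp add: sr)
  qed
  define U' where "U' = ?r ` U"
  define \<tau>' where "\<tau>' y = ?r (\<tau> (?s y))" for y
  \<comment> \<open>The Jacobian matrix of the conjugated map is \<open>J\<close> with rows and
    columns relabelled, so its determinant is unchanged.\<close>
  define J' where "J' y = (\<chi> a b. J (?s y) $ unord a $ unord b)" for y
  have dJ: "det (J' y) = det (J (?s y))" for y unfolding J'_def by (rule det_reindex[OF bij_unord])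
  have sU: "?s ` U' = U" by (force simp: U'_def image_iff sr)
  have tU: "\<tau>' ` U' = ?r ` \<tau> ` U" by (force simp: U'_def \<tau>'_def image_iff sr)
  have J'v: "J' y *v h = ?r (J (?s y) *v ?s h)" for y h
  proof -
    have "(\<Sum>b\<in>UNIV. J (?s y) $ unord a $ unord b * h $ b) = (\<Sum>j\<in>UNIV. J (?s y) $ unord a $ j * ?s h $ j)" for a :: "'n ordered"
      using sum.reindex_bij_betw[OF bij_unord, of "\<lambda>j. J (?s y) $ unord a $ j * ?s h $ j"]
      by (simp add: bij_is_inj[OF bij_unord])
    then show ?thesis by (simp add: vec_eq_iff matrix_vector_mult_def J'_def)
  qed
  have "(\<integral>\<^sup>+y. ennreal (indicator (\<tau>' ` U') y * f (?s y)) \<partial>lborel)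
     = (\<integral>\<^sup>+x. ennreal (indicator U' x * (\<bar>det (J' x)\<bar> * f (?s (\<tau>' x)))) \<partial>lborel)"
  proof (rule nn_integral_change_of_variables_wellorder)
    show "U' \<in> sets borel" using measurable_sets[OF cr(2), of U] U by (simp add: U'_def img)
    show "(\<tau>' has_derivative (\<lambda>h. J' y *v h)) (at y within U')" if "y \<in> U'" for y
    proof -
      have "?s y \<in> U" using that sU by blast
      then have "((\<lambda>y. \<tau> (?s y)) has_derivative (\<lambda>h. J (?s y) *v ?s h)) (at y within U')"
        using has_derivative_in_compose[of ?s ?s y U' \<tau> "\<lambda>h. J (?s y) *v h"] \<tau> sU
          bounded_linear_imp_has_derivative[OF lin(2)] by simp
      from has_derivative_compose[OF this bounded_linear_imp_has_derivative[OF lin(1)]]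
      show ?thesis by (simp add: J'v \<tau>'_def[abs_def])
    qed
    show "inj_on \<tau>' U'"
      unfolding inj_on_def U'_def \<tau>'_def using inj by (auto simp: sr) (metis sr inj_onD)
    show "(\<lambda>x. indicator U' x * (\<bar>det (J' x)\<bar> * f (?s (\<tau>' x)))) \<in> borel_measurable borel"
      using measurable_compose[OF cr(2) m1] by (simp add: U'_def ind dJ \<tau>'_def sr)
    show "(\<lambda>y. indicator (\<tau>' ` U') y * f (?s y)) \<in> borel_measurable borel"
      using measurable_compose[OF cr(2) m2] by (simp add: tU ind)
  qed (use f0 in simp)
  then have "(\<integral>\<^sup>+y. ennreal (indicator (\<tau> ` U) (?s y) * f (?s y)) \<partial>lborel)
     = (\<integral>\<^sup>+x. ennreal (indicator U (?s x) * (\<bar>det (J (?s x))\<bar> * f (\<tau> (?s x)))) \<partial>lborel)"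
    unfolding tU by (simp only: ind U'_def dJ \<tau>'_def sr)
  then show ?thesis
    by (subst (1 2) trans) (use m1 m2 in simp_all)
qed

section \<open>Charts of a compact manifold\<close>

lemma continuous_on_openin_local:
  fixes f :: "'a::t2_space \<Rightarrow> 'b::topological_space"
  assumes "\<And>x. x \<in> S \<Longrightarrow> \<exists>T. openin (top_of_set S) T \<and> x \<in> T \<and> continuous_on T f"
  shows "continuous_on S f"
  unfolding continuous_on_eq_continuous_within
proof
  fix x assume "x \<in> S"
  then obtain T where T: "openin (top_of_set S) T" "x \<in> T" "continuous_on T f" using assms by blast
  then have "continuous (at x within T) f" by (simp add: continuous_on_eq_continuous_within)
  then show "continuous (at x within S) f" using at_within_openin[OF T(1,2)] by simp
qed

definition chart_diff :: "('a, 'n::finite) chart \<Rightarrow> ('a \<Rightarrow> real) \<Rightarrow> 'a \<Rightarrow> real^'n" where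
  "chart_diff c f p = (\<chi> i. pd c i f p)"

definition C1_chart :: "('a, 'n::finite) chart \<Rightarrow> ('a \<Rightarrow> real) \<Rightarrow> bool" where
  "C1_chart c f \<longleftrightarrow> C1 (chart_image c) (\<lambda>x. f (chart_inv c x))"

text \<open>The inner product of the gradients of \<open>f\<close> and \<open>h\<close>, computed as
  the inverse metric applied to the two differentials.\<close>

definition chart_ip :: "('a, 'n::finite) tensor2 \<Rightarrow> ('a, 'n) chart \<Rightarrow> ('a \<Rightarrow> real) \<Rightarrow> ('a \<Rightarrow> real) \<Rightarrow> 'a \<Rightarrow> real" where
  "chart_ip g c f h p = chart_diff c f p \<bullet> (matrix_inv (g c p) *v chart_diff c h p)"

text \<open>The density of the weighted measure with respect to Lebesgue measure in the
  chart.\<close>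

definition chart_weight :: "('a, 'n::finite) tensor2 \<Rightarrow> ('a \<Rightarrow> real) \<Rightarrow> ('a, 'n) chart \<Rightarrow> 'a \<Rightarrow> real" where
  "chart_weight g \<eta> c p = sqrt (det (g c p)) * exp (- \<eta> p)"

text \<open>The drift Laplacian with the chart as a free parameter in place of
  \<open>chart_at A p\<close>. Only with the chart fixed can it be treated as a function on a whole
  coordinate domain.\<close>

definition chart_drift :: "('a, 'n::finite) tensor2 \<Rightarrow> ('a \<Rightarrow> real) \<Rightarrow> ('a, 'n) chart \<Rightarrow> ('a \<Rightarrow> real) \<Rightarrow> 'a \<Rightarrow> real" where
  "chart_drift g \<eta> c f p =
     (\<Sum>i\<in>UNIV. \<Sum>j\<in>UNIV. matrix_inv (g c p) $ i $ j * hessian g f c p $ i $ j) - chart_ip g c \<eta> f p"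

lemma pd_eq_partial: "pd c i f p = partial (chart_image c) i (\<lambda>x. f (chart_inv c x)) (snd c p)"
  by (simp add: pd_def o_def)

locale compact_manifold =
  fixes M :: "'a::{second_countable_topology, t2_space} set" and A :: "('a, 'n::finite) chart set"
  assumes manifold: "manifold_with_boundary M A" and oriented: "oriented_atlas A" and compact_M: "compact M"
begin

lemma domain_openin: "c \<in> A \<Longrightarrow> openin (top_of_set M) (fst c)"
  and chart_homeomorphism: "c \<in> A \<Longrightarrow> homeomorphism (fst c) (chart_image c) (snd c) (chart_inv c)"
  and chart_halfspace: "c \<in> A \<Longrightarrow> \<exists>b. openin (top_of_set {x. 0 \<le> b \<bullet> x}) (chart_image c)"
  and M_eq: "M = (\<Union>c\<in>A. fst c)"
  and transition_smooth: "c \<in> A \<Longrightarrow> c' \<in> A \<Longrightarrow>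
    smooth_on (snd c ` (fst c \<inter> fst c')) (\<lambda>x. snd c' (chart_inv c x) $ a)"
  using manifold unfolding manifold_with_boundary_def by blast+

lemma hs_open_chart_image: "c \<in> A \<Longrightarrow> hs_open (chart_image c)"
  using chart_halfspace by (simp add: hs_open_def)

lemma domain_subset: "c \<in> A \<Longrightarrow> fst c \<subseteq> M"
  using M_eq by blast

lemma chart_inv_chart: "c \<in> A \<Longrightarrow> p \<in> fst c \<Longrightarrow> chart_inv c (snd c p) = p"
  using chart_homeomorphism homeomorphism_apply1 by metis

lemma chart_chart_inv: "c \<in> A \<Longrightarrow> x \<in> chart_image c \<Longrightarrow> snd c (chart_inv c x) = x"
  using chart_homeomorphism homeomorphism_apply2 by metis

lemma chart_in_image: "p \<in> fst c \<Longrightarrow> snd c p \<in> chart_image c"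
  by (simp add: chart_image_def)

lemma chart_inv_in: "c \<in> A \<Longrightarrow> x \<in> chart_image c \<Longrightarrow> chart_inv c x \<in> fst c"
  using chart_homeomorphism homeomorphism_image2 by (metis imageI)

lemma continuous_chart: "c \<in> A \<Longrightarrow> continuous_on (fst c) (snd c)"
  and continuous_chart_inv: "c \<in> A \<Longrightarrow> continuous_on (chart_image c) (chart_inv c)"
  using chart_homeomorphism by (auto simp: homeomorphism_def)

lemma chart_at:
  assumes "p \<in> M"
  shows "chart_at A p \<in> A" "p \<in> fst (chart_at A p)"
proof -
  have "\<exists>c. c \<in> A \<and> p \<in> fst c" using assms M_eq by blast
  then have "chart_at A p \<in> A \<and> p \<in> fst (chart_at A p)" unfolding chart_at_def by (rule someI_ex)
  then show "chart_at A p \<in> A" "p \<in> fst (chart_at A p)" by auto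
qed

lemma chart_image_openin:
  assumes "c \<in> A" "openin (top_of_set (fst c)) U"
  shows "openin (top_of_set (chart_image c)) (snd c ` U)"
  using homeomorphism_imp_open_map[OF chart_homeomorphism] assms by blast

lemma overlap_openin:
  assumes "c \<in> A" "c' \<in> A"
  shows "openin (top_of_set (fst c)) (fst c \<inter> fst c')"
proof -
  obtain W where "open W" "fst c' = M \<inter> W" using domain_openin[OF assms(2)] by (auto simp: openin_open)
  moreover have "fst c \<inter> (M \<inter> W) = fst c \<inter> W" using domain_subset[OF assms(1)] by blast
  ultimately show ?thesis by (auto simp: openin_open)
qed

lemma overlap_image_openin:
  assumes "c \<in> A" "c' \<in> A"
  shows "openin (top_of_set (chart_image c)) (snd c ` (fst c \<inter> fst c'))"
  using chart_image_openin[OF assms(1) overlap_openin[OF assms]] .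

lemma hs_open_overlap:
  assumes "c \<in> A" "c' \<in> A"
  shows "hs_open (snd c ` (fst c \<inter> fst c'))"
  using hs_open_openin[OF hs_open_chart_image overlap_image_openin] assms by blast

lemma transition_C1:
  assumes "c \<in> A" "c' \<in> A"
  shows "C1 (snd c ` (fst c \<inter> fst c')) (\<lambda>x. snd c' (chart_inv c x) $ a)"
  using smooth_on_C1[OF hs_open_overlap transition_smooth] assms by blast

lemma jacobian_eq_partial:
  assumes "c \<in> A" "c' \<in> A" "p \<in> fst c \<inter> fst c'"
  shows "jacobian c c' p $ a $ i = partial (snd c ` (fst c \<inter> fst c')) i (\<lambda>x. snd c' (chart_inv c x) $ a) (snd c p)"
  using partial_openin[OF overlap_image_openin[OF assms(1,2)], of "snd c p"] assms(3)
  by (simp add: jacobian_def pd_eq_partial)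

lemma det_jacobian_pos:
  assumes "c \<in> A" "c' \<in> A" "p \<in> fst c \<inter> fst c'"
  shows "0 < det (jacobian c c' p)"
  using oriented assms unfolding oriented_atlas_def by blast

lemma transition_in:
  assumes "c \<in> A" "c' \<in> A" "x \<in> snd c ` (fst c \<inter> fst c')"
  shows "snd c' (chart_inv c x) \<in> snd c' ` (fst c' \<inter> fst c)" "chart_inv c' (snd c' (chart_inv c x)) = chart_inv c x"
  using assms by (auto simp: chart_inv_chart)

text \<open>The chain rule for the transition map \<open>\<tau>\<close>. The differential is a
  covector, hence pulled back by the transposed Jacobian.\<close>

lemma C1_overlap:
  assumes c: "c \<in> A" "c' \<in> A" and f: "C1 (snd c' ` (fst c' \<inter> fst c)) (\<lambda>x. f (chart_inv c' x))"
  shows "C1 (snd c ` (fst c \<inter> fst c')) (\<lambda>x. f (chart_inv c x))"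
    and "p \<in> fst c \<inter> fst c' \<Longrightarrow> chart_diff c f p = transpose (jacobian c c' p) *v chart_diff c' f p"
proof -
  let ?U = "snd c ` (fst c \<inter> fst c')" and ?U' = "snd c' ` (fst c' \<inter> fst c)" and ?\<tau> = "\<lambda>x. snd c' (chart_inv c x)"
  have im: "?\<tau> ` ?U \<subseteq> ?U'" using transition_in(1)[OF c] by blast
  note comp = C1_compose[OF hs_open_overlap[OF c] transition_C1[OF c] im f]
  have eq: "f (chart_inv c' (?\<tau> x)) = f (chart_inv c x)" if "x \<in> ?U" for x
    using transition_in(2)[OF c that] by simp
  show "C1 ?U (\<lambda>x. f (chart_inv c x))"
    by (rule C1_cong[THEN iffD1, OF eq comp(1)])
  assume p: "p \<in> fst c \<inter> fst c'"
  then have x: "snd c p \<in> ?U" by blast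
  have px: "?\<tau> (snd c p) = snd c' p" using p c by (simp add: chart_inv_chart)
  have "pd c i f p = (\<Sum>a\<in>UNIV. pd c' a f p * jacobian c c' p $ a $ i)" for i
  proof -
    have "pd c i f p = partial ?U i (\<lambda>x. f (chart_inv c x)) (snd c p)"
      using partial_openin[OF overlap_image_openin[OF c] x] by (simp add: pd_eq_partial)
    also have "\<dots> = partial ?U i (\<lambda>x. f (chart_inv c' (?\<tau> x))) (snd c p)"
      by (rule partial_cong[OF _ x]) (rule eq[symmetric])
    also have "\<dots> = (\<Sum>a\<in>UNIV. partial ?U' a (\<lambda>x. f (chart_inv c' x)) (?\<tau> (snd c p)) * partial ?U i (\<lambda>x. ?\<tau> x $ a) (snd c p))"
      by (rule comp(2)[OF x])
    also have "\<dots> = (\<Sum>a\<in>UNIV. pd c' a f p * jacobian c c' p $ a $ i)"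
    proof (rule sum.cong[OF refl])
      fix a
      have "snd c' p \<in> ?U'" using p by blast
      then have "partial ?U' a (\<lambda>x. f (chart_inv c' x)) (snd c' p) = pd c' a f p"
        using partial_openin[OF overlap_image_openin[OF c(2,1)]] by (simp add: pd_eq_partial)
      then show "partial ?U' a (\<lambda>x. f (chart_inv c' x)) (?\<tau> (snd c p)) * partial ?U i (\<lambda>x. ?\<tau> x $ a) (snd c p)
          = pd c' a f p * jacobian c c' p $ a $ i"
        using jacobian_eq_partial[OF c p] px by simp
    qed
    finally show ?thesis .
  qed
  then show "chart_diff c f p = transpose (jacobian c c' p) *v chart_diff c' f p"
    by (simp add: vec_eq_iff chart_diff_def matrix_vector_mult_def transpose_def mult.commute)
qed

lemma C1_chart_overlap:
  assumes "c \<in> A" "c' \<in> A" "C1_chart c f"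
  shows "C1 (snd c ` (fst c \<inter> fst c')) (\<lambda>x. f (chart_inv c x))"
  using C1_openin[OF _ overlap_image_openin] assms unfolding C1_chart_def by blast

lemma chart_diff_change:
  assumes "c \<in> A" "c' \<in> A" "C1_chart c' f" "p \<in> fst c \<inter> fst c'"
  shows "chart_diff c f p = transpose (jacobian c c' p) *v chart_diff c' f p"
  using C1_overlap(2)[OF assms(1,2) C1_chart_overlap[OF assms(2,1,3)] assms(4)] .

lemma C1_chart_continuous:
  assumes "c \<in> A" "C1_chart c f"
  shows "continuous_on (fst c) f"
proof -
  have "continuous_on (fst c) (\<lambda>p. f (chart_inv c (snd c p)))"
    by (rule continuous_on_compose2[OF C1_continuous continuous_chart[OF assms(1)]])
      (use assms in \<open>auto simp: C1_chart_def chart_image_def\<close>)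
  then show ?thesis using chart_inv_chart[OF assms(1)] by (simp cong: continuous_on_cong)
qed

lemma C1_chart_continuous_pd:
  assumes "c \<in> A" "C1_chart c f"
  shows "continuous_on (fst c) (pd c i f)"
proof -
  have "continuous_on (fst c) (\<lambda>p. partial (chart_image c) i (\<lambda>x. f (chart_inv c x)) (snd c p))"
    by (rule continuous_on_compose2[OF C1_continuous_partial continuous_chart[OF assms(1)]])
      (use assms in \<open>auto simp: C1_chart_def chart_image_def\<close>)
  then show ?thesis by (simp add: pd_eq_partial[abs_def])
qed

lemma smooth_in_chart_C1: "c \<in> A \<Longrightarrow> smooth_in_chart c f \<Longrightarrow> C1_chart c f"
  using smooth_on_C1[OF hs_open_chart_image] by (simp add: smooth_in_chart_def C1_chart_def o_def)

lemma pd_cong: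
  assumes "c \<in> A" "\<And>q. q \<in> fst c \<Longrightarrow> f q = h q" "p \<in> fst c"
  shows "pd c i f p = pd c i h p"
  unfolding pd_eq_partial
  by (rule partial_cong) (simp_all add: assms chart_inv_in chart_in_image)

lemma smooth_in_chart_pd:
  assumes "c \<in> A" "smooth_in_chart c f"
  shows "smooth_in_chart c (pd c i f)"
proof -
  let ?F = "partial (chart_image c) i (f \<circ> chart_inv c)"
  have "smooth_on (chart_image c) ?F"
    using smooth_on_partial[OF hs_open_chart_image] assms by (simp add: smooth_in_chart_def)
  moreover have "?F x = (pd c i f \<circ> chart_inv c) x" if "x \<in> chart_image c" for x
    using chart_chart_inv[OF assms(1) that] by (simp add: pd_def)
  ultimately show ?thesis unfolding smooth_in_chart_def smooth_on_def by (metis (no_types, lifting) IntE)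
qed

lemma C1_chart_pd: "c \<in> A \<Longrightarrow> smooth_in_chart c f \<Longrightarrow> C1_chart c (pd c i f)"
  using smooth_in_chart_C1 smooth_in_chart_pd by blast

lemma C1_chart_mult: "c \<in> A \<Longrightarrow> C1_chart c f \<Longrightarrow> C1_chart c h \<Longrightarrow> C1_chart c (\<lambda>q. f q * h q)"
  unfolding C1_chart_def by (rule C1_mult[OF hs_open_chart_image])

lemma C1_chart_sum: "c \<in> A \<Longrightarrow> (\<And>k. k \<in> K \<Longrightarrow> C1_chart c (f k)) \<Longrightarrow> C1_chart c (\<lambda>q. \<Sum>k\<in>K. f k q)"
  unfolding C1_chart_def by (rule C1_sum[OF hs_open_chart_image])

lemma C1_chart_differentiable:
  "C1_chart c f \<Longrightarrow> p \<in> fst c \<Longrightarrow> (\<lambda>x. f (chart_inv c x)) differentiable (at (snd c p) within chart_image c)"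
  unfolding C1_chart_def by (rule C1_differentiable[OF _ chart_in_image])

lemma pd_mult:
  assumes "c \<in> A" "C1_chart c f" "C1_chart c h" "p \<in> fst c"
  shows "pd c i (\<lambda>q. f q * h q) p = f p * pd c i h p + h p * pd c i f p"
  using partial_mult[OF hs_open_chart_image[OF assms(1)] chart_in_image[OF assms(4)]
      C1_chart_differentiable[OF assms(2,4)] C1_chart_differentiable[OF assms(3,4)]]
    chart_inv_chart[OF assms(1,4)] by (simp add: pd_eq_partial)

lemma pd_add:
  assumes "c \<in> A" "C1_chart c f" "C1_chart c h" "p \<in> fst c"
  shows "pd c i (\<lambda>q. f q + h q) p = pd c i f p + pd c i h p"
  using partial_add[OF hs_open_chart_image[OF assms(1)] chart_in_image[OF assms(4)]
      C1_chart_differentiable[OF assms(2,4)] C1_chart_differentiable[OF assms(3,4)]]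
  by (simp add: pd_eq_partial)

lemma pd_sum:
  assumes "c \<in> A" "\<And>k. k \<in> K \<Longrightarrow> C1_chart c (f k)" "p \<in> fst c"
  shows "pd c i (\<lambda>q. \<Sum>k\<in>K. f k q) p = (\<Sum>k\<in>K. pd c i (f k) p)"
  using partial_sum[OF hs_open_chart_image[OF assms(1)] chart_in_image[OF assms(3)], of K "\<lambda>k x. f k (chart_inv c x)"]
    C1_chart_differentiable[OF assms(2,3)]
  by (simp add: pd_eq_partial)

lemma continuous_on_M:
  assumes "\<And>c. c \<in> A \<Longrightarrow> continuous_on (fst c) f"
  shows "continuous_on M f"
proof (rule continuous_on_openin_local)
  fix p assume "p \<in> M"
  then show "\<exists>T. openin (top_of_set M) T \<and> p \<in> T \<and> continuous_on T f"
    using chart_at[of p] domain_openin assms by (intro exI[of _ "fst (chart_at A p)"]) simp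
qed

lemma closed_M: "closed M"
  using compact_M by (rule compact_imp_closed)

lemma sets_M: "sets (restrict_space borel M) = {E \<in> sets borel. E \<subseteq> M}"
  using closed_M by (auto simp: sets_restrict_space_iff sets_restrict_space)

lemma domain_sets: "c \<in> A \<Longrightarrow> fst c \<in> sets borel"
  using domain_openin[of c] closed_M by (auto simp: openin_open)

lemma chart_image_sets: "c \<in> A \<Longrightarrow> chart_image c \<in> sets borel"
proof -
  assume "c \<in> A"
  then obtain b T where "open T" "chart_image c = {x. 0 \<le> b \<bullet> x} \<inter> T"
    using chart_halfspace[of c] by (auto simp: openin_open)
  then show ?thesis using closed_halfspace_ge[of 0 b] by auto
qed

lemma measurable_chart_inv:
  "c \<in> A \<Longrightarrow> chart_inv c \<in> measurable (restrict_space borel (chart_image c)) borel"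
  using continuous_chart_inv by (rule borel_measurable_continuous_on_restrict)

lemma chart_image_of_set: "c \<in> A \<Longrightarrow> E \<subseteq> fst c \<Longrightarrow> snd c ` E = chart_inv c -` E \<inter> chart_image c"
  by (rule set_eqI, rule iffI)
    (force simp: chart_inv_chart chart_in_image, force simp: image_iff chart_chart_inv)

lemma chart_image_borel:
  assumes "c \<in> A" "E \<in> sets borel" "E \<subseteq> fst c"
  shows "snd c ` E \<in> sets borel"
proof -
  have "chart_inv c -` E \<inter> chart_image c \<in> sets (restrict_space borel (chart_image c))"
    using measurable_sets[OF measurable_chart_inv[OF assms(1)] assms(2)] by (simp add: space_restrict_space)
  then show ?thesis
    using chart_image_sets[OF assms(1)] chart_image_of_set[OF assms(1,3)] by (simp add: sets_restrict_space_iff)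
qed

end

section \<open>The Riemannian volume\<close>

locale riemannian_compact_manifold = compact_manifold M A
  for M :: "'a::{second_countable_topology, t2_space} set" and A :: "('a, 'n::finite) chart set" +
  fixes g :: "('a, 'n) tensor2"
  assumes metric: "riemannian_metric A g"
begin

lemma det_metric_pos:
  assumes "c \<in> A" "p \<in> fst c"
  shows "0 < det (g c p)"
  by (rule det_pos_of_positive_definite) (use metric assms in \<open>simp add: riemannian_metric_def\<close>)

lemma metric_symmetric:
  assumes "c \<in> A" "p \<in> fst c"
  shows "transpose (g c p) = g c p"
  using metric assms unfolding riemannian_metric_def by blast

lemma metric_C1: "c \<in> A \<Longrightarrow> C1_chart c (\<lambda>p. g c p $ i $ j)"
  using metric unfolding riemannian_metric_def by (intro smooth_in_chart_C1) blast+

lemma metric_change: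
  assumes "c \<in> A" "c' \<in> A" "p \<in> fst c \<inter> fst c'"
  shows "g c p = transpose (jacobian c c' p) ** g c' p ** jacobian c c' p"
  using metric assms unfolding riemannian_metric_def tensor_field2_def by blast

text \<open>This is where the orientation enters: the Jacobian determinant is positive, so the root
  of its square is the determinant itself.\<close>

lemma sqrt_det_metric_change:
  assumes "c \<in> A" "c' \<in> A" "p \<in> fst c \<inter> fst c'"
  shows "sqrt (det (g c p)) = det (jacobian c c' p) * sqrt (det (g c' p))"
proof -
  have "det (g c p) = det (jacobian c c' p) ^ 2 * det (g c' p)"
    using metric_change[OF assms] by (simp add: det_mul power2_eq_square)
  then show ?thesis using det_jacobian_pos[OF assms] by (simp add: real_sqrt_mult)
qed

lemma sqrt_det_metric_C1: "c \<in> A \<Longrightarrow> C1_chart c (\<lambda>p. sqrt (det (g c p)))"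
  unfolding C1_chart_def
  by (rule C1_sqrt[OF hs_open_chart_image C1_det[OF hs_open_chart_image]])
    (use metric_C1 det_metric_pos chart_inv_in in \<open>simp_all add: C1_chart_def\<close>)

lemma metric_inverse_C1: "c \<in> A \<Longrightarrow> C1_chart c (\<lambda>p. matrix_inv (g c p) $ i $ j)"
  unfolding C1_chart_def
  by (rule C1_matrix_inv[OF hs_open_chart_image])
    (use metric_C1 det_metric_pos chart_inv_in in \<open>simp_all add: C1_chart_def less_imp_neq[symmetric]\<close>)

definition chart_measure :: "('a, 'n) chart \<Rightarrow> (real^'n) measure" where
  "chart_measure c = density lborel (\<lambda>x. ennreal (sqrt (det (g c (chart_inv c x)))) * indicator (chart_image c) x)"

lemma chart_density_measurable':
  assumes "c \<in> A"
  shows "(\<lambda>x. indicator (chart_image c) x * sqrt (det (g c (chart_inv c x)))) \<in> borel_measurable borel"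
proof -
  have "continuous_on (chart_image c) (\<lambda>x. sqrt (det (g c (chart_inv c x))))"
    using sqrt_det_metric_C1[OF assms] C1_continuous unfolding C1_chart_def by blast
  from borel_measurable_continuous_on_indicator[OF chart_image_sets[OF assms] this]
  show ?thesis by simp
qed

lemma chart_density_eq:
  "ennreal (sqrt (det (g c (chart_inv c x)))) * indicator (chart_image c) x
    = ennreal (indicator (chart_image c) x * sqrt (det (g c (chart_inv c x))))"
  by (simp add: indicator_def)

lemma chart_density_measurable:
  assumes "c \<in> A"
  shows "(\<lambda>x. ennreal (sqrt (det (g c (chart_inv c x)))) * indicator (chart_image c) x) \<in> borel_measurable borel"
  unfolding chart_density_eq using chart_density_measurable'[OF assms] by measurable

lemma sets_chart_measure [simp]: "sets (chart_measure c) = sets borel"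
  by (simp add: chart_measure_def)

lemma emeasure_chart_measure:
  assumes "c \<in> A" "B \<in> sets borel" "B \<subseteq> chart_image c"
  shows "emeasure (chart_measure c) B = (\<integral>\<^sup>+x\<in>B. ennreal (sqrt (det (g c (chart_inv c x)))) \<partial>lborel)"
proof -
  have "emeasure (chart_measure c) B =
    (\<integral>\<^sup>+x. ennreal (sqrt (det (g c (chart_inv c x)))) * indicator (chart_image c) x * indicator B x \<partial>lborel)"
    unfolding chart_measure_def
    by (rule emeasure_density) (use chart_density_measurable[OF assms(1)] assms(2) in simp_all)
  also have "\<dots> = (\<integral>\<^sup>+x\<in>B. ennreal (sqrt (det (g c (chart_inv c x)))) \<partial>lborel)"
    by (rule nn_integral_cong) (use assms(3) in \<open>auto simp: indicator_def\<close>)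
  finally show ?thesis .
qed

text \<open>The Jacobian determinant of the transition map is exactly the quotient of the two chart
  densities. This consistency on overlaps is what makes the volume well defined.\<close>

lemma chart_measure_change:
  assumes c: "c \<in> A" "c' \<in> A" and E: "E \<in> sets borel" "E \<subseteq> fst c \<inter> fst c'"
  shows "emeasure (chart_measure c) (snd c ` E) = emeasure (chart_measure c') (snd c' ` E)"
proof -
  let ?\<tau> = "\<lambda>x. snd c' (chart_inv c x)" and ?J = "\<lambda>x. jacobian c c' (chart_inv c x)"
  let ?U = "snd c ` (fst c \<inter> fst c')"
  \<comment> \<open>Outside the image of the chart the determinant is arbitrary and its real root
    may be negative, while the change of variables asks for a function nonnegative everywhere; hence
    the \<open>max 0\<close>.\<close>
  let ?f = "\<lambda>y. max 0 (sqrt (det (g c' (chart_inv c' y))))"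
  have sub: "E \<subseteq> fst c" "E \<subseteq> fst c'" using E by auto
  have bU: "snd c ` E \<in> sets borel" "snd c' ` E \<in> sets borel"
    using chart_image_borel c E sub by blast+
  have subU: "snd c ` E \<subseteq> chart_image c" "snd c' ` E \<subseteq> chart_image c'"
    using sub by (auto simp: chart_image_def)
  have im: "?\<tau> ` snd c ` E = snd c' ` E"
    using sub(1) chart_inv_chart[OF c(1)] by (force simp: image_iff)
  have val: "\<bar>det (?J x)\<bar> * ?f (?\<tau> x) = sqrt (det (g c (chart_inv c x)))" if x: "x \<in> snd c ` E" for x
  proof -
    obtain p where p: "p \<in> E" "x = snd c p" using x by blast
    then have pp: "p \<in> fst c" "p \<in> fst c'" using E by auto
    have e: "chart_inv c x = p" "?\<tau> x = snd c' p" "chart_inv c' (snd c' p) = p"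
      using p pp chart_inv_chart c by simp_all
    show ?thesis using sqrt_det_metric_change[OF c, of p] det_jacobian_pos[OF c, of p] det_metric_pos[OF c(2) pp(2)] pp
      by (simp add: e)
  qed
  have "(\<integral>\<^sup>+y. ennreal (indicator (?\<tau> ` snd c ` E) y * ?f y) \<partial>lborel)
    = (\<integral>\<^sup>+x. ennreal (indicator (snd c ` E) x * (\<bar>det (?J x)\<bar> * ?f (?\<tau> x))) \<partial>lborel)"
  proof (rule nn_integral_change_of_variables[OF bU(1)])
    fix x assume x: "x \<in> snd c ` E"
    then obtain p where p: "p \<in> E" "x = snd c p" by blast
    have xU: "x \<in> ?U" using p E by blast
    have pp: "p \<in> fst c \<inter> fst c'" and ci: "chart_inv c x = p"
      using p E chart_inv_chart[OF c(1)] by auto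
    have "((\<lambda>y. \<chi> a. ?\<tau> y $ a) has_derivative (\<lambda>h. \<chi> a. grad ?U (\<lambda>x. ?\<tau> x $ a) x \<bullet> h)) (at x within ?U)"
      using C1_has_derivative[OF transition_C1[OF c] xU]
      unfolding has_derivative_componentwise_within[of "\<lambda>y. \<chi> a. ?\<tau> y $ a"]
      by (auto simp: Basis_vec_def inner_axis)
    moreover have "(\<chi> a. grad ?U (\<lambda>x. ?\<tau> x $ a) x \<bullet> h) = ?J x *v h" for h
      using ci unfolding p(2)
      by (simp add: vec_eq_iff matrix_vector_mult_def Finite_Cartesian_Product.inner_vec_def
          jacobian_eq_partial[OF c pp])
    ultimately have "(?\<tau> has_derivative (\<lambda>h. ?J x *v h)) (at x within ?U)" by simp
    then show "(?\<tau> has_derivative (\<lambda>h. ?J x *v h)) (at x within snd c ` E)"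
      using has_derivative_subset E(2) by blast
  next
    show "inj_on ?\<tau> (snd c ` E)"
    proof (rule inj_onI)
      fix x y assume xy: "x \<in> snd c ` E" "y \<in> snd c ` E" and e: "?\<tau> x = ?\<tau> y"
      then obtain p q where pq: "p \<in> E" "q \<in> E" "x = snd c p" "y = snd c q" by blast
      then have "snd c' p = snd c' q" using e sub chart_inv_chart[OF c(1)] by (metis subsetD)
      then have "p = q" using pq sub chart_inv_chart[OF c(2)] by (metis subsetD)
      then show "x = y" using pq by simp
    qed
  next
    have "(\<lambda>x. indicator (snd c ` E) x * (indicator (chart_image c) x * sqrt (det (g c (chart_inv c x))))) \<in> borel_measurable borel"
      using chart_density_measurable'[OF c(1)] bU(1) by measurable
    moreover have "indicator (snd c ` E) x * (indicator (chart_image c) x * sqrt (det (g c (chart_inv c x))))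
       = indicator (snd c ` E) x * (\<bar>det (?J x)\<bar> * ?f (?\<tau> x))" for x
      using val subU(1) by (auto simp: indicator_def)
    ultimately show "(\<lambda>x. indicator (snd c ` E) x * (\<bar>det (?J x)\<bar> * ?f (?\<tau> x))) \<in> borel_measurable borel" by simp
  next
    have "(\<lambda>x. indicator (snd c' ` E) x * max 0 (indicator (chart_image c') x * sqrt (det (g c' (chart_inv c' x))))) \<in> borel_measurable borel"
      using chart_density_measurable'[OF c(2)] bU(2) by measurable
    moreover have "indicator (snd c' ` E) x * max 0 (indicator (chart_image c') x * sqrt (det (g c' (chart_inv c' x))))
       = indicator (snd c' ` E) x * ?f x" for x
      using subU(2) by (auto simp: indicator_def)
    ultimately show "(\<lambda>x. indicator (?\<tau> ` snd c ` E) x * ?f x) \<in> borel_measurable borel" by (simp add: im)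
  qed simp
  moreover have "ennreal (indicator (snd c' ` E) y * ?f y) = ennreal (sqrt (det (g c' (chart_inv c' y)))) * indicator (snd c' ` E) y" for y
    by (auto simp: indicator_def max_def ennreal_neg)
  moreover have "ennreal (indicator (snd c ` E) x * (\<bar>det (?J x)\<bar> * ?f (?\<tau> x)))
      = ennreal (sqrt (det (g c (chart_inv c x)))) * indicator (snd c ` E) x" for x
    using val by (auto simp: indicator_def)
  ultimately show ?thesis
    using emeasure_chart_measure[OF c(1) bU(1) subU(1)] emeasure_chart_measure[OF c(2) bU(2) subU(2)]
    by (simp add: im)
qed

text \<open>The defining property inside the definite description \<open>riemannian_volume\<close>,
  isolated for the proof of existence and uniqueness.\<close>

abbreviation "is_volume \<mu> \<equiv> sets \<mu> = sets (restrict_space borel M) \<and>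
     (\<forall>c\<in>A. \<forall>E\<in>sets \<mu>. E \<subseteq> fst c \<longrightarrow>
        emeasure \<mu> E = (\<integral>\<^sup>+x\<in>snd c ` E. ennreal (sqrt (det (g c (chart_inv c x)))) \<partial>lborel))"

lemma finite_chart_cover:
  obtains F :: "nat \<Rightarrow> ('a, 'n) chart" and N where "\<And>k. k < N \<Longrightarrow> F k \<in> A" "M = (\<Union>k<N. fst (F k))"
proof -
  define W where "W c = (SOME W. open W \<and> fst c = M \<inter> W)" for c :: "('a, 'n) chart"
  have W: "open (W c) \<and> fst c = M \<inter> W c" if "c \<in> A" for c
  proof -
    have "\<exists>W. open W \<and> fst c = M \<inter> W" using domain_openin[OF that] by (simp add: openin_open)
    then show ?thesis unfolding W_def by (rule someI_ex)
  qed
  have "M \<subseteq> (\<Union>c\<in>A. W c)"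
  proof
    fix p assume p: "p \<in> M"
    then show "p \<in> (\<Union>c\<in>A. W c)" using chart_at[OF p] W[OF chart_at(1)[OF p]] by blast
  qed
  then obtain C where C: "C \<subseteq> A" "finite C" "M \<subseteq> (\<Union>c\<in>C. W c)"
    using compactE_image[OF compact_M, of A W] W by metis
  then have C3: "M \<subseteq> (\<Union>c\<in>C. fst c)" using W by blast
  obtain F and N :: nat where "C = F ` {..<N}"
    using finite_imp_nat_seg_image_inj_on[OF C(2)] by (metis lessThan_def)
  then have "F k \<in> A" if "k < N" for k using C that by auto
  moreover have "M = (\<Union>k<N. fst (F k))"
  proof
    show "M \<subseteq> (\<Union>k<N. fst (F k))" using C3 \<open>C = F ` {..<N}\<close> by auto
    show "(\<Union>k<N. fst (F k)) \<subseteq> M" using calculation domain_subset by (intro UN_least) simp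
  qed
  ultimately show ?thesis using that by blast
qed

text \<open>A finite chart cover is cut into disjoint Borel pieces \<open>B k\<close>, each inside
  one chart, and the chart measures of the pieces are added up. By
  \<open>chart_measure_change\<close> the result has the right value in every other chart.
  Conversely, additivity over the pieces determines any measure with the required property.\<close>

lemma volume_exists_unique: "\<exists>!\<mu>. is_volume \<mu>"
proof -
  obtain F :: "nat \<Rightarrow> ('a, 'n) chart" and N where F: "\<And>k. k < N \<Longrightarrow> F k \<in> A" and cov: "M = (\<Union>k<N. fst (F k))"
    using finite_chart_cover by blast
  define B where "B k = fst (F k) - (\<Union>j<k. fst (F j))" for k
  let ?S = "sets (restrict_space borel M)"
  let ?I = "\<lambda>c E. emeasure (chart_measure c) (snd c ` E)"
  have B_sub: "B k \<subseteq> fst (F k)" for k by (auto simp: B_def)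
  have B_disj: "disjoint_family_on B {..<N}"
  proof (unfold disjoint_family_on_def, intro ballI impI)
    fix i j :: nat assume "i \<noteq> j"
    then consider "i < j" | "j < i" by linarith
    then show "B i \<inter> B j = {}" by cases (auto simp: B_def)
  qed
  have B_sets: "B k \<in> sets borel" if "k < N" for k
    using that domain_sets F unfolding B_def by (intro sets.Diff sets.finite_UN) auto
  have B_cov: "(\<Union>k<N. B k) = M"
  proof -
    have "p \<in> (\<Union>k<N. B k)" if pM: "p \<in> M" for p
    proof -
      \<comment> \<open>A point belongs to the piece whose index is that of the first chart
        containing it.\<close>
      define k where "k = (LEAST k. p \<in> fst (F k))"
      obtain l where l: "l < N" "p \<in> fst (F l)" using pM cov by blast
      have "p \<in> fst (F k)" unfolding k_def by (rule LeastI[of "\<lambda>k. p \<in> fst (F k)", OF l(2)])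
      moreover have "k \<le> l" unfolding k_def by (rule Least_le[of "\<lambda>k. p \<in> fst (F k)", OF l(2)])
      moreover have "p \<notin> fst (F j)" if j: "j < k" for j
        using not_less_Least[OF j[unfolded k_def]] .
      ultimately show ?thesis using l by (intro UN_I[of k]) (auto simp: B_def)
    qed
    moreover have "(\<Union>k<N. B k) \<subseteq> M" using B_sub cov by blast
    ultimately show ?thesis by blast
  qed
  have I_borel: "snd c ` E \<in> sets borel" if "c \<in> A" "E \<in> sets borel" "E \<subseteq> fst c" for c E
    using chart_image_borel that by blast
  have I_Un: "?I c (\<Union>i\<in>J. X i) = (\<Sum>i\<in>J. ?I c (X i))"
    if "c \<in> A" "finite J" "\<And>i. i \<in> J \<Longrightarrow> X i \<in> sets borel" "\<And>i. i \<in> J \<Longrightarrow> X i \<subseteq> fst c" "disjoint_family_on X J" for c and J :: "nat set" and X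
  proof -
    have inj: "inj_on (snd c) (fst c)" using chart_inv_chart[OF that(1)] by (rule inj_on_inverseI)
    have dj: "disjoint_family_on (\<lambda>i. snd c ` X i) J"
      using that(4,5) inj unfolding disjoint_family_on_def
      by (metis (no_types, lifting) image_empty inj_on_image_Int)
    have "(\<Sum>i\<in>J. ?I c (X i)) = emeasure (chart_measure c) (\<Union>i\<in>J. snd c ` X i)"
    proof (rule sum_emeasure)
      show "(\<lambda>i. snd c ` X i) ` J \<subseteq> sets (chart_measure c)"
        using I_borel[OF that(1) that(3,4)] by (simp add: image_subset_iff)
    qed (use dj that(2) in auto)
    then show ?thesis by (simp add: image_UN)
  qed
  define \<nu> where "\<nu> E = (\<Sum>k<N. ?I (F k) (E \<inter> B k))" for E
  have ca: "countably_additive ?S \<nu>"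
  proof (rule countably_additiveI)
    fix X :: "nat \<Rightarrow> 'a set"
    assume X: "range X \<subseteq> ?S" "disjoint_family X" "(\<Union>i. X i) \<in> ?S"
    have "(\<Sum>i. \<nu> (X i)) = (\<Sum>k<N. \<Sum>i. ?I (F k) (X i \<inter> B k))"
      unfolding \<nu>_def by (rule suminf_sum) simp
    also have "\<dots> = (\<Sum>k<N. ?I (F k) ((\<Union>i. X i) \<inter> B k))"
    proof (rule sum.cong[OF refl])
      fix k assume "k \<in> {..<N}"
      then have k: "F k \<in> A" "B k \<in> sets borel" using F B_sets by auto
      have inj: "inj_on (snd (F k)) (fst (F k))" using chart_inv_chart[OF k(1)] by (rule inj_on_inverseI)
      have "disjoint_family (\<lambda>i. snd (F k) ` (X i \<inter> B k))"
      proof (unfold disjoint_family_on_def, intro ballI impI)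
        fix i j :: nat assume "i \<noteq> j"
        then have e: "(X i \<inter> B k) \<inter> (X j \<inter> B k) = {}" using X(2) unfolding disjoint_family_on_def by blast
        have "X i \<inter> B k \<subseteq> fst (F k)" "X j \<inter> B k \<subseteq> fst (F k)" using B_sub by blast+
        from inj_on_image_Int[OF inj this] show "snd (F k) ` (X i \<inter> B k) \<inter> snd (F k) ` (X j \<inter> B k) = {}"
          unfolding e by simp
      qed
      moreover have "X i \<in> sets borel" for i using X(1) sets_M by blast
      then have "snd (F k) ` (X i \<inter> B k) \<in> sets borel" for i
        using B_sub[of k] by (intro I_borel[OF k(1)] sets.Int k(2)) blast+
      then have "range (\<lambda>i. snd (F k) ` (X i \<inter> B k)) \<subseteq> sets (chart_measure (F k))"
        by (simp add: image_subset_iff)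
      ultimately have "(\<Sum>i. ?I (F k) (X i \<inter> B k)) = emeasure (chart_measure (F k)) (\<Union>i. snd (F k) ` (X i \<inter> B k))"
        by (intro suminf_emeasure)
      moreover have "(\<Union>i. snd (F k) ` (X i \<inter> B k)) = snd (F k) ` ((\<Union>i. X i) \<inter> B k)" by blast
      ultimately show "(\<Sum>i. ?I (F k) (X i \<inter> B k)) = ?I (F k) ((\<Union>i. X i) \<inter> B k)" by simp
    qed
    finally show "(\<Sum>i. \<nu> (X i)) = \<nu> (\<Union>i. X i)" by (simp add: \<nu>_def)
  qed
  have sa: "sigma_algebra M ?S"
    using sets.sigma_algebra_axioms[of "restrict_space borel M"] by (simp add: space_restrict_space)
  define \<mu> where "\<mu> = measure_of M ?S \<nu>"
  have sets_\<mu>: "sets \<mu> = ?S" unfolding \<mu>_def by (rule sigma_algebra.sets_measure_of_eq[OF sa])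
  have em: "emeasure \<mu> E = \<nu> E" if "E \<in> ?S" for E
    unfolding \<mu>_def by (rule emeasure_measure_of_sigma[OF sa _ ca that]) (simp add: positive_def \<nu>_def)
  have parts: "E = (\<Union>k<N. E \<inter> B k)" if "E \<subseteq> M" for E using that B_cov by blast
  have disj: "disjoint_family_on (\<lambda>k. E \<inter> B k) {..<N}" for E
    using B_disj unfolding disjoint_family_on_def by blast
  have I_int: "?I c E = (\<integral>\<^sup>+x\<in>snd c ` E. ennreal (sqrt (det (g c (chart_inv c x)))) \<partial>lborel)"
    if "c \<in> A" "E \<in> sets borel" "E \<subseteq> fst c" for c E
    using emeasure_chart_measure[OF that(1) I_borel[OF that]] that(3) by (simp add: chart_image_def image_mono)
  have vol: "is_volume \<mu>"
  proof (intro conjI ballI impI)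
    show "sets \<mu> = ?S" by (rule sets_\<mu>)
    fix c E assume c: "c \<in> A" and E: "E \<in> sets \<mu>" "E \<subseteq> fst c"
    have Eb: "E \<in> sets borel" "E \<subseteq> M" using E sets_\<mu> sets_M by auto
    have "emeasure \<mu> E = (\<Sum>k<N. ?I (F k) (E \<inter> B k))" using em E sets_\<mu> by (simp add: \<nu>_def)
    also have "\<dots> = (\<Sum>k<N. ?I c (E \<inter> B k))"
    proof (rule sum.cong[OF refl])
      fix k assume "k \<in> {..<N}"
      then have k: "k < N" by simp
      show "?I (F k) (E \<inter> B k) = ?I c (E \<inter> B k)"
        using B_sub[of k] E(2)
        by (intro chart_measure_change F k c sets.Int Eb B_sets) blast
    qed
    also have "\<dots> = ?I c (\<Union>k<N. E \<inter> B k)"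
    proof (rule I_Un[symmetric, OF c _ _ _ disj])
      show "E \<inter> B k \<in> sets borel" if "k \<in> {..<N}" for k
        using that by (intro sets.Int Eb B_sets) simp
    qed (use E in auto)
    also have "\<dots> = ?I c E" using parts[OF Eb(2)] by simp
    finally show "emeasure \<mu> E = (\<integral>\<^sup>+x\<in>snd c ` E. ennreal (sqrt (det (g c (chart_inv c x)))) \<partial>lborel)"
      using I_int[OF c Eb(1) E(2)] by simp
  qed
  have uniq: "\<mu>' = \<mu>" if \<mu>': "is_volume \<mu>'" for \<mu>'
  proof (rule measure_eqI)
    show "sets \<mu>' = sets \<mu>" using \<mu>' sets_\<mu> by simp
    fix E assume E: "E \<in> sets \<mu>'"
    then have Eb: "E \<in> sets borel" "E \<subseteq> M" using \<mu>' sets_M by auto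
    have EB: "E \<inter> B k \<in> sets \<mu>'" if "k < N" for k
      using \<mu>' sets_M Eb B_sets[OF that] by (auto intro!: sets.Int)
    have "emeasure \<mu>' E = emeasure \<mu>' (\<Union>k<N. E \<inter> B k)" using parts[OF Eb(2)] by simp
    also have "\<dots> = (\<Sum>k<N. emeasure \<mu>' (E \<inter> B k))"
      by (intro sum_emeasure[symmetric] disj) (use EB in auto)
    also have "\<dots> = (\<Sum>k<N. ?I (F k) (E \<inter> B k))"
    proof (rule sum.cong[OF refl])
      fix k assume "k \<in> {..<N}"
      then have k: "k < N" by simp
      have s: "E \<inter> B k \<subseteq> fst (F k)" using B_sub by blast
      have b: "E \<inter> B k \<in> sets borel" using Eb(1) B_sets[OF k] by (rule sets.Int)
      show "emeasure \<mu>' (E \<inter> B k) = ?I (F k) (E \<inter> B k)"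
        unfolding I_int[OF F[OF k] b s] using \<mu>' F[OF k] EB[OF k] s by blast
    qed
    also have "\<dots> = emeasure \<mu> E" using em E \<mu>' by (simp add: \<nu>_def)
    finally show "emeasure \<mu>' E = emeasure \<mu> E" .
  qed
  show ?thesis by (rule ex1I[of is_volume, OF vol uniq])
qed

lemma is_volume_riemannian_volume: "is_volume (riemannian_volume M A g)"
  using theI'[OF volume_exists_unique] unfolding riemannian_volume_def .

end

section \<open>Partitions of unity\<close>

text \<open>Squaring the positive part removes its corner: the map y to
  \<open>(max 0 y)\<^sup>2\<close> has the continuous derivative \<open>2 * max 0 y\<close>. The
  resulting bump vanishes outside the ball of radius \<open>r\<close>, and class C1 is all that is
  required.\<close>

lemma C1_quadratic_bump:
  fixes x0 :: "real^'n::finite"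
  assumes "hs_open S"
  shows "C1 S (\<lambda>x. (max 0 (r\<^sup>2 - (x - x0) \<bullet> (x - x0)))\<^sup>2)"
proof -
  have q: "C1 S (\<lambda>x. r\<^sup>2 - (x - x0) \<bullet> (x - x0))"
    by (rule C1I[OF assms, where D="\<lambda>x. - 2 *\<^sub>R (x - x0)"])
      (auto intro!: derivative_eq_intros continuous_intros simp: inner_commute algebra_simps)
  have d: "((\<lambda>y::real. (max 0 y)\<^sup>2) has_real_derivative 2 * max 0 y) (at y)" for y
  proof (cases "y = 0")
    case True
    have "((\<lambda>h::real. (max 0 h)\<^sup>2 / h) \<longlongrightarrow> 0) (at 0)"
    proof (rule Lim_null_comparison)
      show "\<forall>\<^sub>F h in at (0::real). norm ((max 0 h)\<^sup>2 / h) \<le> \<bar>h\<bar>"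
        by (rule always_eventually) (auto simp: max_def power2_eq_square)
      show "((\<lambda>h::real. \<bar>h\<bar>) \<longlongrightarrow> 0) (at 0)" by (auto intro!: tendsto_eq_intros)
    qed
    then show ?thesis using True by (simp add: has_field_derivative_iff)
  next
    case False
    show ?thesis
    proof (cases "0 < y")
      case True
      have "((\<lambda>y::real. y\<^sup>2) has_real_derivative 2 * max 0 y) (at y)"
        using True by (auto intro!: derivative_eq_intros)
      then show ?thesis
        by (rule has_field_derivative_transform_within_open[of _ _ _ "{0<..}"]) (use True in auto)
    next
      case neg: False
      have "((\<lambda>y::real. 0) has_real_derivative 2 * max 0 y) (at y)" using neg by auto
      then show ?thesis
        by (rule has_field_derivative_transform_within_open[of _ _ _ "{..<0}"]) (use neg False in auto)
    qed
  qed
  show ?thesis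
    by (rule C1_compose_real[OF assms q, where k="\<lambda>y. (max 0 y)\<^sup>2" and k'="\<lambda>y. 2 * max 0 y"])
      (auto intro: d intro!: continuous_intros)
qed

context compact_manifold
begin

lemma openin_domain_imp_M:
  assumes "c \<in> A" "openin (top_of_set (fst c)) U"
  shows "openin (top_of_set M) U"
  using openin_trans[OF assms(2) domain_openin[OF assms(1)]] .

text \<open>At points of the support, which lie in \<open>c\<close>, regularity is carried over by
  the transition map. Off the support the function vanishes on a relatively open set, because
  \<open>K\<close> is closed.\<close>

lemma C1_chart_of_compact_support:
  assumes c: "c \<in> A" "c' \<in> A" and K: "compact K" "K \<subseteq> fst c" and f: "C1_chart c f"
    and z: "\<And>q. q \<in> M - K \<Longrightarrow> f q = 0"
  shows "C1_chart c' f"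
  unfolding C1_chart_def
proof (rule C1_local)
  fix x assume x: "x \<in> chart_image c'"
  define q where "q = chart_inv c' x"
  have q: "q \<in> fst c'" "snd c' q = x" using x c(2) chart_inv_in chart_chart_inv by (simp_all add: q_def)
  show "\<exists>T. openin (top_of_set (chart_image c')) T \<and> x \<in> T \<and> C1 T (\<lambda>x. f (chart_inv c' x))"
  proof (cases "q \<in> K")
    case True
    then have "q \<in> fst c' \<inter> fst c" using q K by blast
    then have "x \<in> snd c' ` (fst c' \<inter> fst c)" using q by blast
    moreover have "C1 (snd c' ` (fst c' \<inter> fst c)) (\<lambda>x. f (chart_inv c' x))"
      by (rule C1_overlap(1)[OF c(2,1)]) (rule C1_chart_overlap[OF c f])
    ultimately show ?thesis using overlap_image_openin[OF c(2,1)] by blast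
  next
    case False
    have o: "openin (top_of_set (fst c')) (fst c' - K)"
      using compact_imp_closed[OF K(1)] by (metis Diff_eq open_Compl openin_open_Int)
    let ?T = "snd c' ` (fst c' - K)"
    have T: "openin (top_of_set (chart_image c')) ?T" by (rule chart_image_openin[OF c(2) o])
    have hs: "hs_open ?T" using hs_open_openin[OF hs_open_chart_image[OF c(2)] T] .
    have "f (chart_inv c' y) = 0" if yT: "y \<in> ?T" for y
    proof -
      obtain p where p: "p \<in> fst c' - K" "y = snd c' p" using yT by blast
      then have "chart_inv c' y = p" using chart_inv_chart[OF c(2)] by simp
      moreover have "p \<in> M - K" using p domain_subset[OF c(2)] by blast
      ultimately show ?thesis using z by simp
    qed
    then have "C1 ?T (\<lambda>x. f (chart_inv c' x)) \<longleftrightarrow> C1 ?T (\<lambda>x. 0)" by (rule C1_cong)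
    then have "C1 ?T (\<lambda>x. f (chart_inv c' x))" using hs by simp
    moreover have "x \<in> ?T" using q False by blast
    ultimately show ?thesis using T by blast
  qed
qed

text \<open>The bump is a quadratic one in the coordinates of \<open>c\<close>, extended by zero.
  Its supporting ball is cut with the closed half-space, so \<open>p\<close> may be a boundary
  point, where the bump is then positive as well.\<close>

lemma bump_function:
  assumes c: "c \<in> A" "p \<in> fst c" and U: "openin (top_of_set M) U" "p \<in> U"
  obtains \<psi> K where "compact K" "K \<subseteq> fst c" "K \<subseteq> U" "\<And>q. 0 \<le> \<psi> q" "\<psi> p > 0"
    "\<And>q. q \<notin> K \<Longrightarrow> \<psi> q = (0::real)" "\<And>c'. c' \<in> A \<Longrightarrow> C1_chart c' \<psi>"
proof -
  let ?S = "chart_image c"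
  obtain b where b: "openin (top_of_set {x. 0 \<le> b \<bullet> x}) ?S" using chart_halfspace[OF c(1)] by blast
  have o: "openin (top_of_set (fst c)) (fst c \<inter> U)"
  proof -
    obtain W where "open W" "U = M \<inter> W" using U(1) by (auto simp: openin_open)
    moreover have "fst c \<inter> (M \<inter> W) = fst c \<inter> W" using domain_subset[OF c(1)] by blast
    ultimately show ?thesis by (simp add: openin_open_Int)
  qed
  have o': "openin (top_of_set {x. 0 \<le> b \<bullet> x}) (snd c ` (fst c \<inter> U))"
    using openin_trans[OF chart_image_openin[OF c(1) o] b] .
  let ?x = "snd c p"
  have "?x \<in> snd c ` (fst c \<inter> U)" using c U by blast
  then obtain e where e: "e > 0" "ball ?x e \<inter> {x. 0 \<le> b \<bullet> x} \<subseteq> snd c ` (fst c \<inter> U)"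
    using o' unfolding openin_contains_ball by blast
  \<comment> \<open>Half the radius, so that the closed ball still lies in the open one.\<close>
  define r where "r = e / 2"
  have r: "r > 0" "cball ?x r \<subseteq> ball ?x e" using e by (auto simp: r_def)
  let ?K' = "cball ?x r \<inter> {x. 0 \<le> b \<bullet> x}"
  have K': "compact ?K'" "?K' \<subseteq> snd c ` (fst c \<inter> U)" "?K' \<subseteq> ?S"
  proof -
    show "compact ?K'" by (intro compact_Int_closed compact_cball closed_halfspace_ge)
    show "?K' \<subseteq> snd c ` (fst c \<inter> U)" using r e by blast
    then show "?K' \<subseteq> ?S" by (auto simp: chart_image_def)
  qed
  define K where "K = chart_inv c ` ?K'"
  define \<beta> where "\<beta> x = (max 0 (r\<^sup>2 - (x - ?x) \<bullet> (x - ?x)))\<^sup>2" for x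
  define \<psi> where "\<psi> q = (if q \<in> fst c then \<beta> (snd c q) else 0)" for q
  have cK: "compact K" unfolding K_def
    using K' continuous_chart_inv[OF c(1)] by (intro compact_continuous_image) (auto intro: continuous_on_subset)
  have KU: "K \<subseteq> fst c \<inter> U"
  proof
    fix q assume "q \<in> K"
    then obtain y where y: "y \<in> ?K'" "q = chart_inv c y" by (auto simp: K_def)
    then obtain q' where q': "q' \<in> fst c \<inter> U" "y = snd c q'" using K'(2) by blast
    then show "q \<in> fst c \<inter> U" using chart_inv_chart[OF c(1)] y by simp
  qed
  have z: "\<psi> q = 0" if "q \<notin> K" for q
  proof (cases "q \<in> fst c")
    case True
    have "snd c q \<notin> ?K'"
    proof
      assume "snd c q \<in> ?K'"
      then have "chart_inv c (snd c q) \<in> K" unfolding K_def by (rule imageI)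
      then show False using that chart_inv_chart[OF c(1) True] by simp
    qed
    moreover have "0 \<le> b \<bullet> snd c q" using chart_in_image[OF True] b openin_imp_subset by blast
    ultimately have "r < dist ?x (snd c q)" by simp
    then have "r\<^sup>2 \<le> (norm (snd c q - ?x))\<^sup>2" using r by (simp add: dist_norm norm_minus_commute power_mono)
    then have "r\<^sup>2 - (snd c q - ?x) \<bullet> (snd c q - ?x) \<le> 0" by (simp add: power2_norm_eq_inner)
    then show ?thesis by (simp add: \<psi>_def \<beta>_def)
  qed (simp add: \<psi>_def)
  have Cc: "C1_chart c \<psi>"
  proof -
    have "C1 ?S (\<lambda>x. \<psi> (chart_inv c x)) \<longleftrightarrow> C1 ?S \<beta>"
      by (rule C1_cong) (simp add: \<psi>_def chart_inv_in[OF c(1)] chart_chart_inv[OF c(1)])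
    then show ?thesis
      using C1_quadratic_bump[OF hs_open_chart_image[OF c(1)]] by (simp add: C1_chart_def \<beta>_def[abs_def])
  qed
  show ?thesis
  proof (rule that[of K \<psi>])
    show "C1_chart c' \<psi>" if "c' \<in> A" for c'
      by (rule C1_chart_of_compact_support[OF c(1) that cK _ Cc]) (use KU z in auto)
    show "\<psi> p > 0" using c r by (simp add: \<psi>_def \<beta>_def)
    show "0 \<le> \<psi> q" for q by (simp add: \<psi>_def \<beta>_def)
  qed (use cK KU z in auto)
qed

text \<open>Finitely many bumps are positive somewhere at each point, by compactness, and are
  divided by their sum. Each is supported in the chart chosen for its own index point
  \<open>p\<close>.\<close>

lemma partition_of_unity:
  obtains P :: "'a set" and pu :: "'a \<Rightarrow> 'a \<Rightarrow> real" and K :: "'a \<Rightarrow> 'a set"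
  where "finite P" "P \<subseteq> M" "\<And>p. p \<in> P \<Longrightarrow> compact (K p)" "\<And>p. p \<in> P \<Longrightarrow> K p \<subseteq> fst (chart_at A p)"
    "\<And>p q. p \<in> P \<Longrightarrow> q \<notin> K p \<Longrightarrow> pu p q = 0" "\<And>p c. p \<in> P \<Longrightarrow> c \<in> A \<Longrightarrow> C1_chart c (pu p)"
    "\<And>q. q \<in> M \<Longrightarrow> (\<Sum>p\<in>P. pu p q) = 1" "M = (\<Union>p\<in>P. K p)"
proof -
  \<comment> \<open>Function and support are packed into a pair so that a single application of
    choice provides both.\<close>
  define Q where "Q p z \<longleftrightarrow> compact (snd z) \<and> snd z \<subseteq> fst (chart_at A p) \<and> (\<forall>q. 0 \<le> fst z q) \<and> fst z p > (0::real) \<and>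
    (\<forall>q. q \<notin> snd z \<longrightarrow> fst z q = 0) \<and> (\<forall>c\<in>A. C1_chart c (fst z))" for p and z :: "('a \<Rightarrow> real) \<times> 'a set"
  have "\<forall>p\<in>M. \<exists>z. Q p z"
  proof
    fix p assume p: "p \<in> M"
    show "\<exists>z. Q p z"
    proof (rule bump_function[OF chart_at[OF p]])
      fix f :: "'a \<Rightarrow> real" and K
      assume "compact K" "K \<subseteq> fst (chart_at A p)" "\<And>q. 0 \<le> f q" "f p > 0"
        "\<And>q. q \<notin> K \<Longrightarrow> f q = 0" "\<And>c. c \<in> A \<Longrightarrow> C1_chart c f"
      then show ?thesis unfolding Q_def by (intro exI[of _ "(f, K)"]) simp
    qed (use p in simp_all)
  qed
  then obtain z where z: "\<forall>p\<in>M. Q p (z p)" by (rule bchoice[THEN exE])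
  define \<psi> where "\<psi> p = fst (z p)" for p
  define K where "K p = snd (z p)" for p
  have \<psi>: "\<And>p. p \<in> M \<Longrightarrow> compact (K p)" "\<And>p. p \<in> M \<Longrightarrow> K p \<subseteq> fst (chart_at A p)"
    "\<And>p q. p \<in> M \<Longrightarrow> 0 \<le> \<psi> p q" "\<And>p. p \<in> M \<Longrightarrow> \<psi> p p > (0::real)"
    "\<And>p q. p \<in> M \<Longrightarrow> q \<notin> K p \<Longrightarrow> \<psi> p q = 0" "\<And>p c. p \<in> M \<Longrightarrow> c \<in> A \<Longrightarrow> C1_chart c (\<psi> p)"
    using z by (simp_all add: Q_def \<psi>_def K_def)
  have cont: "continuous_on M (\<psi> p)" if "p \<in> M" for p
    by (rule continuous_on_M) (rule C1_chart_continuous[OF _ \<psi>(6)[OF that]])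
  have "\<exists>W. open W \<and> M \<inter> W = {q \<in> M. \<psi> p q > 0}" if "p \<in> M" for p
  proof -
    have "openin (top_of_set M) (M \<inter> \<psi> p -` {0<..})"
      by (rule continuous_openin_preimage_gen[OF cont[OF that]]) simp
    then show ?thesis by (auto simp: openin_open)
  qed
  then obtain W where W: "\<And>p. p \<in> M \<Longrightarrow> open (W p)" "\<And>p. p \<in> M \<Longrightarrow> M \<inter> W p = {q \<in> M. \<psi> p q > 0}"
    by metis
  have "M \<subseteq> (\<Union>p\<in>M. W p)" using W(2) \<psi>(4) by blast
  then obtain P where P: "P \<subseteq> M" "finite P" "M \<subseteq> (\<Union>p\<in>P. W p)"
    using compactE_image[OF compact_M, of M W] W(1) by metis
  define s where "s q = (\<Sum>p\<in>P. \<psi> p q)" for q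
  have pos: "\<exists>p\<in>P. \<psi> p q > 0" if "q \<in> M" for q
    using that P W(2) by blast
  have s: "s q > 0" if "q \<in> M" for q
  proof -
    obtain p where "p \<in> P" "\<psi> p q > 0" using pos[OF \<open>q \<in> M\<close>] by blast
    then show ?thesis unfolding s_def using P \<psi>(3) by (intro sum_pos2[of P p]) auto
  qed
  have sC: "C1_chart c s" if "c \<in> A" for c
    unfolding s_def[abs_def] by (rule C1_chart_sum[OF that]) (use P \<psi>(6) that in blast)
  define pu where "pu p q = \<psi> p q * inverse (s q)" for p q
  show ?thesis
  proof (rule that[of P K pu])
    show "C1_chart c (pu p)" if "p \<in> P" "c \<in> A" for p c
      unfolding pu_def[abs_def]
    proof (rule C1_chart_mult)
      show "C1_chart c (\<lambda>q. inverse (s q))"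
        unfolding C1_chart_def
      proof (rule C1_inverse[OF hs_open_chart_image[OF that(2)]])
        show "C1 (chart_image c) (\<lambda>x. s (chart_inv c x))" using sC[OF that(2)] by (simp add: C1_chart_def)
        show "s (chart_inv c x) \<noteq> 0" if x: "x \<in> chart_image c" for x
        proof -
          have "chart_inv c x \<in> M" using chart_inv_in[OF \<open>c \<in> A\<close> x] domain_subset[OF \<open>c \<in> A\<close>] by blast
          then show ?thesis using s by force
        qed
      qed
    qed (use that P \<psi>(6) in blast)+
    show "(\<Sum>p\<in>P. pu p q) = 1" if "q \<in> M" for q
      using s[OF that] by (simp add: pu_def sum_distrib_right[symmetric] s_def)
    show "M = (\<Union>p\<in>P. K p)"
    proof
      show "M \<subseteq> (\<Union>p\<in>P. K p)"
      proof
        fix q assume "q \<in> M"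
        then obtain p where p: "p \<in> P" "\<psi> p q > 0" using pos by blast
        then have "q \<in> K p" using \<psi>(5)[of p q] P(1) by (cases "q \<in> K p") auto
        then show "q \<in> (\<Union>p\<in>P. K p)" using p by blast
      qed
      have "K p \<subseteq> M" if "p \<in> P" for p
      proof -
        have "p \<in> M" using that P(1) by blast
        then show ?thesis using \<psi>(2) domain_subset[OF chart_at(1)] by blast
      qed
      then show "(\<Union>p\<in>P. K p) \<subseteq> M" by blast
    qed
  qed (use P \<psi> in \<open>auto simp: pu_def subset_iff\<close>)
qed

end

section \<open>The weighted Laplacian in a chart\<close>

text \<open>The contravariant transformation law of the inverse metric, obtained by cancelling the
  invertible factor \<open>transpose J\<close>.\<close>

lemma matrix_inv_congruence:
  fixes J g' :: "real^'n::finite^'n"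
  assumes g: "g = transpose J ** g' ** J" and J: "det J \<noteq> 0" and d: "det g \<noteq> 0"
  shows "matrix_inv g' = J ** matrix_inv g ** transpose J"
proof (rule matrix_inv_eqI)
  have "transpose J ** (g' ** (J ** matrix_inv g ** transpose J)) = g ** matrix_inv g ** transpose J"
    by (simp add: g matrix_mul_assoc)
  also have "\<dots> = transpose J" using matrix_inv_right_left(1)[OF d] by simp
  finally have "matrix_inv (transpose J) ** (transpose J ** (g' ** (J ** matrix_inv g ** transpose J)))
      = matrix_inv (transpose J) ** transpose J" by simp
  then show "g' ** (J ** matrix_inv g ** transpose J) = mat 1"
    using matrix_inv_right_left(2)[of "transpose J"] J by (simp add: matrix_mul_assoc)
qed

lemma inner_transpose_mult: "(transpose A *v x) \<bullet> y = x \<bullet> (A *v (y :: real^'n::finite))"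
  by (metis dot_lmul_matrix vector_transpose_matrix transpose_transpose)

lemma inner_matrix_mult_symmetric:
  assumes "transpose A = A"
  shows "x \<bullet> (A *v (y :: real^'n::finite)) = y \<bullet> (A *v x)"
  by (metis assms inner_commute inner_transpose_mult)

lemma inner_matrix_mult_sum:
  "x \<bullet> (A *v (y :: real^'n::finite)) = (\<Sum>i\<in>UNIV. \<Sum>j\<in>UNIV. A $ i $ j * x $ i * y $ j)"
  by (simp add: Finite_Cartesian_Product.inner_vec_def matrix_vector_mult_def sum_distrib_left mult_ac)

context riemannian_compact_manifold
begin

lemma metric_inverse_symmetric:
  assumes "c \<in> A" "p \<in> fst c"
  shows "transpose (matrix_inv (g c p)) = matrix_inv (g c p)"
  using matrix_inv_transpose_symmetric det_metric_pos[OF assms] metric_symmetric[OF assms] by (metis less_irrefl)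

lemma chart_ip_sym:
  assumes "c \<in> A" "p \<in> fst c"
  shows "chart_ip g c f h p = chart_ip g c h f p"
  unfolding chart_ip_def by (rule inner_matrix_mult_symmetric[OF metric_inverse_symmetric[OF assms]])

text \<open>The Jacobians from the two differentials cancel against those from the inverse
  metric.\<close>

lemma chart_ip_change:
  assumes c: "c \<in> A" "c' \<in> A" and f: "C1_chart c' f" "C1_chart c' h" and p: "p \<in> fst c \<inter> fst c'"
  shows "chart_ip g c f h p = chart_ip g c' f h p"
proof -
  let ?J = "jacobian c c' p"
  have "matrix_inv (g c' p) = ?J ** matrix_inv (g c p) ** transpose ?J"
    using matrix_inv_congruence[OF metric_change[OF c p]] det_jacobian_pos[OF c p] det_metric_pos[OF c(1), of p] p by simp
  then show ?thesis
    unfolding chart_ip_def chart_diff_change[OF c f(1) p] chart_diff_change[OF c f(2) p]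
    by (simp only: inner_transpose_mult matrix_vector_mul_assoc matrix_mul_assoc)
qed

lemma inner_vec_gradient:
  assumes "p \<in> M"
  shows "inner_vec A g (gradient g f) (gradient g h) p = chart_ip g (chart_at A p) f h p"
proof -
  let ?c = "chart_at A p"
  note c = chart_at[OF assms]
  let ?G = "matrix_inv (g ?c p)"
  have grad: "gradient g f ?c p = ?G *v chart_diff ?c f p" for f
    by (simp add: gradient_def metric_inverse_def chart_diff_def matrix_vector_mult_def vec_eq_iff)
  have "inner_vec A g (gradient g f) (gradient g h) p = (?G *v chart_diff ?c f p) \<bullet> (g ?c p *v (?G *v chart_diff ?c h p))"
    by (simp add: inner_vec_def Let_def inner_matrix_mult_sum grad)
  also have "\<dots> = (?G *v chart_diff ?c f p) \<bullet> chart_diff ?c h p"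
    using matrix_inv_right_left(1)[of "g ?c p"] det_metric_pos[OF c] by (simp add: matrix_vector_mul_assoc)
  also have "\<dots> = chart_diff ?c f p \<bullet> (?G *v chart_diff ?c h p)"
    using inner_transpose_mult[of ?G] metric_inverse_symmetric[OF c] by metis
  finally show ?thesis by (simp add: chart_ip_def)
qed

lemma drift_laplacian_eq:
  assumes "p \<in> M"
  shows "drift_laplacian A g \<eta> f p = chart_drift g \<eta> (chart_at A p) f p"
  using inner_vec_gradient[OF assms]
  by (simp add: drift_laplacian_def laplace_beltrami_def tensor_trace_def chart_drift_def Let_def metric_inverse_def)

lemma continuous_chart_ip:
  assumes "c \<in> A" "C1_chart c f" "C1_chart c h"
  shows "continuous_on (fst c) (chart_ip g c f h)"
proof -
  have "continuous_on (fst c) (\<lambda>p. \<Sum>i\<in>UNIV. \<Sum>j\<in>UNIV. matrix_inv (g c p) $ i $ j * pd c i f p * pd c j h p)"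
    by (intro continuous_on_sum continuous_on_mult C1_chart_continuous_pd assms
        C1_chart_continuous[OF assms(1) metric_inverse_C1[OF assms(1)]])
  then show ?thesis by (simp add: chart_ip_def[abs_def] inner_matrix_mult_sum chart_diff_def)
qed

lemma pd_det_metric:
  assumes c: "c \<in> A" "p \<in> fst c"
  shows "pd c k (\<lambda>q. det (g c q)) p
    = det (g c p) * (\<Sum>i\<in>UNIV. \<Sum>j\<in>UNIV. matrix_inv (g c p) $ j $ i * pd c k (\<lambda>q. g c q $ i $ j) p)"
  using partial_det[OF hs_open_chart_image[OF c(1)] chart_in_image[OF c(2)], of "\<lambda>x. g c (chart_inv c x)" k]
    metric_C1[OF c(1)] det_metric_pos[OF c] chart_inv_chart[OF c]
  by (simp add: pd_eq_partial C1_chart_def)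

lemma pd_metric_inverse:
  assumes c: "c \<in> A" "p \<in> fst c"
  shows "pd c k (\<lambda>q. matrix_inv (g c q) $ i $ j) p
    = - (\<Sum>a\<in>UNIV. \<Sum>b\<in>UNIV. matrix_inv (g c p) $ i $ a * pd c k (\<lambda>q. g c q $ a $ b) p * matrix_inv (g c p) $ b $ j)"
proof -
  have "det (g c (chart_inv c x)) \<noteq> 0" if "x \<in> chart_image c" for x
    using det_metric_pos[OF c(1) chart_inv_in[OF c(1) that]] by simp
  then show ?thesis
    using partial_matrix_inv[OF hs_open_chart_image[OF c(1)] chart_in_image[OF c(2)], of "\<lambda>x. g c (chart_inv c x)" k i j]
      metric_C1[OF c(1)] chart_inv_chart[OF c]
    by (simp add: pd_eq_partial C1_chart_def)
qed

end

locale weighted_compact_manifold = riemannian_compact_manifold M A g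
  for M :: "'a::{second_countable_topology, t2_space} set" and A :: "('a, 'n::finite) chart set" and g +
  fixes \<eta> :: "'a \<Rightarrow> real"
  assumes weight_smooth: "smooth_fun A \<eta>"
begin

lemma eta_C1: "c \<in> A \<Longrightarrow> C1_chart c \<eta>"
  using weight_smooth smooth_in_chart_C1 by (simp add: smooth_fun_def)

lemma exp_eta_C1: "c \<in> A \<Longrightarrow> C1_chart c (\<lambda>p. exp (- \<eta> p))"
  using eta_C1 unfolding C1_chart_def by (intro C1_exp C1_minus hs_open_chart_image) simp_all

lemma chart_weight_C1: "c \<in> A \<Longrightarrow> C1_chart c (chart_weight g \<eta> c)"
  unfolding chart_weight_def[abs_def] by (intro C1_chart_mult sqrt_det_metric_C1 exp_eta_C1)

lemma chart_weight_pos: "c \<in> A \<Longrightarrow> p \<in> fst c \<Longrightarrow> 0 < chart_weight g \<eta> c p"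
  using det_metric_pos by (simp add: chart_weight_def)

lemma chart_weight_change:
  "c \<in> A \<Longrightarrow> c' \<in> A \<Longrightarrow> p \<in> fst c \<inter> fst c' \<Longrightarrow>
    chart_weight g \<eta> c p = det (jacobian c c' p) * chart_weight g \<eta> c' p"
  unfolding chart_weight_def using sqrt_det_metric_change[of c c' p] by simp

text \<open>The bracket is the logarithmic derivative of sqrt (det g) exp (-\<eta>), its first part
  coming from Jacobi's formula.\<close>

lemma pd_chart_weight:
  assumes c: "c \<in> A" "p \<in> fst c"
  shows "pd c k (chart_weight g \<eta> c) p = chart_weight g \<eta> c p *
    (1/2 * (\<Sum>i\<in>UNIV. \<Sum>j\<in>UNIV. matrix_inv (g c p) $ j $ i * pd c k (\<lambda>q. g c q $ i $ j) p) - pd c k \<eta> p)"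
proof -
  note hs = hs_open_chart_image[OF c(1)] and x = chart_in_image[OF c(2)] and inv = chart_inv_chart[OF c]
  have dC: "C1_chart c (\<lambda>q. det (g c q))"
    unfolding C1_chart_def by (rule C1_det[OF hs]) (use metric_C1[OF c(1)] in \<open>simp add: C1_chart_def\<close>)
  have 1: "pd c k (\<lambda>q. sqrt (det (g c q))) p = inverse (sqrt (det (g c p))) / 2 * pd c k (\<lambda>q. det (g c q)) p"
    using partial_compose_real[OF hs x C1_chart_differentiable[OF dC c(2)], of sqrt _ k]
      DERIV_real_sqrt[OF det_metric_pos[OF c]] inv by (simp add: pd_eq_partial)
  have mC: "C1_chart c (\<lambda>q. - \<eta> q)" using C1_minus[OF hs] eta_C1[OF c(1)] by (simp add: C1_chart_def)
  have um: "(uminus has_real_derivative - 1) (at y)" for y :: real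
    by (rule DERIV_minus[OF DERIV_ident])
  have "pd c k (\<lambda>q. - \<eta> q) p = (- 1) * pd c k \<eta> p"
    using partial_compose_real[OF hs x C1_chart_differentiable[OF eta_C1[OF c(1)] c(2)] um, of k]
    by (simp add: pd_eq_partial)
  moreover have "pd c k (\<lambda>q. exp (- \<eta> q)) p = exp (- \<eta> p) * pd c k (\<lambda>q. - \<eta> q) p"
    using partial_compose_real[OF hs x C1_chart_differentiable[OF mC c(2)] DERIV_exp, of k]
      inv by (simp add: pd_eq_partial)
  ultimately have 2: "pd c k (\<lambda>q. exp (- \<eta> q)) p = - exp (- \<eta> p) * pd c k \<eta> p" by simp
  have a: "pd c k (chart_weight g \<eta> c) p
     = sqrt (det (g c p)) * pd c k (\<lambda>q. exp (- \<eta> q)) p + exp (- \<eta> p) * pd c k (\<lambda>q. sqrt (det (g c q))) p"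
    unfolding chart_weight_def[abs_def] by (rule pd_mult[OF c(1) sqrt_det_metric_C1[OF c(1)] exp_eta_C1[OF c(1)] c(2)])
  have "inverse (sqrt (det (g c p))) * det (g c p) = sqrt (det (g c p))"
    using det_metric_pos[OF c] by (simp add: divide_inverse[symmetric] mult.commute real_div_sqrt)
  then have b: "exp (- \<eta> p) * pd c k (\<lambda>q. sqrt (det (g c q))) p = chart_weight g \<eta> c p *
    (1/2 * (\<Sum>i\<in>UNIV. \<Sum>j\<in>UNIV. matrix_inv (g c p) $ j $ i * pd c k (\<lambda>q. g c q $ i $ j) p))"
    unfolding 1 pd_det_metric[OF c] chart_weight_def by (simp add: mult.assoc[symmetric]) 
  show ?thesis unfolding a b 2 by (simp add: chart_weight_def algebra_simps)
qed

text \<open>The i-th component of the gradient of \<open>f\<close> times the chart weight; its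
  coordinate divergence is the weight times the drift Laplacian.\<close>

definition flux :: "('a, 'n) chart \<Rightarrow> 'n \<Rightarrow> ('a \<Rightarrow> real) \<Rightarrow> 'a \<Rightarrow> real" where
  "flux c i f q = chart_weight g \<eta> c q * (\<Sum>j\<in>UNIV. matrix_inv (g c q) $ i $ j * pd c j f q)"

lemma flux_C1:
  assumes "c \<in> A" "\<And>j. C1_chart c (pd c j f)"
  shows "C1_chart c (flux c i f)"
  unfolding flux_def[abs_def]
  by (intro C1_chart_mult C1_chart_sum chart_weight_C1 metric_inverse_C1 assms)

text \<open>The divergence form of the drift Laplacian, in one chart. Differentiating the product of
  weight, inverse metric and differential gives the second derivatives of \<open>f\<close>, the
  pairing with the differential of \<eta>, and terms in the first derivatives of the metric, which
  must be recognised as the Christoffel part of the Hessian.\<close>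

lemma divergence_flux:
  assumes c: "c \<in> A" "p \<in> fst c" and f: "\<And>j. C1_chart c (pd c j f)"
  shows "(\<Sum>i\<in>UNIV. pd c i (flux c i f) p) = chart_weight g \<eta> c p * chart_drift g \<eta> c f p"
proof -
  define W where "W = chart_weight g \<eta> c p"
  define G where "G i j = matrix_inv (g c p) $ i $ j" for i j
  define D where "D i a b = pd c i (\<lambda>q. g c q $ a $ b) p" for i a b
  define f1 where "f1 j = pd c j f p" for j
  define f2 where "f2 i j = pd c i (pd c j f) p" for i j
  define e where "e i = pd c i \<eta> p" for i
  define X where "X i = (\<Sum>a\<in>UNIV. \<Sum>b\<in>UNIV. G b a * D i a b)" for i
  define Y where "Y i = (\<Sum>j\<in>UNIV. G i j * f1 j)" for i
  have Gs: "G i j = G j i" for i j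
    using arg_cong[OF metric_inverse_symmetric[OF c], of "\<lambda>m. m $ j $ i"] by (simp add: transpose_def G_def)
  have Ds: "D i a b = D i b a" for i a b
    unfolding D_def
  proof (rule pd_cong[OF c(1) _ c(2)])
    fix q assume "q \<in> fst c"
    from arg_cong[OF metric_symmetric[OF c(1) this], of "\<lambda>m. m $ b $ a"]
    show "g c q $ a $ b = g c q $ b $ a" by (simp add: transpose_def)
  qed
  have S: "pd c i (\<lambda>q. \<Sum>j\<in>UNIV. matrix_inv (g c q) $ i $ j * pd c j f q) p
      = (\<Sum>j\<in>UNIV. G i j * f2 i j - f1 j * (\<Sum>a\<in>UNIV. \<Sum>b\<in>UNIV. G i a * D i a b * G b j))" for i
  proof -
    have "pd c i (\<lambda>q. \<Sum>j\<in>UNIV. matrix_inv (g c q) $ i $ j * pd c j f q) p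
        = (\<Sum>j\<in>UNIV. pd c i (\<lambda>q. matrix_inv (g c q) $ i $ j * pd c j f q) p)"
      by (rule pd_sum[OF c(1) _ c(2)]) (intro C1_chart_mult metric_inverse_C1 c f)
    also have "\<dots> = (\<Sum>j\<in>UNIV. G i j * f2 i j + f1 j * pd c i (\<lambda>q. matrix_inv (g c q) $ i $ j) p)"
      using pd_mult[OF c(1) metric_inverse_C1[OF c(1)] f c(2)] by (simp add: G_def f1_def f2_def)
    finally show ?thesis by (simp add: pd_metric_inverse[OF c] G_def D_def)
  qed
  have "pd c i (flux c i f) p = W * (\<Sum>j\<in>UNIV. G i j * f2 i j - f1 j * (\<Sum>a\<in>UNIV. \<Sum>b\<in>UNIV. G i a * D i a b * G b j))
     + (\<Sum>j\<in>UNIV. G i j * f1 j) * (W * (1/2 * (\<Sum>a\<in>UNIV. \<Sum>b\<in>UNIV. G b a * D i a b) - e i))" for i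
  proof -
    have C: "C1_chart c (\<lambda>q. \<Sum>j\<in>UNIV. matrix_inv (g c q) $ i $ j * pd c j f q)"
      by (intro C1_chart_sum C1_chart_mult metric_inverse_C1 c f)
    show ?thesis
      unfolding flux_def[abs_def] pd_mult[OF c(1) chart_weight_C1[OF c(1)] C c(2)] S pd_chart_weight[OF c]
      by (simp add: W_def G_def D_def f1_def e_def)
  qed
  then have fl: "pd c i (flux c i f) p = W * (\<Sum>j\<in>UNIV. G i j * f2 i j - f1 j * (\<Sum>a\<in>UNIV. \<Sum>b\<in>UNIV. G i a * D i a b * G b j))
     + Y i * (W * (1/2 * X i - e i))" for i
    by (simp only: X_def Y_def)
  have "(\<Sum>i\<in>UNIV. pd c i (flux c i f) p) = (\<Sum>i\<in>UNIV. W * (\<Sum>j\<in>UNIV. G i j * f2 i j)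
      - W * (\<Sum>j\<in>UNIV. (\<Sum>a\<in>UNIV. \<Sum>b\<in>UNIV. G i a * D i a b * G b j) * f1 j)
      + W * (1/2 * X i * Y i) - W * (e i * Y i))"
    unfolding fl by (intro sum.cong refl) (simp add: sum_subtractf right_diff_distrib mult_ac)
  then have "(\<Sum>i\<in>UNIV. pd c i (flux c i f) p)
    = W * ((\<Sum>i\<in>UNIV. \<Sum>j\<in>UNIV. G i j * f2 i j)
      - ((\<Sum>i\<in>UNIV. \<Sum>j\<in>UNIV. (\<Sum>a\<in>UNIV. \<Sum>b\<in>UNIV. G i a * D i a b * G b j) * f1 j)
      - (\<Sum>i\<in>UNIV. 1/2 * (\<Sum>a\<in>UNIV. \<Sum>b\<in>UNIV. G b a * D i a b) * (\<Sum>j\<in>UNIV. G i j * f1 j)))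
      - (\<Sum>i\<in>UNIV. e i * (\<Sum>j\<in>UNIV. G i j * f1 j)))"
    unfolding X_def[symmetric] Y_def[symmetric]
    by (simp only: sum.distrib sum_subtractf sum_distrib_left[of W, symmetric]) (simp add: algebra_simps)
  \<comment> \<open>The derivatives of the inverse metric and of sqrt (det g) combine into the trace
    of the Christoffel term.\<close>
  also have "\<dots> = W * ((\<Sum>i\<in>UNIV. \<Sum>j\<in>UNIV. G i j * f2 i j)
      - (\<Sum>i\<in>UNIV. \<Sum>j\<in>UNIV. G i j * (\<Sum>k\<in>UNIV. (1/2 * (\<Sum>l\<in>UNIV. G k l * (D i j l + D j i l - D l i j))) * f1 k))
      - (\<Sum>i\<in>UNIV. e i * (\<Sum>j\<in>UNIV. G i j * f1 j)))"
    unfolding christoffel_trace_algebra[of G D f1, OF Gs Ds] ..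
  also have "\<dots> = W * chart_drift g \<eta> c f p"
    by (simp add: chart_drift_def hessian_def christoffel_def metric_inverse_def chart_ip_def
        Finite_Cartesian_Product.inner_vec_def matrix_vector_mult_def chart_diff_def
        G_def[symmetric] D_def[symmetric] f1_def[symmetric] f2_def[symmetric] e_def[symmetric]
        right_diff_distrib sum_subtractf)
  finally show ?thesis by (simp add: W_def)
qed

end

section \<open>Integration against the weighted measure\<close>

text \<open>Compact pieces inside charts, unlike the chart domains themselves, yield uniform bounds
  from continuity.\<close>

lemma (in compact_manifold) finite_compact_cover:
  obtains P :: "'a set" and K :: "'a \<Rightarrow> 'a set"
  where "finite P" "P \<subseteq> M" "\<forall>p\<in>P. compact (K p) \<and> K p \<subseteq> fst (chart_at A p)" "M = (\<Union>p\<in>P. K p)"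
proof (rule partition_of_unity)
  fix P K and pu :: "'a \<Rightarrow> 'a \<Rightarrow> real"
  assume "finite P" "P \<subseteq> M" "\<And>p. p \<in> P \<Longrightarrow> compact (K p)" "\<And>p. p \<in> P \<Longrightarrow> K p \<subseteq> fst (chart_at A p)"
    "M = (\<Union>p\<in>P. K p)"
  then show thesis by (intro that[of P K]) simp_all
qed

context weighted_compact_manifold
begin

abbreviation "m \<equiv> weighted_measure M A g \<eta>"
abbreviation "vol \<equiv> riemannian_volume M A g"

lemma sets_vol [simp]: "sets vol = sets (restrict_space borel M)"
  using is_volume_riemannian_volume by blast

lemma space_vol [simp]: "space vol = M"
  using sets_eq_imp_space_eq[OF sets_vol] by (simp add: space_restrict_space)

lemma sets_m [simp]: "sets m = sets (restrict_space borel M)"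
  by (simp add: weighted_measure_def)

lemma space_m [simp]: "space m = M"
  by (simp add: weighted_measure_def)

lemma emeasure_vol:
  assumes "c \<in> A" "E \<in> sets borel" "E \<subseteq> fst c"
  shows "emeasure vol E = emeasure (chart_measure c) (snd c ` E)"
proof -
  have "E \<in> sets vol" using assms domain_subset[OF assms(1)] by (auto simp: sets_M)
  then have "emeasure vol E = (\<integral>\<^sup>+x\<in>snd c ` E. ennreal (sqrt (det (g c (chart_inv c x)))) \<partial>lborel)"
    using is_volume_riemannian_volume assms by blast
  also have "\<dots> = emeasure (chart_measure c) (snd c ` E)"
    by (rule emeasure_chart_measure[symmetric, OF assms(1) chart_image_borel[OF assms]])
      (use assms(3) in \<open>auto simp: chart_image_def\<close>)
  finally show ?thesis .
qed

lemma measurable_M: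
  fixes f :: "'a \<Rightarrow> real"
  assumes "continuous_on M f"
  shows "f \<in> borel_measurable vol" "f \<in> borel_measurable m" "f \<in> borel_measurable (restrict_space borel M)"
proof -
  show f: "f \<in> borel_measurable (restrict_space borel M)"
    using assms by (rule borel_measurable_continuous_on_restrict)
  show "f \<in> borel_measurable vol" "f \<in> borel_measurable m"
    using f measurable_cong_sets[OF sets_vol refl] measurable_cong_sets[OF sets_m refl] by blast+
qed

lemma continuous_eta: "continuous_on M \<eta>"
  by (rule continuous_on_M) (rule C1_chart_continuous[OF _ eta_C1])

lemma exp_eta_measurable: "(\<lambda>p. exp (- \<eta> p)) \<in> borel_measurable vol"
  by (rule measurable_M) (intro continuous_on_exp continuous_on_minus continuous_eta)

text \<open>The volume is characterised by its values on sets; as an equality of measures the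
  characterisation becomes usable under integrals.\<close>

lemma restrict_vol_eq_distr:
  assumes c: "c \<in> A"
  shows "restrict_space vol (fst c)
    = distr (restrict_space (chart_measure c) (chart_image c)) (restrict_space borel (fst c)) (chart_inv c)"
proof (rule measure_eqI)
  let ?S = "chart_image c"
  have d: "fst c \<in> sets borel" "fst c \<subseteq> M" using domain_sets domain_subset c by auto
  have sv: "sets (restrict_space vol (fst c)) = sets (restrict_space borel (fst c))"
    using d by (auto simp: sets_restrict_space_iff sets_restrict_space sets_M)
  then show "sets (restrict_space vol (fst c)) =
    sets (distr (restrict_space (chart_measure c) ?S) (restrict_space borel (fst c)) (chart_inv c))" by simp
  fix E assume E: "E \<in> sets (restrict_space vol (fst c))"
  then have Eb: "E \<in> sets borel" "E \<subseteq> fst c"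
    using d unfolding sv by (auto simp: sets_restrict_space_iff)
  have meas: "chart_inv c \<in> measurable (restrict_space (chart_measure c) ?S) (restrict_space borel (fst c))"
  proof (rule measurable_restrict_space2)
    show "chart_inv c \<in> space (restrict_space (chart_measure c) ?S) \<rightarrow> fst c"
      using chart_inv_in[OF c] by (simp add: space_restrict_space)
    have "sets (restrict_space (chart_measure c) ?S) = sets (restrict_space borel ?S)"
      by (rule sets_restrict_space_cong) simp
    then show "chart_inv c \<in> measurable (restrict_space (chart_measure c) ?S) borel"
      using measurable_chart_inv[OF c] measurable_cong_sets by blast
  qed
  have "emeasure (distr (restrict_space (chart_measure c) ?S) (restrict_space borel (fst c)) (chart_inv c)) E
     = emeasure (restrict_space (chart_measure c) ?S) (chart_inv c -` E \<inter> space (restrict_space (chart_measure c) ?S))"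
    by (rule emeasure_distr[OF meas]) (use E sv in simp)
  also have "chart_inv c -` E \<inter> space (restrict_space (chart_measure c) ?S) = snd c ` E"
    using chart_image_of_set[OF c Eb(2)] by (simp add: space_restrict_space chart_measure_def)
  also have "emeasure (restrict_space (chart_measure c) ?S) (snd c ` E) = emeasure (chart_measure c) (snd c ` E)"
    by (rule emeasure_restrict_space) (use chart_image_sets[OF c] Eb(2) in \<open>auto simp: chart_image_def\<close>)
  finally have "emeasure (distr (restrict_space (chart_measure c) ?S) (restrict_space borel (fst c)) (chart_inv c)) E
     = emeasure vol E" using emeasure_vol[OF c Eb] by simp
  moreover have "emeasure (restrict_space vol (fst c)) E = emeasure vol E"
    by (rule emeasure_restrict_space) (use d Eb in \<open>auto simp: sets_M Int_absorb2\<close>)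
  ultimately show "emeasure (restrict_space vol (fst c)) E =
    emeasure (distr (restrict_space (chart_measure c) ?S) (restrict_space borel (fst c)) (chart_inv c)) E" by simp
qed

text \<open>The factor exp (-\<eta>) of the weighted measure and the chart density sqrt (det g) of
  the volume merge into \<open>chart_weight\<close>. Because \<open>f\<close> vanishes outside the
  domain of \<open>c\<close>, one chart suffices.\<close>

lemma integral_chart:
  fixes f :: "'a \<Rightarrow> real"
  assumes c: "c \<in> A" and f: "f \<in> borel_measurable (restrict_space borel M)" and z: "\<And>p. p \<in> M - fst c \<Longrightarrow> f p = 0"
  shows "(\<integral>p. f p \<partial>m)
    = (\<integral>x. indicator (chart_image c) x * (f (chart_inv c x) * chart_weight g \<eta> c (chart_inv c x)) \<partial>lborel)"
proof -
  let ?S = "chart_image c"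
  let ?h = "\<lambda>p. exp (- \<eta> p) * f p"
  have d: "fst c \<in> sets borel" "fst c \<subseteq> M" using domain_sets domain_subset c by auto
  have fv: "f \<in> borel_measurable vol" using f measurable_cong_sets[OF sets_vol refl] by blast
  have hv: "?h \<in> borel_measurable vol" using fv exp_eta_measurable by measurable
  have "(\<integral>p. f p \<partial>m) = (\<integral>p. ?h p \<partial>vol)"
    unfolding weighted_measure_def using integral_density[OF fv exp_eta_measurable] by simp
  also have "\<dots> = (\<integral>p. indicator (fst c) p *\<^sub>R ?h p \<partial>vol)"
    by (rule Bochner_Integration.integral_cong) (use z in \<open>auto simp: indicator_def\<close>)
  also have "\<dots> = (\<integral>p. ?h p \<partial>restrict_space vol (fst c))"
    by (rule integral_restrict_space[symmetric]) (use d in \<open>auto simp: sets_M Int_absorb2\<close>)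
  also have "\<dots> = (\<integral>x. ?h (chart_inv c x) \<partial>restrict_space (chart_measure c) ?S)"
    unfolding restrict_vol_eq_distr[OF c]
  proof (rule integral_distr)
    show "chart_inv c \<in> measurable (restrict_space (chart_measure c) ?S) (restrict_space borel (fst c))"
    proof (rule measurable_restrict_space2)
      show "chart_inv c \<in> space (restrict_space (chart_measure c) ?S) \<rightarrow> fst c"
        using chart_inv_in[OF c] by (simp add: space_restrict_space)
      have "sets (restrict_space (chart_measure c) ?S) = sets (restrict_space borel ?S)"
        by (rule sets_restrict_space_cong) simp
      then show "chart_inv c \<in> measurable (restrict_space (chart_measure c) ?S) borel"
        using measurable_chart_inv[OF c] measurable_cong_sets by blast
    qed
    have "?h \<in> borel_measurable (restrict_space vol (fst c))" using hv by (rule measurable_restrict_space1)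
    moreover have "sets (restrict_space vol (fst c)) = sets (restrict_space borel (fst c))"
      using d by (auto simp: sets_restrict_space_iff sets_restrict_space sets_M)
    ultimately show "?h \<in> borel_measurable (restrict_space borel (fst c))"
      using measurable_cong_sets by blast
  qed
  also have "\<dots> = (\<integral>x. indicator ?S x *\<^sub>R ?h (chart_inv c x) \<partial>chart_measure c)"
    by (rule integral_restrict_space) (use chart_image_sets[OF c] in simp)
  also have "\<dots> = (\<integral>x. (indicator ?S x * sqrt (det (g c (chart_inv c x)))) *\<^sub>R (indicator ?S x *\<^sub>R ?h (chart_inv c x)) \<partial>lborel)"
    unfolding chart_measure_def chart_density_eq
  proof (rule integral_density)
    have "?h \<in> borel_measurable (restrict_space borel M)" using hv measurable_cong_sets[OF sets_vol refl] by blast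
    moreover have "chart_inv c \<in> measurable (restrict_space borel ?S) (restrict_space borel M)"
      by (rule measurable_restrict_space2[OF _ measurable_chart_inv[OF c]])
        (use chart_inv_in[OF c] d in \<open>auto simp: space_restrict_space\<close>)
    ultimately have "(\<lambda>x. ?h (chart_inv c x)) \<in> borel_measurable (restrict_space borel ?S)"
      by (rule measurable_compose[rotated])
    then show "(\<lambda>x. indicator ?S x *\<^sub>R ?h (chart_inv c x)) \<in> borel_measurable lborel"
      using chart_image_sets[OF c] by (simp add: borel_measurable_restrict_space_iff)
    show "(\<lambda>x. indicator ?S x * sqrt (det (g c (chart_inv c x)))) \<in> borel_measurable lborel"
      using chart_density_measurable'[OF c] by simp
    show "AE x in lborel. 0 \<le> indicator ?S x * sqrt (det (g c (chart_inv c x)))"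
      using det_metric_pos[OF c chart_inv_in[OF c]] by (intro AE_I2) (auto simp: indicator_def less_imp_le)
  qed
  also have "\<dots> = (\<integral>x. indicator ?S x * (f (chart_inv c x) * chart_weight g \<eta> c (chart_inv c x)) \<partial>lborel)"
    by (rule Bochner_Integration.integral_cong) (auto simp: indicator_def chart_weight_def)
  finally show ?thesis .
qed

lemma emeasure_vol_compact:
  assumes c: "c \<in> A" and K: "compact K" "K \<subseteq> fst c"
  shows "emeasure vol K < \<infinity>"
proof -
  let ?K = "snd c ` K"
  have cK: "compact ?K"
    using K continuous_chart[OF c] by (intro compact_continuous_image) (auto intro: continuous_on_subset)
  have sub: "?K \<subseteq> chart_image c" using K by (auto simp: chart_image_def)
  have "continuous_on ?K (\<lambda>x. sqrt (det (g c (chart_inv c x))))"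
    using sqrt_det_metric_C1[OF c] C1_continuous continuous_on_subset[OF _ sub] unfolding C1_chart_def by blast
  then have "bounded ((\<lambda>x. sqrt (det (g c (chart_inv c x)))) ` ?K)"
    using cK compact_continuous_image compact_imp_bounded by blast
  then obtain B where B: "\<And>x. x \<in> ?K \<Longrightarrow> norm (sqrt (det (g c (chart_inv c x)))) \<le> B"
    unfolding bounded_iff by blast
  have "emeasure vol K = (\<integral>\<^sup>+x\<in>?K. ennreal (sqrt (det (g c (chart_inv c x)))) \<partial>lborel)"
    using emeasure_vol[OF c _ K(2)] emeasure_chart_measure[OF c _ sub] cK K(1)
    by (simp add: compact_imp_closed)
  also have "\<dots> \<le> (\<integral>\<^sup>+x. ennreal B * indicator ?K x \<partial>lborel)"
  proof (rule nn_integral_mono)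
    fix x
    show "ennreal (sqrt (det (g c (chart_inv c x)))) * indicator ?K x \<le> ennreal B * indicator ?K x"
      using B[of x] by (auto simp: indicator_def intro!: ennreal_leI)
  qed
  also have "\<dots> = ennreal B * emeasure lborel ?K"
    by (rule nn_integral_cmult_indicator) (use cK in \<open>simp add: compact_imp_closed\<close>)
  also have "\<dots> < \<infinity>"
    using emeasure_bounded_finite[OF compact_imp_bounded[OF cK]] by (simp add: ennreal_mult_less_top)
  finally show ?thesis .
qed

text \<open>Finitely many compact pieces, each of finite volume, and a bounded density. Constants
  can then serve as dominating functions.\<close>

lemma finite_measure_m: "finite_measure m"
proof
  obtain P :: "'a set" and K :: "'a \<Rightarrow> 'a set"
    where P: "finite P" "P \<subseteq> M" "\<forall>p\<in>P. compact (K p) \<and> K p \<subseteq> fst (chart_at A p)" "M = (\<Union>p\<in>P. K p)"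
    by (rule finite_compact_cover)
  have Kv: "K p \<in> sets vol" if "p \<in> P" for p
  proof -
    have "K p \<subseteq> M" using P(4) that by blast
    moreover have "closed (K p)" using P(3) that compact_imp_closed by blast
    ultimately show ?thesis by (simp add: sets_M)
  qed
  have "emeasure vol M = emeasure vol (\<Union>p\<in>P. K p)" by (rule arg_cong[OF P(4)])
  also have "\<dots> \<le> (\<Sum>p\<in>P. emeasure vol (K p))"
    by (rule emeasure_subadditive_finite[OF P(1)]) (use Kv in blast)
  also have "\<dots> < \<infinity>"
  proof -
    have "emeasure vol (K p) < top" if "p \<in> P" for p
    proof -
      have "p \<in> M" using P(2) that by blast
      then show ?thesis using emeasure_vol_compact[OF chart_at(1), of p "K p"] P(3) that by simp
    qed
    then show ?thesis using P(1) by simp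
  qed
  finally have fin: "emeasure vol M < \<infinity>" .
  have "bounded ((\<lambda>p. exp (- \<eta> p)) ` M)"
    by (intro compact_imp_bounded compact_continuous_image compact_M continuous_on_exp continuous_on_minus continuous_eta)
  then obtain B where B: "\<And>p. p \<in> M \<Longrightarrow> norm (exp (- \<eta> p)) \<le> B" unfolding bounded_iff by blast
  have "emeasure m M = (\<integral>\<^sup>+p. ennreal (exp (- \<eta> p)) * indicator M p \<partial>vol)"
    unfolding weighted_measure_def
    by (rule emeasure_density) (use exp_eta_measurable closed_M in \<open>auto simp: sets_M\<close>)
  also have "\<dots> \<le> (\<integral>\<^sup>+p. ennreal B * indicator M p \<partial>vol)"
  proof (rule nn_integral_mono)
    fix p
    show "ennreal (exp (- \<eta> p)) * indicator M p \<le> ennreal B * indicator M p"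
      using B[of p] by (auto simp: indicator_def intro!: ennreal_leI)
  qed
  also have "\<dots> = ennreal B * emeasure vol M"
    by (rule nn_integral_cmult_indicator) (use closed_M in \<open>auto simp: sets_M\<close>)
  also have "\<dots> < \<infinity>" using fin by (simp add: ennreal_mult_less_top)
  finally show "emeasure m (space m) \<noteq> \<infinity>" by simp
qed

lemma integrable_bounded_M:
  fixes f :: "'a \<Rightarrow> real"
  assumes "f \<in> borel_measurable m" "\<And>p. p \<in> M \<Longrightarrow> \<bar>f p\<bar> \<le> B"
  shows "integrable m f"
  by (rule finite_measure.integrable_const_bound[OF finite_measure_m, of f B])
    (use assms in \<open>auto intro!: AE_I2\<close>)

lemma integrable_continuous_M:
  fixes f :: "'a \<Rightarrow> real"
  assumes "continuous_on M f"
  shows "integrable m f"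
proof -
  have "bounded (f ` M)" using assms compact_M compact_continuous_image compact_imp_bounded by blast
  then obtain B where "\<And>p. p \<in> M \<Longrightarrow> norm (f p) \<le> B" unfolding bounded_iff by blast
  then show ?thesis by (intro integrable_bounded_M[OF measurable_M(2)[OF assms], of B]) simp
qed

end

section \<open>Green's identity\<close>

context compact_manifold
begin

lemma continuous_extend_zero:
  assumes c: "c \<in> A" and h: "continuous_on (fst c) h" and K: "compact K" "K \<subseteq> fst c"
    and z: "\<And>q. q \<in> fst c - K \<Longrightarrow> h q = (0::real)"
  shows "continuous_on M (\<lambda>p. if p \<in> fst c then h p else 0)"
proof (rule continuous_on_openin_local)
  fix p assume p: "p \<in> M"
  show "\<exists>T. openin (top_of_set M) T \<and> p \<in> T \<and> continuous_on T (\<lambda>p. if p \<in> fst c then h p else 0)"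
  proof (cases "p \<in> fst c")
    case True
    have "continuous_on (fst c) (\<lambda>p. if p \<in> fst c then h p else 0) = continuous_on (fst c) h"
      by (rule continuous_on_cong) simp_all
    then show ?thesis using h True domain_openin[OF c] by blast
  next
    case False
    have "openin (top_of_set M) (M \<inter> - K)"
      using compact_imp_closed[OF K(1)] by (intro openin_open_Int) auto
    moreover have "continuous_on (M \<inter> - K) (\<lambda>p. if p \<in> fst c then h p else 0) = continuous_on (M \<inter> - K) (\<lambda>p. 0 :: real)"
      by (rule continuous_on_cong) (use z in auto)
    ultimately show ?thesis using False p K(2) by (intro exI[of _ "M \<inter> - K"]) auto
  qed
qed

lemma pd_zero_off_support:
  assumes c: "c \<in> A" and w: "C1_chart c w" and K: "compact K" and z: "\<And>q. q \<in> fst c - K \<Longrightarrow> w q = 0"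
    and q: "q \<in> fst c - K"
  shows "pd c i w q = 0"
proof -
  let ?T = "snd c ` (fst c - K)"
  have "openin (top_of_set (fst c)) (fst c \<inter> - K)"
    using compact_imp_closed[OF K] by (intro openin_open_Int) auto
  then have o: "openin (top_of_set (chart_image c)) ?T"
    using chart_image_openin[OF c] by (simp add: Diff_eq)
  have x: "snd c q \<in> ?T" using q by blast
  have hs: "hs_open ?T" using hs_open_openin[OF hs_open_chart_image[OF c] o] .
  have "pd c i w q = partial ?T i (\<lambda>x. w (chart_inv c x)) (snd c q)"
    using partial_openin[OF o x] by (simp add: pd_eq_partial)
  also have "\<dots> = partial ?T i (\<lambda>x. 0) (snd c q)"
  proof (rule partial_cong[OF _ x])
    fix y assume "y \<in> ?T"
    then obtain p where "p \<in> fst c - K" "y = snd c p" by blast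
    then show "w (chart_inv c y) = 0" using z[of p] chart_inv_chart[OF c, of p] by simp
  qed
  also have "\<dots> = 0" using hs x by simp
  finally show ?thesis .
qed

lemma not_interior_imp_boundary:
  assumes "c \<in> A" "p \<in> fst c" "snd c p \<notin> interior (chart_image c)"
  shows "p \<in> manifold_boundary A"
  using assms unfolding manifold_boundary_def by blast

end

context weighted_compact_manifold
begin

text \<open>Read off from the divergence form: the divergence of a C1 flux, divided by the positive
  weight, is continuous. No regularity of Christoffel symbols has to be discussed.\<close>

lemma continuous_chart_drift:
  assumes c: "c \<in> A" and f: "C1_chart c f" "\<And>j. C1_chart c (pd c j f)"
  shows "continuous_on (fst c) (chart_drift g \<eta> c f)"
proof -
  have "continuous_on (fst c) (\<lambda>p. (\<Sum>i\<in>UNIV. pd c i (flux c i f) p) / chart_weight g \<eta> c p)"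
  proof (rule continuous_on_divide)
    show "continuous_on (fst c) (\<lambda>p. \<Sum>i\<in>UNIV. pd c i (flux c i f) p)"
      by (intro continuous_on_sum C1_chart_continuous_pd flux_C1 c f)
    show "continuous_on (fst c) (chart_weight g \<eta> c)"
      by (rule C1_chart_continuous[OF c chart_weight_C1[OF c]])
    show "\<forall>p\<in>fst c. chart_weight g \<eta> c p \<noteq> 0" using chart_weight_pos[OF c] by force
  qed
  moreover have "(\<Sum>i\<in>UNIV. pd c i (flux c i f) p) / chart_weight g \<eta> c p = chart_drift g \<eta> c f p" if "p \<in> fst c" for p
    using divergence_flux[OF c that f(2)] chart_weight_pos[OF c that] by simp
  ultimately show ?thesis by (simp cong: continuous_on_cong)
qed

text \<open>The integrand of Green's identity. In the chart, its product with the weight is the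
  divergence of \<open>w\<close> times the flux of \<open>f\<close>.\<close>

definition green_density :: "('a, 'n) chart \<Rightarrow> ('a \<Rightarrow> real) \<Rightarrow> ('a \<Rightarrow> real) \<Rightarrow> 'a \<Rightarrow> real" where
  "green_density c w f p = (if p \<in> fst c then w p * chart_drift g \<eta> c f p + chart_ip g c w f p else 0)"

lemma chart_ip_zero_off_support:
  assumes c: "c \<in> A" and w: "C1_chart c w" and K: "compact K" and z: "\<And>q. q \<in> fst c - K \<Longrightarrow> w q = 0"
    and q: "q \<in> fst c - K"
  shows "chart_ip g c w f q = 0"
  using pd_zero_off_support[OF c w K z q] by (simp add: chart_ip_def chart_diff_def zero_vec_def[symmetric])

lemma green_density_continuous:
  assumes c: "c \<in> A" and f: "C1_chart c f" "\<And>j. C1_chart c (pd c j f)"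
    and w: "C1_chart c w" and K: "compact K" "K \<subseteq> fst c" and z: "\<And>q. q \<in> fst c - K \<Longrightarrow> w q = 0"
  shows "continuous_on M (green_density c w f)"
  unfolding green_density_def[abs_def]
proof (rule continuous_extend_zero[OF c _ K])
  show "continuous_on (fst c) (\<lambda>p. w p * chart_drift g \<eta> c f p + chart_ip g c w f p)"
    by (intro continuous_on_add continuous_on_mult C1_chart_continuous[OF c w] continuous_chart_drift
        continuous_chart_ip c f w)
  show "w q * chart_drift g \<eta> c f q + chart_ip g c w f q = 0" if "q \<in> fst c - K" for q
    using z[OF that] chart_ip_zero_off_support[OF c w K(1) z that] by simp
qed

text \<open>Green's identity inside one chart: in coordinates the integral is a sum of integrals of
  partial derivatives of compactly supported functions vanishing on the hyperplane. The Laplacian is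
  still the one computed in this chart.\<close>

lemma integral_green_density:
  assumes c: "c \<in> A" and f: "C1_chart c f" "\<And>j. C1_chart c (pd c j f)"
    and w: "C1_chart c w" and K: "compact K" "K \<subseteq> fst c" and z: "\<And>q. q \<in> fst c - K \<Longrightarrow> w q = 0"
    and bd: "\<And>q. q \<in> fst c \<Longrightarrow> snd c q \<notin> interior (chart_image c) \<Longrightarrow> w q = 0"
  shows "(\<integral>p. green_density c w f p \<partial>m) = 0"
proof -
  let ?S = "chart_image c"
  obtain b where b: "openin (top_of_set {x. 0 \<le> b \<bullet> x}) ?S" using chart_halfspace[OF c] by blast
  let ?F = "\<lambda>i x. w (chart_inv c x) * flux c i f (chart_inv c x)"
  have FC: "C1_chart c (\<lambda>q. w q * flux c i f q)" for i by (intro C1_chart_mult flux_C1 c f w)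
  have "compact (snd c ` K)"
    using K continuous_chart[OF c] by (intro compact_continuous_image) (auto intro: continuous_on_subset)
  note dv = integral_partial_eq_0[OF b _ this, of "?F i" i for i]
  have sub: "snd c ` K \<subseteq> ?S" using K by (auto simp: chart_image_def)
  have off: "?F i x = 0" if "x \<in> ?S - snd c ` K" for i x
  proof -
    have "chart_inv c x \<notin> K" using that chart_chart_inv[OF c, of x] by force
    then show ?thesis using z chart_inv_in[OF c, of x] that by simp
  qed
  have bd': "?F i x = 0" if "x \<in> ?S" "x \<notin> interior ?S" for i x
    using bd[OF chart_inv_in[OF c that(1)]] that chart_chart_inv[OF c that(1)] by simp
  have i0: "integrable lborel (\<lambda>x. indicator ?S x * partial ?S i (?F i) x)"
    "(\<integral>x. indicator ?S x * partial ?S i (?F i) x \<partial>lborel) = 0" for i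
    using dv[of i] FC[of i] sub off bd' by (simp_all add: C1_chart_def)
  have pw: "(\<Sum>i\<in>UNIV. indicator ?S x * partial ?S i (?F i) x)
      = indicator ?S x * (green_density c w f (chart_inv c x) * chart_weight g \<eta> c (chart_inv c x))" for x
  proof (cases "x \<in> ?S")
    case True
    define p where "p = chart_inv c x"
    have p: "p \<in> fst c" "snd c p = x" using True chart_inv_in[OF c] chart_chart_inv[OF c] by (simp_all add: p_def)
    have "partial ?S i (?F i) x = w p * pd c i (flux c i f) p + flux c i f p * pd c i w p" for i
      using pd_mult[OF c w flux_C1[OF c f(2)] p(1), of i i] by (simp add: pd_eq_partial p)
    then have "(\<Sum>i\<in>UNIV. partial ?S i (?F i) x) = w p * (chart_weight g \<eta> c p * chart_drift g \<eta> c f p)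
        + (\<Sum>i\<in>UNIV. flux c i f p * pd c i w p)"
      by (simp add: sum.distrib sum_distrib_left[symmetric] divergence_flux[OF c p(1) f(2)])
    also have "(\<Sum>i\<in>UNIV. flux c i f p * pd c i w p) = chart_weight g \<eta> c p * chart_ip g c w f p"
      by (simp add: flux_def chart_ip_def inner_matrix_mult_sum chart_diff_def sum_distrib_left sum_distrib_right mult_ac)
    finally show ?thesis
      using True p(1) by (simp add: green_density_def p_def[symmetric] algebra_simps)
  qed simp
  have "(\<integral>p. green_density c w f p \<partial>m)
     = (\<integral>x. indicator ?S x * (green_density c w f (chart_inv c x) * chart_weight g \<eta> c (chart_inv c x)) \<partial>lborel)"
    by (rule integral_chart[OF c measurable_M(3)[OF green_density_continuous[OF c f w K z]]])
      (simp_all add: green_density_def)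
  also have "\<dots> = (\<integral>x. (\<Sum>i\<in>UNIV. indicator ?S x * partial ?S i (?F i) x) \<partial>lborel)"
    unfolding pw ..
  also have "\<dots> = (\<Sum>i\<in>UNIV. \<integral>x. indicator ?S x * partial ?S i (?F i) x \<partial>lborel)"
    by (rule Bochner_Integration.integral_sum) (rule i0)
  finally show ?thesis using i0 by simp
qed

text \<open>From a boundary point a small step in the direction \<open>b\<close> leads into the
  interior of the image.\<close>

lemma interior_point_dense:
  assumes c: "c \<in> A" and U: "openin (top_of_set (fst c)) U" "U \<noteq> {}"
  shows "\<exists>q\<in>U. snd c q \<in> interior (chart_image c)"
proof -
  obtain p where p: "p \<in> U" using U by blast
  obtain b where b: "openin (top_of_set {x. 0 \<le> b \<bullet> x}) (chart_image c)" using chart_halfspace[OF c] by blast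
  have "openin (top_of_set {x. 0 \<le> b \<bullet> x}) (snd c ` U)"
    using openin_trans[OF chart_image_openin[OF c U(1)] b] .
  then obtain T where T: "open T" "snd c ` U = {x. 0 \<le> b \<bullet> x} \<inter> T" by (auto simp: openin_open)
  have "snd c p \<in> T" "0 \<le> b \<bullet> snd c p" using p T(2) by blast+
  obtain e where e: "e > 0" "ball (snd c p) e \<subseteq> T" using T(1) \<open>snd c p \<in> T\<close> by (meson openE)
  have UI: "snd c ` U \<subseteq> chart_image c" using U(1) openin_imp_subset by (fastforce simp: chart_image_def)
  have "\<exists>y \<in> T. b = 0 \<or> 0 < b \<bullet> y"
  proof (cases "b = 0")
    case False
    \<comment> \<open>The step has length e / 2, so \<open>y\<close> stays in the ball.\<close>
    define y where "y = snd c p + (e / (2 * norm b)) *\<^sub>R b"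
    have "y \<in> ball (snd c p) e" using e False by (simp add: y_def dist_norm)
    moreover have "0 < b \<bullet> y" using \<open>0 \<le> b \<bullet> snd c p\<close> e False by (simp add: y_def inner_add_right add_nonneg_pos)
    ultimately show ?thesis using e by blast
  qed (use \<open>snd c p \<in> T\<close> in blast)
  then obtain y where y: "y \<in> T" "b = 0 \<or> 0 < b \<bullet> y" by blast
  have "y \<in> interior (chart_image c)"
  proof (cases "b = 0")
    case True
    then have "T \<subseteq> chart_image c" using T(2) UI by simp
    then show ?thesis using interior_maximal[OF _ T(1)] y by blast
  next
    case False
    have "T \<inter> {x. 0 < b \<bullet> x} \<subseteq> chart_image c" using T(2) UI by auto
    moreover have "open (T \<inter> {x. 0 < b \<bullet> x})" by (intro open_Int T open_halfspace_gt)
    ultimately have "T \<inter> {x. 0 < b \<bullet> x} \<subseteq> interior (chart_image c)" by (rule interior_maximal)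
    then show ?thesis using y False by blast
  qed
  moreover have "y \<in> snd c ` U" using y T(2) by (auto simp: inner_zero_left)
  ultimately show ?thesis by blast
qed

end

context weighted_compact_manifold
begin

lemma smooth_fun_C1:
  assumes "smooth_fun A f" "c \<in> A"
  shows "C1_chart c f" "C1_chart c (pd c j f)"
  using assms smooth_in_chart_C1 C1_chart_pd by (simp_all add: smooth_fun_def)

text \<open>Invariance of domain: the transition map is continuous and injective on an open subset
  of Euclidean space, so its image is open. Thus a point interior for one chart is interior for the
  other, and a bump can avoid the boundary in both.\<close>

lemma chart_image_interior_invariant:
  assumes c: "c \<in> A" "c' \<in> A" and U: "openin (top_of_set M) U" "U \<subseteq> fst c \<inter> fst c'"
    and i: "\<And>q. q \<in> U \<Longrightarrow> snd c q \<in> interior (chart_image c)" and q: "q \<in> U"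
  shows "open (snd c ` U)" "snd c' q \<in> interior (chart_image c')"
proof -
  have UM: "openin (top_of_set (fst c)) U"
    using openin_subset_trans[OF U(1) _ domain_subset[OF c(1)]] U(2) by blast
  have o: "openin (top_of_set (chart_image c)) (snd c ` U)" by (rule chart_image_openin[OF c(1) UM])
  then obtain T where T: "open T" "snd c ` U = chart_image c \<inter> T" by (auto simp: openin_open)
  have "snd c ` U = interior (chart_image c) \<inter> T"
    using T(2) i interior_subset by blast
  then show op: "open (snd c ` U)" using T(1) by (simp add: open_Int)
  let ?\<tau> = "\<lambda>x. snd c' (chart_inv c x)"
  have ci: "chart_inv c (snd c r) = r" if "r \<in> U" for r using chart_inv_chart[OF c(1), of r] that U(2) by blast
  have "continuous_on (snd c ` U) ?\<tau>"
  proof (rule continuous_on_compose2[OF continuous_chart[OF c(2)]])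
    show "continuous_on (snd c ` U) (chart_inv c)"
      by (rule continuous_on_subset[OF continuous_chart_inv[OF c(1)] openin_imp_subset[OF o]])
    show "chart_inv c ` snd c ` U \<subseteq> fst c'" using ci U(2) by auto
  qed
  moreover have "inj_on ?\<tau> (snd c ` U)"
  proof (rule inj_onI)
    fix x y assume xy: "x \<in> snd c ` U" "y \<in> snd c ` U" and e: "?\<tau> x = ?\<tau> y"
    then obtain p r where pr: "p \<in> U" "r \<in> U" "x = snd c p" "y = snd c r" by blast
    then have "snd c' p = snd c' r" using e ci by simp
    then have "p = r" using pr U(2) chart_inv_chart[OF c(2)] by (metis IntD2 subsetD)
    then show "x = y" using pr by simp
  qed
  ultimately have "open (?\<tau> ` snd c ` U)" by (rule invariance_of_domain[OF _ op])
  moreover have "?\<tau> ` snd c ` U = snd c' ` U" using ci by (force simp: image_iff)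
  moreover have "snd c' ` U \<subseteq> chart_image c'" using U(2) by (auto simp: chart_image_def)
  ultimately have "snd c' ` U \<subseteq> interior (chart_image c')" using interior_maximal by metis
  then show "snd c' q \<in> interior (chart_image c')" using q by blast
qed

text \<open>A nonnegative function with zero integral vanishes almost everywhere, and a nonempty
  open set of coordinates is not negligible.\<close>

lemma integral_eq_0_chart:
  fixes e :: "'a \<Rightarrow> real"
  assumes c: "c \<in> A" and e: "continuous_on M e" "\<And>q. q \<in> M \<Longrightarrow> 0 \<le> e q"
    and K: "compact K" "K \<subseteq> fst c" and z: "\<And>q. q \<in> M - K \<Longrightarrow> e q = 0"
    and int: "(\<integral>p. e p \<partial>m) = 0" and U: "open (snd c ` U)" "U \<subseteq> fst c" "q \<in> U"
  shows "\<exists>q\<in>U. e q = 0"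
proof (rule ccontr)
  assume neg: "\<not> (\<exists>q\<in>U. e q = 0)"
  let ?S = "chart_image c"
  let ?E = "\<lambda>x. indicator ?S x * (e (chart_inv c x) * chart_weight g \<eta> c (chart_inv c x))"
  have sub: "chart_inv c ` ?S \<subseteq> M" using chart_inv_in[OF c] domain_subset[OF c] by blast
  have cE: "continuous_on ?S (\<lambda>x. e (chart_inv c x) * chart_weight g \<eta> c (chart_inv c x))"
  proof (intro continuous_on_mult)
    show "continuous_on ?S (\<lambda>x. e (chart_inv c x))"
      by (rule continuous_on_compose2[OF e(1) continuous_chart_inv[OF c] sub])
    show "continuous_on ?S (\<lambda>x. chart_weight g \<eta> c (chart_inv c x))"
      using chart_weight_C1[OF c] C1_continuous unfolding C1_chart_def by blast
  qed
  have Em: "?E \<in> borel_measurable borel"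
    using borel_measurable_continuous_on_indicator[OF chart_image_sets[OF c] cE] by simp
  have E0: "0 \<le> ?E x" for x
  proof (cases "x \<in> ?S")
    case True
    then show ?thesis using e(2) sub chart_weight_pos[OF c chart_inv_in[OF c True]] by (auto simp: less_imp_le)
  qed simp
  let ?K = "snd c ` K"
  have cK: "compact ?K"
    using K continuous_chart[OF c] by (intro compact_continuous_image) (auto intro: continuous_on_subset)
  have KS: "?K \<subseteq> ?S" using K by (auto simp: chart_image_def)
  obtain B where B: "\<And>x. x \<in> ?K \<Longrightarrow> norm (e (chart_inv c x) * chart_weight g \<eta> c (chart_inv c x)) \<le> B"
    using compact_imp_bounded[OF compact_continuous_image[OF continuous_on_subset[OF cE KS] cK]]
    unfolding bounded_iff by blast
  obtain R where R: "?K \<subseteq> cball 0 R" using bounded_subset_ballD[OF compact_imp_bounded[OF cK], of 0] ball_subset_cball by blast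
  have "integrable lborel ?E"
  proof (rule integrable_indicator_compact_bound[OF Em, of "max B 0" R])
    fix x
    show "\<bar>?E x\<bar> \<le> max B 0 * indicator (cball 0 R) x"
    proof (cases "x \<in> ?K")
      case True
      then have "x \<in> cball 0 R" "x \<in> ?S" using R KS by blast+
      then show ?thesis using B[OF True] by simp
    next
      case False
      have E: "?E x = 0"
      proof (cases "x \<in> ?S")
        case True
        have "chart_inv c x \<notin> K" using False chart_chart_inv[OF c True] by force
        then have "e (chart_inv c x) = 0" using z sub True by blast
        then show ?thesis by simp
      qed simp
      show ?thesis unfolding E by (simp add: indicator_def)
    qed
  qed
  moreover have "(\<integral>x. ?E x \<partial>lborel) = 0"
    using int integral_chart[OF c measurable_M(3)[OF e(1)]] z K(2) by fastforce
  ultimately have "AE x in lborel. ?E x = 0"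
    using integral_nonneg_eq_0_iff_AE[of lborel ?E] E0 by simp
  moreover have "?E x \<noteq> 0" if x: "x \<in> snd c ` U" for x
  proof -
    obtain r where r: "r \<in> U" "x = snd c r" using x by blast
    have rc: "r \<in> fst c" using r U(2) by blast
    then have "x \<in> ?S" "chart_inv c x = r" using r chart_in_image chart_inv_chart[OF c] by simp_all
    then show ?thesis using neg r chart_weight_pos[OF c rc] by auto
  qed
  ultimately have "AE x in lborel. x \<notin> snd c ` U" by (auto elim: eventually_mono)
  then have "snd c ` U \<in> null_sets lborel"
    using U(1) by (subst AE_iff_null_sets) auto
  then have "negligible (snd c ` U)"
    unfolding negligible_iff_null_sets by (rule null_sets_completionI)
  moreover have "snd c ` U \<noteq> {}" using U(3) by blast
  ultimately show False using open_not_negligible[OF U(1)] by blast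
qed

text \<open>Invariance is derived in weak form: both chart expressions have the same pairing with every bump
  function, since \<open>\<integral> w L f dm = - \<integral> \<langle>\<nabla>w, \<nabla>f\<rangle> dm\<close> and the right-hand side is invariant. This avoids the
  transformation law of the Christoffel symbols.\<close>

lemma chart_drift_change:
  assumes c: "c \<in> A" "c' \<in> A" and p: "p \<in> fst c \<inter> fst c'" and f: "smooth_fun A f"
  shows "chart_drift g \<eta> c f p = chart_drift g \<eta> c' f p"
proof (rule ccontr)
  assume neq: "chart_drift g \<eta> c f p \<noteq> chart_drift g \<eta> c' f p"
  define D where "D q = chart_drift g \<eta> c f q - chart_drift g \<eta> c' f q" for q
  let ?O = "fst c \<inter> fst c'"
  note fc = smooth_fun_C1[OF f c(1)] and fc' = smooth_fun_C1[OF f c(2)]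
  have cD: "continuous_on ?O D"
    unfolding D_def[abs_def]
    by (intro continuous_on_diff continuous_on_subset[OF continuous_chart_drift[OF c(1) fc]]
        continuous_on_subset[OF continuous_chart_drift[OF c(2) fc']]) auto
  have oO: "openin (top_of_set M) ?O" using domain_openin c by blast
  \<comment> \<open>The set where \<open>D\<close> has the same sign as at \<open>p\<close>; the
    product avoids a case distinction on that sign.\<close>
  define U0 where "U0 = {q \<in> ?O. 0 < D q * D p}"
  have "openin (top_of_set ?O) (?O \<inter> (\<lambda>q. D q * D p) -` {0<..})"
    by (rule continuous_openin_preimage_gen) (auto intro!: continuous_intros cD)
  then have oU0: "openin (top_of_set ?O) U0" by (simp add: U0_def vimage_def Int_def)
  have oU0': "openin (top_of_set (fst c)) U0" using openin_trans[OF oU0 overlap_openin[OF c]] .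
  have "D p \<noteq> 0" using neq by (simp add: D_def)
  then have "0 < D p * D p" by (metis not_real_square_gt_zero)
  then have "p \<in> U0" using p by (simp add: U0_def)
  \<comment> \<open>As \<open>p\<close> may lie on the boundary, the argument moves to a nearby
    interior point, where a bump can be chosen to vanish on the boundary of both chart
    images.\<close>
  then obtain q0 where q0: "q0 \<in> U0" "snd c q0 \<in> interior (chart_image c)"
    using interior_point_dense[OF c(1) oU0'] by blast
  define U where "U = U0 \<inter> snd c -` interior (chart_image c)"
  have "openin (top_of_set U0) (U0 \<inter> snd c -` interior (chart_image c))"
    using continuous_chart[OF c(1)] oU0' openin_imp_subset
    by (intro continuous_openin_preimage_gen) (blast intro: continuous_on_subset, simp)
  then have oU: "openin (top_of_set M) U"
    unfolding U_def using openin_trans[OF _ openin_domain_imp_M[OF c(1) oU0']] by blast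
  have UO: "U \<subseteq> ?O" by (auto simp: U_def U0_def)
  have Ui: "snd c q \<in> interior (chart_image c)" if "q \<in> U" for q using that by (simp add: U_def)
  have q0U: "q0 \<in> U" "q0 \<in> fst c" using q0 by (simp_all add: U_def U0_def)
  note inv = chart_image_interior_invariant[OF c oU UO Ui]
  show False
  proof (rule bump_function[OF c(1) q0U(2) oU q0U(1)])
    fix w K assume K: "compact K" "K \<subseteq> fst c" "K \<subseteq> U" and w0: "\<And>q. 0 \<le> w q" "w q0 > 0"
      and z: "\<And>q. q \<notin> K \<Longrightarrow> w q = (0::real)" and wC: "\<And>c'. c' \<in> A \<Longrightarrow> C1_chart c' w"
    have K': "K \<subseteq> fst c'" using K(3) UO by blast
    have bd: "w q = 0" if "snd c q \<notin> interior (chart_image c)" for q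
      using z[of q] Ui[of q] K(3) that by blast
    have bd': "w q = 0" if "snd c' q \<notin> interior (chart_image c')" for q
      using z[of q] inv(2)[of q] K(3) that by blast
    have G1: "(\<integral>q. green_density c w f q \<partial>m) = 0"
      by (rule integral_green_density[OF c(1) fc wC[OF c(1)] K(1,2)]) (use z bd in auto)
    have G2: "(\<integral>q. green_density c' w f q \<partial>m) = 0"
      by (rule integral_green_density[OF c(2) fc' wC[OF c(2)] K(1) K']) (use z bd' in auto)
    have C1: "continuous_on M (green_density c w f)"
      by (rule green_density_continuous[OF c(1) fc wC[OF c(1)] K(1,2)]) (use z in auto)
    have C2: "continuous_on M (green_density c' w f)"
      by (rule green_density_continuous[OF c(2) fc' wC[OF c(2)] K(1) K']) (use z in auto)
    \<comment> \<open>The gradient terms agree in both charts and cancel, leaving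
      \<open>w * D\<close>; the factor \<open>D p\<close> makes the difference nonnegative.\<close>
    define e where "e q = (green_density c w f q - green_density c' w f q) * D p" for q
    have eO: "e q = w q * (D q * D p)" if "q \<in> ?O" for q
      using that chart_ip_change[OF c wC[OF c(2)] fc'(1) that]
      by (simp add: e_def green_density_def D_def algebra_simps)
    have ez: "e q = 0" if "q \<notin> K" for q
    proof -
      have "green_density c w f q = 0"
        using z that chart_ip_zero_off_support[OF c(1) wC[OF c(1)] K(1), of q f] by (simp add: green_density_def)
      moreover have "green_density c' w f q = 0"
        using z that chart_ip_zero_off_support[OF c(2) wC[OF c(2)] K(1), of q f] by (simp add: green_density_def)
      ultimately show ?thesis by (simp add: e_def)
    qed
    have e0: "0 \<le> e q" for q
    proof (cases "q \<in> K")
      case True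
      then have "q \<in> ?O" "0 < D q * D p" using K(3) UO by (auto simp: U_def U0_def)
      then show ?thesis using eO w0(1) by simp
    qed (simp add: ez)
    have "continuous_on M e" unfolding e_def[abs_def] by (intro continuous_intros C1 C2)
    moreover have "(\<integral>q. e q \<partial>m) = 0"
      unfolding e_def using G1 G2 integrable_continuous_M[OF C1] integrable_continuous_M[OF C2] by simp
    \<comment> \<open>A neighbourhood of \<open>q0\<close> with open coordinate image on which the
      bump is strictly positive, so that \<open>e\<close> cannot vanish there.\<close>
    moreover obtain V where V: "V \<subseteq> U" "q0 \<in> V" "open (snd c ` V)" "\<And>q. q \<in> V \<Longrightarrow> 0 < w q"
    proof -
      let ?V = "U \<inter> w -` {0<..}"
      have "continuous_on U w"
        using C1_chart_continuous[OF c(1) wC[OF c(1)]] UO continuous_on_subset by blast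
      then have "openin (top_of_set U) ?V" by (rule continuous_openin_preimage_gen) simp
      then have oV: "openin (top_of_set M) ?V" using openin_trans oU by blast
      have "open (snd c ` ?V)"
        by (rule chart_image_interior_invariant(1)[OF c oV _ _, of q0]) (use UO Ui q0U w0 in auto)
      then show thesis using q0U w0 by (intro that[of ?V]) auto
    qed
    ultimately have "\<exists>q\<in>V. e q = 0"
      using integral_eq_0_chart[OF c(1) _ _ K(1,2) _ _ V(3) _ V(2), of e] e0 ez V(1) UO by blast
    then obtain q where q: "q \<in> V" "e q = 0" by blast
    then have "q \<in> ?O" and "0 < D q * D p" using V(1) UO by (auto simp: U_def U0_def)
    have "0 < w q * (D q * D p)" by (rule mult_pos_pos[OF V(4)[OF q(1)] \<open>0 < D q * D p\<close>])
    then show False using eO[OF \<open>q \<in> ?O\<close>] q(2) by simp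
  qed
qed

end

section \<open>Chart-independent scalars and the global Green identity\<close>

definition point_ip :: "('a, 'n::finite) chart set \<Rightarrow> ('a, 'n) tensor2 \<Rightarrow> ('a \<Rightarrow> real) \<Rightarrow> ('a \<Rightarrow> real) \<Rightarrow> 'a \<Rightarrow> real" where
  "point_ip A g f h p = chart_ip g (chart_at A p) f h p"

context riemannian_compact_manifold
begin

lemma point_ip_eq_chart_ip:
  assumes c: "c \<in> A" "p \<in> fst c" and f: "C1_chart c f" "C1_chart c h"
  shows "point_ip A g f h p = chart_ip g c f h p"
  unfolding point_ip_def
  by (rule chart_ip_change[OF chart_at(1) c(1) f]) (use c chart_at domain_subset[OF c(1)] in blast)+

lemma continuous_point_ip:
  assumes "\<And>c. c \<in> A \<Longrightarrow> C1_chart c f" "\<And>c. c \<in> A \<Longrightarrow> C1_chart c h"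
  shows "continuous_on M (point_ip A g f h)"
proof (rule continuous_on_M)
  fix c assume c: "c \<in> A"
  have "continuous_on (fst c) (point_ip A g f h) = continuous_on (fst c) (chart_ip g c f h)"
    by (rule continuous_on_cong) (use point_ip_eq_chart_ip[OF c] assms c in simp_all)
  then show "continuous_on (fst c) (point_ip A g f h)" using continuous_chart_ip[OF c] assms c by blast
qed

lemma point_ip_sym: "p \<in> M \<Longrightarrow> point_ip A g f h p = point_ip A g h f p"
  unfolding point_ip_def by (rule chart_ip_sym[OF chart_at])

lemma point_ip_mult_left:
  assumes p: "p \<in> M" and f: "\<And>c. c \<in> A \<Longrightarrow> C1_chart c f" "\<And>c. c \<in> A \<Longrightarrow> C1_chart c h"
  shows "point_ip A g (\<lambda>q. f q * h q) k p = f p * point_ip A g h k p + h p * point_ip A g f k p"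
proof -
  note c = chart_at[OF p]
  have "chart_diff (chart_at A p) (\<lambda>q. f q * h q) p
      = f p *\<^sub>R chart_diff (chart_at A p) h p + h p *\<^sub>R chart_diff (chart_at A p) f p"
    using pd_mult[OF c(1) f(1)[OF c(1)] f(2)[OF c(1)] c(2)] by (simp add: chart_diff_def vec_eq_iff)
  then show ?thesis by (simp add: point_ip_def chart_ip_def inner_add_left)
qed

lemma point_ip_sum_left:
  assumes p: "p \<in> M" and f: "\<And>k c. k \<in> K \<Longrightarrow> c \<in> A \<Longrightarrow> C1_chart c (f k)"
  shows "point_ip A g (\<lambda>q. \<Sum>k\<in>K. f k q) h p = (\<Sum>k\<in>K. point_ip A g (f k) h p)"
proof -
  note c = chart_at[OF p]
  have "chart_diff (chart_at A p) (\<lambda>q. \<Sum>k\<in>K. f k q) p = (\<Sum>k\<in>K. chart_diff (chart_at A p) (f k) p)"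
    using pd_sum[OF c(1) _ c(2), of K f] f c(1) by (simp add: chart_diff_def vec_eq_iff)
  then show ?thesis by (simp add: point_ip_def chart_ip_def inner_sum_left)
qed

lemma point_ip_cong_left:
  assumes p: "p \<in> M" and "\<And>q. q \<in> M \<Longrightarrow> f q = f' q"
  shows "point_ip A g f h p = point_ip A g f' h p"
proof -
  note c = chart_at[OF p]
  have "chart_diff (chart_at A p) f p = chart_diff (chart_at A p) f' p"
    using pd_cong[OF c(1) _ c(2), of f f'] assms(2) domain_subset[OF c(1)]
    by (auto simp: chart_diff_def vec_eq_iff)
  then show ?thesis by (simp add: point_ip_def chart_ip_def)
qed

end

context weighted_compact_manifold
begin

lemma drift_laplacian_eq_chart_drift:
  assumes c: "c \<in> A" "p \<in> fst c" and f: "smooth_fun A f"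
  shows "drift_laplacian A g \<eta> f p = chart_drift g \<eta> c f p"
proof -
  have p: "p \<in> M" using c domain_subset by blast
  show ?thesis unfolding drift_laplacian_eq[OF p]
    by (rule chart_drift_change[OF chart_at(1)[OF p] c(1) _ f]) (use chart_at(2)[OF p] c(2) in blast)
qed

lemma continuous_drift_laplacian:
  assumes f: "smooth_fun A f"
  shows "continuous_on M (drift_laplacian A g \<eta> f)"
proof (rule continuous_on_M)
  fix c assume c: "c \<in> A"
  have "continuous_on (fst c) (drift_laplacian A g \<eta> f) = continuous_on (fst c) (chart_drift g \<eta> c f)"
    by (rule continuous_on_cong) (use drift_laplacian_eq_chart_drift[OF c _ f] in simp_all)
  then show "continuous_on (fst c) (drift_laplacian A g \<eta> f)"
    using continuous_chart_drift[OF c smooth_fun_C1[OF f c]] by blast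
qed

text \<open>The test function is split by the partition of unity. Each part has compact support in
  one chart and still vanishes on the boundary, so the local identity applies, and the sum recovers
  \<open>w\<close>. Differentiability is asked of \<open>w\<close> only to first order, since
  products of \<open>w\<close> with cut-off functions are no better than C1.\<close>

lemma green_identity:
  assumes f: "smooth_fun A f" and w: "\<And>c. c \<in> A \<Longrightarrow> C1_chart c w"
    and bd: "\<And>p. p \<in> manifold_boundary A \<Longrightarrow> w p = 0"
  shows "(\<integral>p. w p * drift_laplacian A g \<eta> f p \<partial>m) = - (\<integral>p. point_ip A g w f p \<partial>m)"
proof (rule partition_of_unity)
  fix P K and pu :: "'a \<Rightarrow> 'a \<Rightarrow> real"
  assume P: "finite P" "P \<subseteq> M" and K: "\<And>p. p \<in> P \<Longrightarrow> compact (K p)" "\<And>p. p \<in> P \<Longrightarrow> K p \<subseteq> fst (chart_at A p)"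
    and pu: "\<And>p q. p \<in> P \<Longrightarrow> q \<notin> K p \<Longrightarrow> pu p q = 0" "\<And>p c. p \<in> P \<Longrightarrow> c \<in> A \<Longrightarrow> C1_chart c (pu p)"
    and one: "\<And>q. q \<in> M \<Longrightarrow> (\<Sum>p\<in>P. pu p q) = 1"
  define W where "W k q = pu k q * w q" for k q
  have WC: "C1_chart c (W k)" if "k \<in> P" "c \<in> A" for k c
    unfolding W_def[abs_def] by (intro C1_chart_mult w pu that)
  have fC: "C1_chart c f" if "c \<in> A" for c using smooth_fun_C1[OF f that] by blast
  let ?d = "\<lambda>w q. w q * drift_laplacian A g \<eta> f q + point_ip A g w f q"
  have cd: "continuous_on M (\<lambda>q. ?d (W k) q)" if "k \<in> P" for k
  proof (intro continuous_on_add continuous_on_mult continuous_drift_laplacian[OF f] continuous_point_ip fC WC that)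
    show "continuous_on M (W k)" by (rule continuous_on_M) (rule C1_chart_continuous[OF _ WC[OF that]])
  qed
  have zero: "(\<integral>q. ?d (W k) q \<partial>m) = 0" if k: "k \<in> P" for k
  proof -
    let ?c = "chart_at A k"
    have c: "?c \<in> A" using chart_at(1) P(2) k by blast
    have z: "W k q = 0" if "q \<notin> K k" for q using pu(1)[OF k that] by (simp add: W_def)
    have "?d (W k) q = green_density ?c (W k) f q" if q: "q \<in> M" for q
    proof (cases "q \<in> fst ?c")
      case True
      then show ?thesis
        using drift_laplacian_eq_chart_drift[OF c True f] point_ip_eq_chart_ip[OF c True WC[OF k c] fC[OF c]]
        by (simp add: green_density_def)
    next
      case False
      \<comment> \<open>Outside the chart the function \<open>W k\<close> vanishes near
        \<open>q\<close>, hence so does its differential, computed in whatever chart is chosen at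
        \<open>q\<close>.\<close>
      then have qK: "q \<notin> K k" using K(2)[OF k] by blast
      note cq = chart_at[OF q]
      have "point_ip A g (W k) f q = 0"
        unfolding point_ip_def
        by (rule chart_ip_zero_off_support[OF cq(1) WC[OF k cq(1)] K(1)[OF k]]) (use z qK cq in auto)
      then show ?thesis using False z[OF qK] by (simp add: green_density_def)
    qed
    then have "(\<integral>q. ?d (W k) q \<partial>m) = (\<integral>q. green_density ?c (W k) f q \<partial>m)"
      by (intro Bochner_Integration.integral_cong) simp_all
    also have "\<dots> = 0"
    proof (rule integral_green_density[OF c smooth_fun_C1[OF f c] WC[OF k c] K(1,2)[OF k]])
      show "W k q = 0" if "q \<in> fst ?c" "snd ?c q \<notin> interior (chart_image ?c)" for q
        using bd[OF not_interior_imp_boundary[OF c that]] by (simp add: W_def)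
    qed (use z in auto)
    finally show ?thesis .
  qed
  have sum: "(\<Sum>k\<in>P. ?d (W k) q) = ?d w q" if q: "q \<in> M" for q
  proof -
    have s: "(\<Sum>k\<in>P. W k q') = w q'" if "q' \<in> M" for q'
      using one[OF that] by (simp add: W_def sum_distrib_right[symmetric])
    have "(\<Sum>k\<in>P. point_ip A g (W k) f q) = point_ip A g (\<lambda>q. \<Sum>k\<in>P. W k q) f q"
      by (rule point_ip_sum_left[OF q WC, symmetric])
    also have "\<dots> = point_ip A g w f q" by (rule point_ip_cong_left[OF q s])
    finally show ?thesis by (simp add: sum.distrib sum_distrib_right[symmetric] s[OF q])
  qed
  have cw: "continuous_on M w" by (rule continuous_on_M) (rule C1_chart_continuous[OF _ w])
  have i1: "integrable m (\<lambda>q. w q * drift_laplacian A g \<eta> f q)"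
    by (intro integrable_continuous_M continuous_on_mult cw continuous_drift_laplacian[OF f])
  have i2: "integrable m (point_ip A g w f)"
    by (intro integrable_continuous_M continuous_point_ip fC w)
  have "(\<integral>q. w q * drift_laplacian A g \<eta> f q \<partial>m) + (\<integral>q. point_ip A g w f q \<partial>m) = (\<integral>q. ?d w q \<partial>m)"
    using i1 i2 by simp
  also have "\<dots> = (\<integral>q. (\<Sum>k\<in>P. ?d (W k) q) \<partial>m)"
    by (rule Bochner_Integration.integral_cong) (simp_all add: sum)
  also have "\<dots> = (\<Sum>k\<in>P. \<integral>q. ?d (W k) q \<partial>m)"
    by (rule Bochner_Integration.integral_sum) (rule integrable_continuous_M[OF cd])
  also have "\<dots> = 0" using zero by simp
  finally show ?thesis by simp
qed

end

section \<open>Comparison of two weighted measures\<close>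

definition weight_ratio :: "('a, 'n::finite) chart set \<Rightarrow> ('a, 'n) tensor2 \<Rightarrow> ('a \<Rightarrow> real) \<Rightarrow> ('a, 'n) tensor2 \<Rightarrow> ('a \<Rightarrow> real) \<Rightarrow> 'a \<Rightarrow> real" where
  "weight_ratio A g \<eta> g' \<eta>' p = chart_weight g' \<eta>' (chart_at A p) p / chart_weight g \<eta> (chart_at A p) p"

locale two_weights = W: weighted_compact_manifold M A g \<eta> + W': weighted_compact_manifold M A g' \<eta>'
  for M :: "'a::{second_countable_topology, t2_space} set" and A :: "('a, 'n::finite) chart set" and g \<eta> g' \<eta>'
begin

text \<open>Both weights change by the same Jacobian determinant, so their quotient is a genuine
  function on the manifold. It is the density of the second weighted measure with respect to the
  first.\<close>

lemma weight_ratio_eq: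
  assumes c: "c \<in> A" "p \<in> fst c"
  shows "weight_ratio A g \<eta> g' \<eta>' p = chart_weight g' \<eta>' c p / chart_weight g \<eta> c p"
proof -
  have p: "p \<in> M" using c W.domain_subset by blast
  note ca = W.chart_at[OF p]
  have q: "p \<in> fst (chart_at A p) \<inter> fst c" using ca c by blast
  show ?thesis
    unfolding weight_ratio_def W.chart_weight_change[OF ca(1) c(1) q] W'.chart_weight_change[OF ca(1) c(1) q]
    using W.det_jacobian_pos[OF ca(1) c(1) q] by simp
qed

lemma continuous_weight_ratio: "continuous_on M (weight_ratio A g \<eta> g' \<eta>')"
proof (rule W.continuous_on_M)
  fix c assume c: "c \<in> A"
  have "continuous_on (fst c) (\<lambda>p. chart_weight g' \<eta>' c p / chart_weight g \<eta> c p)"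
    using W.C1_chart_continuous[OF c W.chart_weight_C1[OF c]] W.C1_chart_continuous[OF c W'.chart_weight_C1[OF c]]
      W.chart_weight_pos[OF c]
    by (intro continuous_on_divide) (auto simp: less_imp_neq[symmetric])
  moreover have "continuous_on (fst c) (weight_ratio A g \<eta> g' \<eta>')
      = continuous_on (fst c) (\<lambda>p. chart_weight g' \<eta>' c p / chart_weight g \<eta> c p)"
    by (rule continuous_on_cong) (use weight_ratio_eq[OF c] in simp_all)
  ultimately show "continuous_on (fst c) (weight_ratio A g \<eta> g' \<eta>')" by blast
qed

text \<open>In a chart the identity is a cancellation of weights under a Lebesgue integral; the
  partition of unity makes it global. It moves all integrals to a measure independent of t before
  they are differentiated.\<close>

lemma integral_change_weight:
  assumes f: "continuous_on M f"
  shows "(\<integral>p. f p \<partial>weighted_measure M A g' \<eta>')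
    = (\<integral>p. weight_ratio A g \<eta> g' \<eta>' p * f p \<partial>weighted_measure M A g \<eta>)"
proof (rule W.partition_of_unity)
  fix P K and pu :: "'a \<Rightarrow> 'a \<Rightarrow> real"
  assume P: "finite P" "P \<subseteq> M" and K: "\<And>p. p \<in> P \<Longrightarrow> compact (K p)" "\<And>p. p \<in> P \<Longrightarrow> K p \<subseteq> fst (chart_at A p)"
    and pu: "\<And>p q. p \<in> P \<Longrightarrow> q \<notin> K p \<Longrightarrow> pu p q = 0" "\<And>p c. p \<in> P \<Longrightarrow> c \<in> A \<Longrightarrow> C1_chart c (pu p)"
    and one: "\<And>q. q \<in> M \<Longrightarrow> (\<Sum>p\<in>P. pu p q) = 1"
  let ?\<theta> = "weight_ratio A g \<eta> g' \<eta>'"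
  have cpu: "continuous_on M (pu k)" if "k \<in> P" for k
    by (rule W.continuous_on_M) (rule W.C1_chart_continuous[OF _ pu(2)[OF that]])
  have c1: "continuous_on M (\<lambda>q. pu k q * f q)" if "k \<in> P" for k
    by (intro continuous_on_mult cpu that f)
  have c2: "continuous_on M (\<lambda>q. pu k q * (?\<theta> q * f q))" if "k \<in> P" for k
    by (intro continuous_on_mult cpu that f continuous_weight_ratio)
  have eq: "(\<integral>q. pu k q * f q \<partial>W'.m) = (\<integral>q. pu k q * (?\<theta> q * f q) \<partial>W.m)" if k: "k \<in> P" for k
  proof -
    let ?c = "chart_at A k"
    have c: "?c \<in> A" using W.chart_at(1) P(2) k by blast
    have z: "pu k q = 0" if "q \<in> M - fst ?c" for q using pu(1)[OF k] K(2)[OF k] that by blast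
    let ?S = "chart_image ?c" and ?i = "chart_inv ?c"
    have "(\<integral>q. pu k q * f q \<partial>W'.m)
      = (\<integral>x. indicator ?S x * (pu k (?i x) * f (?i x) * chart_weight g' \<eta>' ?c (?i x)) \<partial>lborel)"
      by (rule W'.integral_chart[OF c W.measurable_M(3)[OF c1[OF k]]]) (simp add: z)
    also have "\<dots> = (\<integral>x. indicator ?S x * (pu k (?i x) * (?\<theta> (?i x) * f (?i x)) * chart_weight g \<eta> ?c (?i x)) \<partial>lborel)"
    proof (rule Bochner_Integration.integral_cong[OF refl])
      fix x
      show "indicator ?S x * (pu k (?i x) * f (?i x) * chart_weight g' \<eta>' ?c (?i x))
        = indicator ?S x * (pu k (?i x) * (?\<theta> (?i x) * f (?i x)) * chart_weight g \<eta> ?c (?i x))"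
      proof (cases "x \<in> ?S")
        case True
        note i = W.chart_inv_in[OF c True]
        show ?thesis using weight_ratio_eq[OF c i] W.chart_weight_pos[OF c i] by simp
      qed simp
    qed
    also have "\<dots> = (\<integral>q. pu k q * (?\<theta> q * f q) \<partial>W.m)"
      by (rule W.integral_chart[symmetric, OF c W.measurable_M(3)[OF c2[OF k]]]) (simp add: z)
    finally show ?thesis .
  qed
  have "(\<integral>q. f q \<partial>W'.m) = (\<integral>q. (\<Sum>k\<in>P. pu k q * f q) \<partial>W'.m)"
    by (rule Bochner_Integration.integral_cong) (simp_all add: sum_distrib_right[symmetric] one)
  also have "\<dots> = (\<Sum>k\<in>P. \<integral>q. pu k q * f q \<partial>W'.m)"
    by (rule Bochner_Integration.integral_sum) (rule W'.integrable_continuous_M[OF c1])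
  also have "\<dots> = (\<Sum>k\<in>P. \<integral>q. pu k q * (?\<theta> q * f q) \<partial>W.m)"
    by (rule sum.cong[OF refl eq])
  also have "\<dots> = (\<integral>q. (\<Sum>k\<in>P. pu k q * (?\<theta> q * f q)) \<partial>W.m)"
    by (rule Bochner_Integration.integral_sum[symmetric]) (rule W.integrable_continuous_M[OF c2])
  also have "\<dots> = (\<integral>q. ?\<theta> q * f q \<partial>W.m)"
    by (rule Bochner_Integration.integral_cong) (simp_all add: sum_distrib_right[symmetric] one)
  finally show ?thesis .
qed

end

section \<open>Differentiation under the integral\<close>

text \<open>Bounding the values together with the difference quotients makes the class closed under products;
  it provides the dominating constant for differentiation under the integral.\<close>

definition lip0 :: "'b set \<Rightarrow> (real \<Rightarrow> 'b \<Rightarrow> real) \<Rightarrow> bool" where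
  "lip0 K u \<longleftrightarrow> (\<exists>C\<ge>0. \<forall>\<^sub>F t in nhds 0. \<forall>p\<in>K. \<bar>u t p\<bar> \<le> C \<and> \<bar>u t p - u 0 p\<bar> \<le> C * \<bar>t\<bar>)"

lemma lip0I:
  assumes "\<forall>\<^sub>F t in nhds 0. \<forall>p\<in>K. \<bar>u t p\<bar> \<le> C \<and> \<bar>u t p - u 0 p\<bar> \<le> C * \<bar>t\<bar>"
  shows "lip0 K u"
  unfolding lip0_def
proof (intro exI[of _ "max C 0"] conjI)
  show "\<forall>\<^sub>F t in nhds 0. \<forall>p\<in>K. \<bar>u t p\<bar> \<le> max C 0 \<and> \<bar>u t p - u 0 p\<bar> \<le> max C 0 * \<bar>t\<bar>"
    using assms
  proof eventually_elim
    case (elim t)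
    have "C * \<bar>t\<bar> \<le> max C 0 * \<bar>t\<bar>" by (intro mult_right_mono) auto
    then show ?case using elim by fastforce
  qed
qed simp

lemma lip0_const:
  assumes "\<And>p. p \<in> K \<Longrightarrow> \<bar>f p\<bar> \<le> B"
  shows "lip0 K (\<lambda>t. f)"
proof (rule lip0I[of _ _ "max B 0"])
  have "\<bar>f p\<bar> \<le> max B 0" if "p \<in> K" for p using assms[OF that] by simp
  then show "\<forall>\<^sub>F t in nhds 0. \<forall>p\<in>K. \<bar>f p\<bar> \<le> max B 0 \<and> \<bar>f p - f p\<bar> \<le> max B 0 * \<bar>t\<bar>" by simp
qed

lemma lip0_cong:
  assumes "lip0 K u" "\<forall>\<^sub>F t in nhds 0. \<forall>p\<in>K. v t p = u t p"
  shows "lip0 K v"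
proof -
  obtain C where C: "\<forall>\<^sub>F t in nhds 0. \<forall>p\<in>K. \<bar>u t p\<bar> \<le> C \<and> \<bar>u t p - u 0 p\<bar> \<le> C * \<bar>t\<bar>"
    using assms(1) by (auto simp: lip0_def)
  \<comment> \<open>The filter \<open>nhds 0\<close> includes t = 0, so the families also agree at
    the base point.\<close>
  have 0: "\<forall>p\<in>K. v 0 p = u 0 p" using eventually_nhds_x_imp_x[OF assms(2)] .
  show ?thesis
  proof (rule lip0I[of _ _ C])
    show "\<forall>\<^sub>F t in nhds 0. \<forall>p\<in>K. \<bar>v t p\<bar> \<le> C \<and> \<bar>v t p - v 0 p\<bar> \<le> C * \<bar>t\<bar>"
      using C assms(2) by eventually_elim (simp add: 0)
  qed
qed

lemma lip0_add:
  assumes "lip0 K u" "lip0 K v"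
  shows "lip0 K (\<lambda>t p. u t p + v t p)"
proof -
  obtain C where C: "\<forall>\<^sub>F t in nhds 0. \<forall>p\<in>K. \<bar>u t p\<bar> \<le> C \<and> \<bar>u t p - u 0 p\<bar> \<le> C * \<bar>t\<bar>"
    using assms(1) by (auto simp: lip0_def)
  obtain D where D: "\<forall>\<^sub>F t in nhds 0. \<forall>p\<in>K. \<bar>v t p\<bar> \<le> D \<and> \<bar>v t p - v 0 p\<bar> \<le> D * \<bar>t\<bar>"
    using assms(2) by (auto simp: lip0_def)
  show ?thesis
  proof (rule lip0I[of _ _ "C + D"])
    show "\<forall>\<^sub>F t in nhds 0. \<forall>p\<in>K. \<bar>u t p + v t p\<bar> \<le> C + D \<and> \<bar>u t p + v t p - (u 0 p + v 0 p)\<bar> \<le> (C + D) * \<bar>t\<bar>"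
      using C D by eventually_elim (fastforce simp: distrib_right)
  qed
qed

lemma lip0_mult:
  assumes "lip0 K u" "lip0 K v"
  shows "lip0 K (\<lambda>t p. u t p * v t p)"
proof -
  obtain C where C0: "C \<ge> 0" and C: "\<forall>\<^sub>F t in nhds 0. \<forall>p\<in>K. \<bar>u t p\<bar> \<le> C \<and> \<bar>u t p - u 0 p\<bar> \<le> C * \<bar>t\<bar>"
    using assms(1) by (auto simp: lip0_def)
  obtain D where D0: "D \<ge> 0" and D: "\<forall>\<^sub>F t in nhds 0. \<forall>p\<in>K. \<bar>v t p\<bar> \<le> D \<and> \<bar>v t p - v 0 p\<bar> \<le> D * \<bar>t\<bar>"
    using assms(2) by (auto simp: lip0_def)
  have D': "\<forall>p\<in>K. \<bar>v 0 p\<bar> \<le> D" using eventually_nhds_x_imp_x[OF D] by blast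
  show ?thesis
  \<comment> \<open>Each of the two terms of the product difference contributes C D; the doubled
    constant also bounds the values.\<close>
  proof (rule lip0I[of _ _ "2 * (C * D)"])
    show "\<forall>\<^sub>F t in nhds 0. \<forall>p\<in>K. \<bar>u t p * v t p\<bar> \<le> 2 * (C * D) \<and> \<bar>u t p * v t p - u 0 p * v 0 p\<bar> \<le> 2 * (C * D) * \<bar>t\<bar>"
      using C D
    proof eventually_elim
      case (elim t)
      show ?case
      proof
        fix p assume p: "p \<in> K"
        have 1: "\<bar>u t p * v t p\<bar> \<le> C * D" unfolding abs_mult using elim p C0 by (intro mult_mono) auto
        have "\<bar>u t p * v t p - u 0 p * v 0 p\<bar> = \<bar>u t p * (v t p - v 0 p) + (u t p - u 0 p) * v 0 p\<bar>"
          by (simp add: algebra_simps)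
        also have "\<dots> \<le> \<bar>u t p\<bar> * \<bar>v t p - v 0 p\<bar> + \<bar>u t p - u 0 p\<bar> * \<bar>v 0 p\<bar>"
          by (metis abs_mult abs_triangle_ineq)
        also have "\<dots> \<le> C * (D * \<bar>t\<bar>) + (C * \<bar>t\<bar>) * D"
          using elim p C0 D0 D' by (intro add_mono mult_mono) auto
        finally have 2: "\<bar>u t p * v t p - u 0 p * v 0 p\<bar> \<le> 2 * (C * D) * \<bar>t\<bar>" by (simp add: algebra_simps)
        have "0 \<le> C * D" using C0 D0 by simp
        then show "\<bar>u t p * v t p\<bar> \<le> 2 * (C * D) \<and> \<bar>u t p * v t p - u 0 p * v 0 p\<bar> \<le> 2 * (C * D) * \<bar>t\<bar>"
          using 1 2 by linarith
      qed
    qed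
  qed
qed

lemma lip0_sum: "(\<And>k. k \<in> J \<Longrightarrow> lip0 K (u k)) \<Longrightarrow> lip0 K (\<lambda>t p. \<Sum>k\<in>J. u k t p)"
proof (induction J rule: infinite_finite_induct)
  case (insert x F)
  have "lip0 K (\<lambda>t p. u x t p + (\<Sum>k\<in>F. u k t p))"
    by (rule lip0_add) (use insert in simp_all)
  then show ?case by (simp add: insert.hyps)
qed (simp_all add: lip0_const[of _ _ 0])

lemma lip0_prod: "(\<And>k. k \<in> J \<Longrightarrow> lip0 K (u k)) \<Longrightarrow> lip0 K (\<lambda>t p. \<Prod>k\<in>J. u k t p)"
proof (induction J rule: infinite_finite_induct)
  case (insert x F)
  have "lip0 K (\<lambda>t p. u x t p * (\<Prod>k\<in>F. u k t p))"
    by (rule lip0_mult) (use insert in simp_all)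
  then show ?case by (simp add: insert.hyps)
qed (simp_all add: lip0_const[of _ _ 1])

lemma lip0_minus: "lip0 K u \<Longrightarrow> lip0 K (\<lambda>t p. - u t p)"
  using lip0_mult[OF lip0_const[of K "\<lambda>_. - 1" 1], of u] by simp

text \<open>For t near 0 all values stay in one compact interval, where \<open>k\<close> is bounded
  and Lipschitz because \<open>k'\<close> is bounded there.\<close>

lemma lip0_compose:
  assumes u: "lip0 K u" and ab: "\<forall>\<^sub>F t in nhds 0. \<forall>p\<in>K. u t p \<in> {a..b}"
    and k: "\<And>x. x \<in> {a..b} \<Longrightarrow> (k has_real_derivative k' x) (at x)" "continuous_on {a..b} k'"
  shows "lip0 K (\<lambda>t p. k (u t p))"
proof -
  obtain C where C0: "C \<ge> 0" and C: "\<forall>\<^sub>F t in nhds 0. \<forall>p\<in>K. \<bar>u t p\<bar> \<le> C \<and> \<bar>u t p - u 0 p\<bar> \<le> C * \<bar>t\<bar>"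
    using u by (auto simp: lip0_def)
  have "continuous_on {a..b} k"
    by (intro continuous_at_imp_continuous_on ballI DERIV_isCont[OF k(1)])
  then have "bounded (k ` {a..b})" by (intro compact_imp_bounded compact_continuous_image compact_Icc)
  then obtain B where B: "\<And>x. x \<in> {a..b} \<Longrightarrow> norm (k x) \<le> B" unfolding bounded_iff by blast
  obtain L where L: "\<And>x. x \<in> {a..b} \<Longrightarrow> norm (k' x) \<le> L"
    using compact_imp_bounded[OF compact_continuous_image[OF k(2) compact_Icc]] unfolding bounded_iff by blast
  have lip: "\<bar>k x - k y\<bar> \<le> max L 0 * \<bar>x - y\<bar>" if xy: "x \<in> {a..b}" "y \<in> {a..b}" for x y
  proof -
    have "norm (k x - k y) \<le> max L 0 * norm (x - y)"
    proof (rule field_differentiable_bound[OF _ _ _ xy])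
      show "(k has_field_derivative k' z) (at z within {a..b})" if "z \<in> {a..b}" for z
        using has_field_derivative_at_within[OF k(1)[OF that]] .
      show "norm (k' z) \<le> max L 0" if "z \<in> {a..b}" for z using L[OF that] by simp
    qed simp
    then show ?thesis by simp
  qed
  have 0: "\<forall>p\<in>K. u 0 p \<in> {a..b}" using eventually_nhds_x_imp_x[OF ab] .
  show ?thesis
  proof (rule lip0I[of _ _ "max B 0 + max L 0 * C"])
    show "\<forall>\<^sub>F t in nhds 0. \<forall>p\<in>K. \<bar>k (u t p)\<bar> \<le> max B 0 + max L 0 * C \<and>
        \<bar>k (u t p) - k (u 0 p)\<bar> \<le> (max B 0 + max L 0 * C) * \<bar>t\<bar>"
      using C ab
    proof eventually_elim
      case (elim t)
      show ?case
      proof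
        fix p assume p: "p \<in> K"
        have LC: "0 \<le> max L 0 * C" using C0 by simp
        have "\<bar>k (u t p)\<bar> \<le> max B 0" using B[of "u t p"] elim p by auto
        moreover have "\<bar>k (u t p) - k (u 0 p)\<bar> \<le> max L 0 * \<bar>u t p - u 0 p\<bar>"
          using lip elim 0 p by blast
        moreover have "\<dots> \<le> max L 0 * (C * \<bar>t\<bar>)" using elim p by (intro mult_left_mono) auto
        moreover have "0 \<le> max B 0 * \<bar>t\<bar>" by simp
        ultimately show "\<bar>k (u t p)\<bar> \<le> max B 0 + max L 0 * C \<and>
            \<bar>k (u t p) - k (u 0 p)\<bar> \<le> (max B 0 + max L 0 * C) * \<bar>t\<bar>"
          using LC unfolding distrib_right mult.assoc by linarith
      qed
    qed
  qed
qed

text \<open>The Lipschitz estimate costs at most \<epsilon> / 2 for small t, uniformly on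
  \<open>K\<close>. This keeps determinants away from 0 before inverses and roots are taken.\<close>

lemma lip0_eventually_ge:
  assumes "lip0 K u" and \<epsilon>: "\<epsilon> > 0" "\<And>p. p \<in> K \<Longrightarrow> \<epsilon> \<le> u 0 p"
  obtains C where "\<forall>\<^sub>F t in nhds 0. \<forall>p\<in>K. u t p \<in> {\<epsilon> / 2..C}"
proof -
  obtain C where C0: "C \<ge> 0" and C: "\<forall>\<^sub>F t in nhds 0. \<forall>p\<in>K. \<bar>u t p\<bar> \<le> C \<and> \<bar>u t p - u 0 p\<bar> \<le> C * \<bar>t\<bar>"
    using assms(1) by (auto simp: lip0_def)
  have "((\<lambda>t. C * \<bar>t\<bar>) \<longlongrightarrow> 0) (nhds 0)" by (auto intro!: tendsto_eq_intros filterlim_ident)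
  then have "\<forall>\<^sub>F t in nhds 0. C * \<bar>t\<bar> < \<epsilon> / 2" by (rule order_tendstoD) (use \<epsilon> in simp)
  with C have "\<forall>\<^sub>F t in nhds 0. \<forall>p\<in>K. u t p \<in> {\<epsilon> / 2..C}"
    by eventually_elim (use \<epsilon>(2) in force)
  then show ?thesis by (rule that)
qed

lemma lip0_inverse:
  assumes "lip0 K u" "\<epsilon> > 0" "\<And>p. p \<in> K \<Longrightarrow> \<epsilon> \<le> u 0 p"
  shows "lip0 K (\<lambda>t p. inverse (u t p))"
proof -
  obtain C where C: "\<forall>\<^sub>F t in nhds 0. \<forall>p\<in>K. u t p \<in> {\<epsilon> / 2..C}" by (rule lip0_eventually_ge[OF assms])
  show ?thesis
  proof (rule lip0_compose[OF assms(1) C, where k'="\<lambda>y. - (inverse y ^ 2)"])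
    show "(inverse has_real_derivative - (inverse x)\<^sup>2) (at x)" if "x \<in> {\<epsilon> / 2..C}" for x
      using DERIV_inverse[of x] that assms(2) by (simp add: power2_eq_square)
    show "continuous_on {\<epsilon> / 2..C} (\<lambda>y. - (inverse y)\<^sup>2)"
      using assms(2) by (auto intro!: continuous_intros)
  qed
qed

lemma lip0_sqrt:
  assumes "lip0 K u" "\<epsilon> > 0" "\<And>p. p \<in> K \<Longrightarrow> \<epsilon> \<le> u 0 p"
  shows "lip0 K (\<lambda>t p. sqrt (u t p))"
proof -
  obtain C where C: "\<forall>\<^sub>F t in nhds 0. \<forall>p\<in>K. u t p \<in> {\<epsilon> / 2..C}" by (rule lip0_eventually_ge[OF assms])
  show ?thesis
  proof (rule lip0_compose[OF assms(1) C, where k'="\<lambda>y. inverse (sqrt y) / 2"])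
    show "(sqrt has_real_derivative inverse (sqrt x) / 2) (at x)" if "x \<in> {\<epsilon> / 2..C}" for x
      using DERIV_real_sqrt[of x] that assms(2) by simp
    show "continuous_on {\<epsilon> / 2..C} (\<lambda>y. inverse (sqrt y) / 2)"
      using assms(2) by (auto intro!: continuous_intros)
  qed
qed

lemma lip0_exp:
  assumes "lip0 K u"
  shows "lip0 K (\<lambda>t p. exp (u t p))"
proof -
  obtain C where C: "\<forall>\<^sub>F t in nhds 0. \<forall>p\<in>K. \<bar>u t p\<bar> \<le> C \<and> \<bar>u t p - u 0 p\<bar> \<le> C * \<bar>t\<bar>"
    using assms by (auto simp: lip0_def)
  then have "\<forall>\<^sub>F t in nhds 0. \<forall>p\<in>K. u t p \<in> {- C..C}" by eventually_elim force
  then show ?thesis by (rule lip0_compose[OF assms, where k'=exp]) (auto intro: DERIV_exp continuous_intros)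
qed

lemma lip0_det:
  fixes m :: "real \<Rightarrow> 'b \<Rightarrow> real^'n::finite^'n"
  assumes "\<And>i j. lip0 K (\<lambda>t p. m t p $ i $ j)"
  shows "lip0 K (\<lambda>t p. det (m t p))"
  unfolding det_def by (intro lip0_sum lip0_mult lip0_prod assms lip0_const[of _ _ 1]) (simp add: sign_def)

lemma lip0_matrix_inv:
  fixes m :: "real \<Rightarrow> 'b \<Rightarrow> real^'n::finite^'n"
  assumes m: "\<And>i j. lip0 K (\<lambda>t p. m t p $ i $ j)" and \<epsilon>: "\<epsilon> > 0" "\<And>p. p \<in> K \<Longrightarrow> \<epsilon> \<le> det (m 0 p)"
  shows "lip0 K (\<lambda>t p. matrix_inv (m t p) $ i $ j)"
proof -
  obtain C where C: "\<forall>\<^sub>F t in nhds 0. \<forall>p\<in>K. det (m t p) \<in> {\<epsilon> / 2..C}"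
    by (rule lip0_eventually_ge[OF lip0_det[OF m] \<epsilon>])
  have e: "lip0 K (\<lambda>t p. (\<chi> r s. if s = i then (if r = j then 1 else 0) else m t p $ r $ s) $ a $ b)" for a b
    using m lip0_const[of K "\<lambda>_. 1" 1] lip0_const[of K "\<lambda>_. 0" 0] by (cases "b = i"; cases "a = j") simp_all
  have "lip0 K (\<lambda>t p. det (\<chi> r s. if s = i then (if r = j then 1 else 0) else m t p $ r $ s) * inverse (det (m t p)))"
    by (rule lip0_mult[OF lip0_det[OF e] lip0_inverse[OF lip0_det[OF m] \<epsilon>]])
  then show ?thesis
  proof (rule lip0_cong)
    show "\<forall>\<^sub>F t in nhds 0. \<forall>p\<in>K. matrix_inv (m t p) $ i $ j
        = det (\<chi> r s. if s = i then (if r = j then 1 else 0) else m t p $ r $ s) * inverse (det (m t p))"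
      using C
    proof eventually_elim
      case (elim t)
      show ?case
      proof
        fix p assume "p \<in> K"
        then have "det (m t p) \<noteq> 0" using elim \<epsilon>(1) by force
        show "matrix_inv (m t p) $ i $ j
            = det (\<chi> r s. if s = i then (if r = j then 1 else 0) else m t p $ r $ s) * inverse (det (m t p))"
          by (simp only: matrix_inv_cramer[OF \<open>det (m t p) \<noteq> 0\<close>] divide_inverse)
      qed
    qed
  qed
qed

lemma lip0_Union:
  assumes "finite P" "\<And>k. k \<in> P \<Longrightarrow> lip0 (K k) u"
  shows "lip0 (\<Union>k\<in>P. K k) u"
  using assms
proof (induction P rule: finite_induct)
  case empty
  then show ?case by (simp add: lip0_def) (rule exI[of _ 0], simp)
next
  case (insert x F)
  obtain C where C: "\<forall>\<^sub>F t in nhds 0. \<forall>p\<in>K x. \<bar>u t p\<bar> \<le> C \<and> \<bar>u t p - u 0 p\<bar> \<le> C * \<bar>t\<bar>"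
    using insert.prems[of x] by (auto simp: lip0_def)
  obtain D where D: "\<forall>\<^sub>F t in nhds 0. \<forall>p\<in>(\<Union>k\<in>F. K k). \<bar>u t p\<bar> \<le> D \<and> \<bar>u t p - u 0 p\<bar> \<le> D * \<bar>t\<bar>"
    using insert.IH insert.prems by (auto simp: lip0_def)
  show ?case
  proof (rule lip0I[of _ _ "max C D"])
    show "\<forall>\<^sub>F t in nhds 0. \<forall>p\<in>(\<Union>k\<in>insert x F. K k). \<bar>u t p\<bar> \<le> max C D \<and> \<bar>u t p - u 0 p\<bar> \<le> max C D * \<bar>t\<bar>"
      using C D
    proof eventually_elim
      case (elim t)
      have m: "C * \<bar>t\<bar> \<le> max C D * \<bar>t\<bar>" "D * \<bar>t\<bar> \<le> max C D * \<bar>t\<bar>" by (intro mult_right_mono; simp)+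
      show ?case
      proof
        fix p assume "p \<in> (\<Union>k\<in>insert x F. K k)"
        then consider "p \<in> K x" | "p \<in> (\<Union>k\<in>F. K k)" by blast
        then show "\<bar>u t p\<bar> \<le> max C D \<and> \<bar>u t p - u 0 p\<bar> \<le> max C D * \<bar>t\<bar>"
        proof cases
          case 1
          then have "\<bar>u t p\<bar> \<le> C \<and> \<bar>u t p - u 0 p\<bar> \<le> C * \<bar>t\<bar>" using elim(1) by blast
          then show ?thesis using m by (auto simp: le_max_iff_disj)
        next
          case 2
          then have "\<bar>u t p\<bar> \<le> D \<and> \<bar>u t p - u 0 p\<bar> \<le> D * \<bar>t\<bar>" using elim(2) by blast
          then show ?thesis using m by (auto simp: le_max_iff_disj)
        qed
      qed
    qed
  qed
qed

text \<open>Uniformly convergent difference quotients are eventually within distance 1 of their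
  bounded limit, which gives a Lipschitz constant; the bound on the values follows for parameters of
  size below 1.\<close>

lemma uniform_limit_lip0:
  assumes lim: "uniform_limit K (\<lambda>s p. (u s p - u t p) / (s - t)) u' (at t)" and t: "t = 0"
    and B: "\<And>p. p \<in> K \<Longrightarrow> \<bar>u 0 p\<bar> \<le> B" "\<And>p. p \<in> K \<Longrightarrow> \<bar>u' p\<bar> \<le> B'"
  shows "lip0 K u"
\<comment> \<open>The summand \<open>max B' 0 + 1\<close> bounds the difference quotients and
  \<open>max B 0\<close> the initial values. The maxima with 0 are needed because \<open>K\<close>
  may be empty and the bounds negative.\<close>
proof (rule lip0I[of _ _ "max B 0 + (max B' 0 + 1)"])
  have "\<forall>\<^sub>F s in at 0. \<forall>p\<in>K. dist ((u s p - u 0 p) / s) (u' p) < 1"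
    using uniform_limitD[OF lim, of 1] t by simp
  then have 1: "\<forall>\<^sub>F s in nhds 0. s \<noteq> 0 \<longrightarrow> (\<forall>p\<in>K. dist ((u s p - u 0 p) / s) (u' p) < 1)"
    by (simp add: eventually_at_filter)
  have "((\<lambda>s::real. \<bar>s\<bar>) \<longlongrightarrow> 0) (nhds 0)" by (auto intro!: tendsto_eq_intros filterlim_ident)
  then have 2: "\<forall>\<^sub>F s in nhds 0. \<bar>s::real\<bar> < 1" by (rule order_tendstoD) simp
  show "\<forall>\<^sub>F s in nhds 0. \<forall>p\<in>K. \<bar>u s p\<bar> \<le> max B 0 + (max B' 0 + 1) \<and>
      \<bar>u s p - u 0 p\<bar> \<le> (max B 0 + (max B' 0 + 1)) * \<bar>s\<bar>"
    using 1 2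
  proof eventually_elim
    case (elim s)
    show ?case
    proof
      fix p assume p: "p \<in> K"
      have d: "\<bar>u s p - u 0 p\<bar> \<le> (max B' 0 + 1) * \<bar>s\<bar>"
      proof (cases "s = 0")
        case False
        then have "\<bar>(u s p - u 0 p) / s - u' p\<bar> < 1" using elim p by (simp add: dist_real_def)
        then have "\<bar>(u s p - u 0 p) / s\<bar> \<le> max B' 0 + 1" using B(2)[OF p] by linarith
        then show ?thesis using False by (simp add: abs_divide divide_le_eq)
      qed simp
      have "(max B' 0 + 1) * \<bar>s\<bar> \<le> max B' 0 + 1" by (rule mult_left_le) (use elim in auto)
      then have "\<bar>u s p\<bar> \<le> max B 0 + (max B' 0 + 1)" using d B(1)[OF p] by linarith
      moreover have "(max B' 0 + 1) * \<bar>s\<bar> \<le> (max B 0 + (max B' 0 + 1)) * \<bar>s\<bar>" by (intro mult_right_mono) auto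
      ultimately show "\<bar>u s p\<bar> \<le> max B 0 + (max B' 0 + 1) \<and>
          \<bar>u s p - u 0 p\<bar> \<le> (max B 0 + (max B' 0 + 1)) * \<bar>s\<bar>" using d by linarith
    qed
  qed
qed

lemma (in compact_manifold) lip0_M:
  assumes "\<And>c K. c \<in> A \<Longrightarrow> compact K \<Longrightarrow> K \<subseteq> fst c \<Longrightarrow> lip0 K u"
  shows "lip0 M u"
proof -
  obtain P :: "'a set" and K :: "'a \<Rightarrow> 'a set"
    where P: "finite P" "P \<subseteq> M" "\<forall>p\<in>P. compact (K p) \<and> K p \<subseteq> fst (chart_at A p)" "M = (\<Union>p\<in>P. K p)"
    by (rule finite_compact_cover)
  have "lip0 (K p) u" if "p \<in> P" for p
    using assms[OF chart_at(1)] P(2,3) that by blast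
  then have "lip0 (\<Union>p\<in>P. K p) u" by (rule lip0_Union[OF P(1)])
  then show ?thesis using P(4) by metis
qed

text \<open>Difference quotients at 0 are dominated by the Lipschitz constant, which is integrable
  over a finite measure. The limit is taken along arbitrary sequences, to which dominated
  convergence applies; measurability of \<open>X'\<close> comes from it being a limit of continuous
  quotients.\<close>

lemma (in weighted_compact_manifold) has_derivative_integral:
  assumes X: "\<forall>\<^sub>F t in nhds 0. continuous_on M (X t)" and lip: "lip0 M X"
    and d: "\<And>p. p \<in> M \<Longrightarrow> ((\<lambda>t. X t p) has_real_derivative X' p) (at 0)"
  shows "integrable m X'" and "((\<lambda>t. \<integral>p. X t p \<partial>m) has_real_derivative (\<integral>p. X' p \<partial>m)) (at 0)"
proof -
  obtain C where C: "\<forall>\<^sub>F t in nhds 0. \<forall>p\<in>M. \<bar>X t p\<bar> \<le> C \<and> \<bar>X t p - X 0 p\<bar> \<le> C * \<bar>t\<bar>"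
    using lip by (auto simp: lip0_def)
  have C': "\<forall>\<^sub>F t in at 0. \<forall>p\<in>M. \<bar>X t p - X 0 p\<bar> \<le> C * \<bar>t\<bar>"
    using C unfolding eventually_at_filter by eventually_elim blast
  have cX: "\<forall>\<^sub>F t in at 0. continuous_on M (X t)"
    using X unfolding eventually_at_filter by eventually_elim blast
  have c0: "continuous_on M (X 0)" using eventually_nhds_x_imp_x[OF X] .
  have key: "integrable m X' \<and> (\<lambda>n. ((\<integral>p. X (s n) p \<partial>m) - (\<integral>p. X 0 p \<partial>m)) / s n) \<longlonglongrightarrow> (\<integral>p. X' p \<partial>m)"
    if s: "\<And>n. s n \<noteq> 0" "s \<longlonglongrightarrow> 0" for s
  proof -
    have fl: "filterlim s (at 0) sequentially" using s by (simp add: filterlim_at)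
    have "\<forall>\<^sub>F n in sequentially. (\<forall>p\<in>M. \<bar>X (s n) p - X 0 p\<bar> \<le> C * \<bar>s n\<bar>) \<and> continuous_on M (X (s n))"
      using eventually_compose_filterlim[OF eventually_conj[OF C' cX] fl] .
    then obtain N where N: "\<And>n p. n \<ge> N \<Longrightarrow> p \<in> M \<Longrightarrow> \<bar>X (s n) p - X 0 p\<bar> \<le> C * \<bar>s n\<bar>"
      "\<And>n. n \<ge> N \<Longrightarrow> continuous_on M (X (s n))"
      unfolding eventually_sequentially by blast
    \<comment> \<open>The shift by \<open>N\<close> discards the finitely many terms whose parameter
      is not yet small enough for continuity and the Lipschitz bound.\<close>
    define q where "q n p = (X (s (n + N)) p - X 0 p) / s (n + N)" for n p
    have cq: "continuous_on M (q n)" for n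
      unfolding q_def[abs_def] by (intro continuous_intros N(2) c0) (use s in auto)
    have qm: "q n \<in> borel_measurable m" for n by (rule measurable_M(2)[OF cq])
    have qb: "\<bar>q n p\<bar> \<le> C" if "p \<in> M" for n p
      using N(1)[of "n + N" p] that s(1)[of "n + N"] by (simp add: q_def abs_divide divide_le_eq)
    have ql: "(\<lambda>n. q n p) \<longlonglongrightarrow> X' p" if "p \<in> M" for p
    proof -
      have "((\<lambda>t. (X t p - X 0 p) / t) \<longlongrightarrow> X' p) (at 0)"
        using d[OF that] by (simp add: has_field_derivative_iff)
      from filterlim_compose[OF this fl] have "(\<lambda>n. (X (s n) p - X 0 p) / s n) \<longlonglongrightarrow> X' p" .
      from LIMSEQ_ignore_initial_segment[OF this, of N] show ?thesis by (simp add: q_def)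
    qed
    have X'm: "X' \<in> borel_measurable m"
      by (rule borel_measurable_LIMSEQ_metric[OF qm]) (use ql in simp)
    have w: "integrable m (\<lambda>p. C)" by (intro integrable_continuous_M continuous_intros)
    have AE: "AE p in m. (\<lambda>n. q n p) \<longlonglongrightarrow> X' p" by (rule AE_I2) (use ql in simp)
    have AEb: "AE p in m. norm (q n p) \<le> C" for n by (rule AE_I2) (use qb in simp)
    have i: "integrable m X'" by (rule integrable_dominated_convergence[OF X'm qm w AE AEb])
    have "(\<lambda>n. \<integral>p. q n p \<partial>m) \<longlonglongrightarrow> (\<integral>p. X' p \<partial>m)"
      by (rule integral_dominated_convergence[OF X'm qm w AE AEb])
    moreover have "(\<integral>p. q n p \<partial>m) = ((\<integral>p. X (s (n + N)) p \<partial>m) - (\<integral>p. X 0 p \<partial>m)) / s (n + N)" for n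
      unfolding q_def using integrable_continuous_M[OF N(2)] integrable_continuous_M[OF c0] by simp
    ultimately have "(\<lambda>n. ((\<integral>p. X (s (n + N)) p \<partial>m) - (\<integral>p. X 0 p \<partial>m)) / s (n + N)) \<longlonglongrightarrow> (\<integral>p. X' p \<partial>m)" by simp
    then have "(\<lambda>n. ((\<integral>p. X (s n) p \<partial>m) - (\<integral>p. X 0 p \<partial>m)) / s n) \<longlonglongrightarrow> (\<integral>p. X' p \<partial>m)"
      by (rule LIMSEQ_offset)
    then show ?thesis using i by blast
  qed
  show "integrable m X'"
    using key[of "\<lambda>n. inverse (real (Suc n))"] LIMSEQ_inverse_real_of_nat by simp
  have "((\<lambda>t. ((\<integral>p. X t p \<partial>m) - (\<integral>p. X 0 p \<partial>m)) / t) \<longlongrightarrow> (\<integral>p. X' p \<partial>m)) (at 0)"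
    unfolding tendsto_at_iff_sequentially using key by (auto simp: o_def)
  then show "((\<lambda>t. \<integral>p. X t p \<partial>m) has_real_derivative (\<integral>p. X' p \<partial>m)) (at 0)"
    by (simp add: has_field_derivative_iff)
qed

section \<open>Tensor contractions and the product rule for the Laplacian\<close>

lemma sum4_rotate:
  "(\<Sum>i\<in>UNIV. \<Sum>j\<in>UNIV. \<Sum>k\<in>UNIV. \<Sum>l\<in>UNIV. (f :: 'n::finite \<Rightarrow> 'n \<Rightarrow> 'n \<Rightarrow> 'n \<Rightarrow> real) i j k l)
    = (\<Sum>k\<in>UNIV. \<Sum>l\<in>UNIV. \<Sum>i\<in>UNIV. \<Sum>j\<in>UNIV. f i j k l)"
proof -
  have "(\<Sum>i\<in>UNIV. \<Sum>j\<in>UNIV. \<Sum>k\<in>UNIV. \<Sum>l\<in>UNIV. f i j k l) = (\<Sum>i\<in>UNIV. \<Sum>k\<in>UNIV. \<Sum>j\<in>UNIV. \<Sum>l\<in>UNIV. f i j k l)" by (intro sum.cong refl sum.swap)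
  also have "\<dots> = (\<Sum>k\<in>UNIV. \<Sum>i\<in>UNIV. \<Sum>j\<in>UNIV. \<Sum>l\<in>UNIV. f i j k l)" by (rule sum.swap)
  also have "\<dots> = (\<Sum>k\<in>UNIV. \<Sum>i\<in>UNIV. \<Sum>l\<in>UNIV. \<Sum>j\<in>UNIV. f i j k l)" by (intro sum.cong refl sum.swap)
  also have "\<dots> = (\<Sum>k\<in>UNIV. \<Sum>l\<in>UNIV. \<Sum>i\<in>UNIV. \<Sum>j\<in>UNIV. f i j k l)" by (intro sum.cong refl sum.swap)
  finally show ?thesis .
qed

text \<open>Contracting the metric with two copies of its inverse leaves one inverse, so the first
  part becomes \<open>s\<close> times the trace of \<open>H\<close>; the rank-one part evaluates
  \<open>H\<close> on the two raised differentials.\<close>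

lemma inner_tensor_algebra:
  fixes G g H :: "real^'n::finite^'n" and u v :: "'n \<Rightarrow> real"
  assumes inv: "\<And>i j. (\<Sum>k\<in>UNIV. G $ i $ k * g $ k $ j) = (if i = j then 1 else 0)"
    and sym: "\<And>i j. G $ i $ j = G $ j $ i"
  shows "(\<Sum>i\<in>UNIV. \<Sum>j\<in>UNIV. \<Sum>k\<in>UNIV. \<Sum>l\<in>UNIV. G $ i $ k * G $ j $ l * (s * g $ i $ j - 2 * (u i * v j)) * H $ k $ l)
    = s * (\<Sum>k\<in>UNIV. \<Sum>l\<in>UNIV. G $ k $ l * H $ k $ l)
      - 2 * (\<Sum>i\<in>UNIV. \<Sum>j\<in>UNIV. (\<Sum>a\<in>UNIV. \<Sum>b\<in>UNIV. G $ i $ a * H $ a $ b * G $ b $ j) * u i * v j)"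
proof -
  have 1: "(\<Sum>i\<in>UNIV. \<Sum>j\<in>UNIV. G $ i $ k * G $ j $ l * g $ i $ j) = G $ k $ l" for k l
  proof -
    have "(\<Sum>i\<in>UNIV. \<Sum>j\<in>UNIV. G $ i $ k * G $ j $ l * g $ i $ j) = (\<Sum>j\<in>UNIV. \<Sum>i\<in>UNIV. G $ i $ k * G $ j $ l * g $ i $ j)"
      by (rule sum.swap)
    also have "\<dots> = (\<Sum>j\<in>UNIV. G $ j $ l * (\<Sum>i\<in>UNIV. G $ k $ i * g $ i $ j))"
      by (simp add: sum_distrib_left sym[of _ k] mult_ac)
    also have "\<dots> = G $ k $ l" by (simp add: inv if_distrib sum.delta' cong: if_cong)
    finally show ?thesis .
  qed
  have "(\<Sum>i\<in>UNIV. \<Sum>j\<in>UNIV. \<Sum>k\<in>UNIV. \<Sum>l\<in>UNIV. G $ i $ k * G $ j $ l * (s * g $ i $ j - 2 * (u i * v j)) * H $ k $ l)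
    = s * (\<Sum>i\<in>UNIV. \<Sum>j\<in>UNIV. \<Sum>k\<in>UNIV. \<Sum>l\<in>UNIV. G $ i $ k * G $ j $ l * g $ i $ j * H $ k $ l)
      - 2 * (\<Sum>i\<in>UNIV. \<Sum>j\<in>UNIV. \<Sum>k\<in>UNIV. \<Sum>l\<in>UNIV. G $ i $ k * G $ j $ l * (u i * v j) * H $ k $ l)"
    by (simp add: sum_distrib_left sum_subtractf[symmetric] algebra_simps)
  also have "(\<Sum>i\<in>UNIV. \<Sum>j\<in>UNIV. \<Sum>k\<in>UNIV. \<Sum>l\<in>UNIV. G $ i $ k * G $ j $ l * g $ i $ j * H $ k $ l)
     = (\<Sum>k\<in>UNIV. \<Sum>l\<in>UNIV. G $ k $ l * H $ k $ l)"
    by (subst sum4_rotate) (simp add: sum_distrib_right[symmetric] 1)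
  also have "(\<Sum>i\<in>UNIV. \<Sum>j\<in>UNIV. \<Sum>k\<in>UNIV. \<Sum>l\<in>UNIV. G $ i $ k * G $ j $ l * (u i * v j) * H $ k $ l)
     = (\<Sum>i\<in>UNIV. \<Sum>j\<in>UNIV. (\<Sum>a\<in>UNIV. \<Sum>b\<in>UNIV. G $ i $ a * H $ a $ b * G $ b $ j) * u i * v j)"
  proof (intro sum.cong refl)
    fix i j
    have "G $ i $ k * G $ j $ l * (u i * v j) * H $ k $ l = G $ i $ k * H $ k $ l * G $ l $ j * u i * v j" for k l
      using sym[of j l] by simp
    then show "(\<Sum>k\<in>UNIV. \<Sum>l\<in>UNIV. G $ i $ k * G $ j $ l * (u i * v j) * H $ k $ l)
        = (\<Sum>a\<in>UNIV. \<Sum>b\<in>UNIV. G $ i $ a * H $ a $ b * G $ b $ j) * u i * v j"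
      by (simp only: sum_distrib_right)
  qed
  finally show ?thesis .
qed

context weighted_compact_manifold
begin

text \<open>The drift and Christoffel terms are derivations, so the cross term arises from the
  second derivatives alone.\<close>

lemma drift_laplacian_mult:
  assumes p: "p \<in> M" and f: "smooth_fun A f" "smooth_fun A h"
  shows "drift_laplacian A g \<eta> (\<lambda>q. f q * h q) p
    = f p * drift_laplacian A g \<eta> h p + h p * drift_laplacian A g \<eta> f p + 2 * point_ip A g f h p"
proof -
  define c where "c = chart_at A p"
  have c: "c \<in> A" "p \<in> fst c" using chart_at[OF p] by (simp_all add: c_def)
  note fc = smooth_fun_C1[OF f(1) c(1)] and hc = smooth_fun_C1[OF f(2) c(1)]
  let ?G = "matrix_inv (g c p)"
  have p1: "pd c j (\<lambda>q. f q * h q) q = f q * pd c j h q + h q * pd c j f q" if "q \<in> fst c" for j q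
    by (rule pd_mult[OF c(1) fc(1) hc(1) that])
  have p2: "pd c i (pd c j (\<lambda>q. f q * h q)) p
      = f p * pd c i (pd c j h) p + pd c j h p * pd c i f p + (h p * pd c i (pd c j f) p + pd c j f p * pd c i h p)" for i j
  proof -
    have "pd c i (pd c j (\<lambda>q. f q * h q)) p = pd c i (\<lambda>q. f q * pd c j h q + h q * pd c j f q) p"
      by (rule pd_cong[OF c(1) p1 c(2)])
    also have "\<dots> = pd c i (\<lambda>q. f q * pd c j h q) p + pd c i (\<lambda>q. h q * pd c j f q) p"
      by (intro pd_add C1_chart_mult c fc hc)
    finally show ?thesis
      using pd_mult[OF c(1) fc(1) hc(2) c(2)] pd_mult[OF c(1) hc(1) fc(2) c(2)] by simp
  qed
  have hs: "hessian g (\<lambda>q. f q * h q) c p $ i $ j = f p * hessian g h c p $ i $ j + h p * hessian g f c p $ i $ j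
      + pd c i f p * pd c j h p + pd c i h p * pd c j f p" for i j
    by (simp add: hessian_def p2 p1[OF c(2)] sum.distrib sum_distrib_left algebra_simps)
  have "(\<Sum>i\<in>UNIV. \<Sum>j\<in>UNIV. ?G $ i $ j * hessian g (\<lambda>q. f q * h q) c p $ i $ j)
     = f p * (\<Sum>i\<in>UNIV. \<Sum>j\<in>UNIV. ?G $ i $ j * hessian g h c p $ i $ j)
      + h p * (\<Sum>i\<in>UNIV. \<Sum>j\<in>UNIV. ?G $ i $ j * hessian g f c p $ i $ j)
      + chart_ip g c f h p + chart_ip g c h f p"
    unfolding hs chart_ip_def inner_matrix_mult_sum chart_diff_def
    by (simp add: sum.distrib sum_distrib_left algebra_simps)
  moreover have "chart_ip g c h f p = chart_ip g c f h p" by (rule chart_ip_sym[OF c])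
  moreover have "chart_ip g c \<eta> (\<lambda>q. f q * h q) p = f p * chart_ip g c \<eta> h p + h p * chart_ip g c \<eta> f p"
    using point_ip_mult_left[OF p smooth_fun_C1(1)[OF f(1)] smooth_fun_C1(1)[OF f(2)], of \<eta>]
    by (simp add: point_ip_def c_def[symmetric] chart_ip_sym[OF c, of \<eta>])
  ultimately show ?thesis
    unfolding drift_laplacian_eq[OF p] c_def[symmetric] point_ip_def chart_drift_def by (simp add: algebra_simps)
qed

text \<open>Green's identity does not apply directly, as \<open>w\<close> need not vanish on the
  boundary. After expanding by the product rule it is applied to \<open>w * f\<close> against
  \<open>h\<close> and to \<open>w * h\<close> against \<open>f\<close>, which do vanish there. With
  \<open>w\<close> the derivative of \<eta>(t) this is the last integration by parts of the
  overview.\<close>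

lemma integral_mult_drift_laplacian:
  assumes f: "smooth_fun A f" "smooth_fun A h" and w: "\<And>c. c \<in> A \<Longrightarrow> C1_chart c w"
    and bd: "\<And>p. p \<in> manifold_boundary A \<Longrightarrow> f p = 0" "\<And>p. p \<in> manifold_boundary A \<Longrightarrow> h p = 0"
  shows "(\<integral>p. w p * drift_laplacian A g \<eta> (\<lambda>q. f q * h q) p \<partial>m) = - (\<integral>p. point_ip A g w (\<lambda>q. f q * h q) p \<partial>m)"
    and "integrable m (\<lambda>p. w p * drift_laplacian A g \<eta> (\<lambda>q. f q * h q) p)"
proof -
  note fC = smooth_fun_C1(1)[OF f(1)] and hC = smooth_fun_C1(1)[OF f(2)]
  have cont: "continuous_on M k" if "\<And>c. c \<in> A \<Longrightarrow> C1_chart c k" for k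
    by (rule continuous_on_M) (rule C1_chart_continuous[OF _ that])
  let ?L = "drift_laplacian A g \<eta>" and ?i = "point_ip A g"
  have wf: "C1_chart c (\<lambda>q. w q * f q)" "C1_chart c (\<lambda>q. w q * h q)" if "c \<in> A" for c
    using that by (intro C1_chart_mult w fC hC; simp)+
  note ci = cont[OF w] cont[OF fC] cont[OF hC] continuous_drift_laplacian[OF f(1)] continuous_drift_laplacian[OF f(2)]
    continuous_point_ip[OF fC hC] continuous_point_ip[OF wf(1) hC] continuous_point_ip[OF wf(2) fC]
  have I1: "integrable m (\<lambda>p. (w p * f p) * ?L h p)"
    by (intro integrable_continuous_M continuous_on_mult ci)
  have I2: "integrable m (\<lambda>p. (w p * h p) * ?L f p)"
    by (intro integrable_continuous_M continuous_on_mult ci)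
  have I3: "integrable m (\<lambda>p. w p * ?i f h p)"
    by (intro integrable_continuous_M continuous_on_mult ci)
  have I4: "integrable m (?i (\<lambda>q. w q * f q) h)"
    by (intro integrable_continuous_M ci)
  have I5: "integrable m (?i (\<lambda>q. w q * h q) f)"
    by (intro integrable_continuous_M ci)
  note I = I1 I2 I3 I4 I5
  have e: "w p * ?L (\<lambda>q. f q * h q) p = (w p * f p) * ?L h p + (w p * h p) * ?L f p + 2 * (w p * ?i f h p)" if "p \<in> M" for p
    using drift_laplacian_mult[OF that f] by (simp add: algebra_simps)
  have "integrable m (\<lambda>p. w p * ?L (\<lambda>q. f q * h q) p) = integrable m (\<lambda>p. (w p * f p) * ?L h p + (w p * h p) * ?L f p + 2 * (w p * ?i f h p))"
    by (rule Bochner_Integration.integrable_cong) (simp_all add: e)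
  then show "integrable m (\<lambda>p. w p * ?L (\<lambda>q. f q * h q) p)"
    using I by simp
  have "(\<integral>p. w p * ?L (\<lambda>q. f q * h q) p \<partial>m) = (\<integral>p. (w p * f p) * ?L h p + (w p * h p) * ?L f p + 2 * (w p * ?i f h p) \<partial>m)"
    by (rule Bochner_Integration.integral_cong) (simp_all add: e)
  also have "\<dots> = (\<integral>p. (w p * f p) * ?L h p \<partial>m) + (\<integral>p. (w p * h p) * ?L f p \<partial>m) + 2 * (\<integral>p. w p * ?i f h p \<partial>m)"
    using I by simp
  also have "(\<integral>p. (w p * f p) * ?L h p \<partial>m) = - (\<integral>p. ?i (\<lambda>q. w q * f q) h p \<partial>m)"
    by (rule green_identity[OF f(2) wf(1)]) (use bd in simp_all)
  also have "(\<integral>p. (w p * h p) * ?L f p \<partial>m) = - (\<integral>p. ?i (\<lambda>q. w q * h q) f p \<partial>m)"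
    by (rule green_identity[OF f(1) wf(2)]) (use bd in simp_all)
  also have "- (\<integral>p. ?i (\<lambda>q. w q * f q) h p \<partial>m) + - (\<integral>p. ?i (\<lambda>q. w q * h q) f p \<partial>m) + 2 * (\<integral>p. w p * ?i f h p \<partial>m)
     = - (\<integral>p. ?i (\<lambda>q. w q * f q) h p + ?i (\<lambda>q. w q * h q) f p - 2 * (w p * ?i f h p) \<partial>m)"
    using I by simp
  also have "(\<integral>p. ?i (\<lambda>q. w q * f q) h p + ?i (\<lambda>q. w q * h q) f p - 2 * (w p * ?i f h p) \<partial>m)
     = (\<integral>p. ?i w (\<lambda>q. f q * h q) p \<partial>m)"
  proof (rule Bochner_Integration.integral_cong[OF refl])
    fix p assume "p \<in> space m"
    then have p: "p \<in> M" by simp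
    show "?i (\<lambda>q. w q * f q) h p + ?i (\<lambda>q. w q * h q) f p - 2 * (w p * ?i f h p) = ?i w (\<lambda>q. f q * h q) p"
      using point_ip_mult_left[OF p w fC, of h] point_ip_mult_left[OF p w hC, of f]
        point_ip_mult_left[OF p fC hC, of w] point_ip_sym[OF p, of h f] point_ip_sym[OF p, of w]
      by (simp add: algebra_simps)
  qed
  finally show "(\<integral>p. w p * ?L (\<lambda>q. f q * h q) p \<partial>m) = - (\<integral>p. ?i w (\<lambda>q. f q * h q) p \<partial>m)" .
qed

end

section \<open>Families differentiable in the parameter\<close>

context compact_manifold
begin

lemma compact_bounded_abs:
  assumes "continuous_on (fst c) f" "compact K" "K \<subseteq> fst c"
  shows "\<exists>B. \<forall>p\<in>K. \<bar>f p :: real\<bar> \<le> B"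
proof -
  have "bounded (f ` K)"
    using assms by (intro compact_imp_bounded compact_continuous_image) (auto intro: continuous_on_subset)
  then show ?thesis unfolding bounded_iff by simp
qed

lemma C1_chart_lip0_const:
  assumes "c \<in> A" "continuous_on (fst c) f" "compact K" "K \<subseteq> fst c"
  shows "lip0 K (\<lambda>t. f)"
proof -
  obtain B where "\<forall>p\<in>K. \<bar>f p\<bar> \<le> B" using compact_bounded_abs[OF assms(2-4)] by blast
  then show ?thesis by (intro lip0_const[of K f B]) simp
qed

lemma family_limit:
  assumes u: "differentiable_family_in_chart I c u" and I: "0 \<in> I"
  obtains u' where "smooth_in_chart c u'"
    "\<forall>is K. compact K \<longrightarrow> K \<subseteq> fst c \<longrightarrow>
            uniform_limit K (\<lambda>s p. (foldr (pd c) is (u s) p - foldr (pd c) is (u 0) p) / (s - 0))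
              (foldr (pd c) is u') (at 0)"
  using u I unfolding differentiable_family_in_chart_def by blast

lemma family_smooth: "differentiable_family_in_chart I c u \<Longrightarrow> t \<in> I \<Longrightarrow> smooth_in_chart c (u t)"
  unfolding differentiable_family_in_chart_def by blast

lemma uniform_limit_DERIV:
  assumes "uniform_limit K (\<lambda>s p. (u s p - u 0 p) / (s - 0)) u' (at (0::real))" "p \<in> K"
  shows "((\<lambda>t. u t p) has_real_derivative u' p) (at 0)"
  using tendsto_uniform_limitI[OF assms] by (simp add: has_field_derivative_iff)

text \<open>The empty word and the word \<open>[i]\<close> in the definition of a differentiable
  family supply the uniform limits for the functions and for their first derivatives.\<close>

lemma family_lip0:
  assumes c: "c \<in> A" and u: "differentiable_family_in_chart I c u" and I: "0 \<in> I"
    and K: "compact K" "K \<subseteq> fst c"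
  shows "lip0 K u" "lip0 K (\<lambda>t. pd c i (u t))"
proof -
  obtain u' where u': "smooth_in_chart c u'" "\<forall>is K. compact K \<longrightarrow> K \<subseteq> fst c \<longrightarrow>
            uniform_limit K (\<lambda>s p. (foldr (pd c) is (u s) p - foldr (pd c) is (u 0) p) / (s - 0))
              (foldr (pd c) is u') (at 0)"
    by (rule family_limit[OF u I])
  note s0 = family_smooth[OF u I]
  have 1: "uniform_limit K (\<lambda>s p. (u s p - u 0 p) / (s - 0)) u' (at 0)"
    using u'(2)[rule_format, of K "[]"] K by simp
  have 2: "uniform_limit K (\<lambda>s p. (pd c i (u s) p - pd c i (u 0) p) / (s - 0)) (pd c i u') (at 0)"
    using u'(2)[rule_format, of K "[i]"] K by simp
  obtain B where B: "\<forall>p\<in>K. \<bar>u 0 p\<bar> \<le> B"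
    using compact_bounded_abs[OF C1_chart_continuous[OF c smooth_in_chart_C1[OF c s0]] K] by blast
  obtain B' where B': "\<forall>p\<in>K. \<bar>u' p\<bar> \<le> B'"
    using compact_bounded_abs[OF C1_chart_continuous[OF c smooth_in_chart_C1[OF c u'(1)]] K] by blast
  show "lip0 K u" by (rule uniform_limit_lip0[OF 1 refl, where B=B and B'=B']) (use B B' in simp_all)
  obtain D where D: "\<forall>p\<in>K. \<bar>pd c i (u 0) p\<bar> \<le> D"
    using compact_bounded_abs[OF C1_chart_continuous[OF c C1_chart_pd[OF c s0]] K] by blast
  obtain D' where D': "\<forall>p\<in>K. \<bar>pd c i u' p\<bar> \<le> D'"
    using compact_bounded_abs[OF C1_chart_continuous[OF c C1_chart_pd[OF c u'(1)]] K] by blast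
  show "lip0 K (\<lambda>t. pd c i (u t))"
    by (rule uniform_limit_lip0[where u="\<lambda>t. pd c i (u t)", OF 2 refl, where B=D and B'=D']) (use D D' in simp_all)
qed

text \<open>On the compact set consisting of \<open>p\<close> alone, uniform convergence is ordinary
  convergence. The pointwise derivative then agrees with the smooth limit on the chart domain and
  inherits its smoothness.\<close>

lemma family_DERIV:
  assumes c: "c \<in> A" and u: "differentiable_family_in_chart I c u" and I: "0 \<in> I"
  shows "p \<in> fst c \<Longrightarrow> ((\<lambda>t. u t p) has_real_derivative deriv (\<lambda>t. u t p) 0) (at 0)"
    and "p \<in> fst c \<Longrightarrow> \<exists>D. ((\<lambda>t. pd c i (u t) p) has_real_derivative D) (at 0)"
    and "smooth_in_chart c (\<lambda>p. deriv (\<lambda>t. u t p) 0)"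
proof -
  obtain u' where u': "smooth_in_chart c u'" "\<forall>is K. compact K \<longrightarrow> K \<subseteq> fst c \<longrightarrow>
            uniform_limit K (\<lambda>s p. (foldr (pd c) is (u s) p - foldr (pd c) is (u 0) p) / (s - 0))
              (foldr (pd c) is u') (at 0)"
    by (rule family_limit[OF u I])
  have 1: "((\<lambda>t. u t p) has_real_derivative u' p) (at 0)" if "p \<in> fst c" for p
    using uniform_limit_DERIV[where K="{p}" and u=u and u'=u' and p=p] u'(2)[rule_format, of "{p}" "[]"] that by simp
  then have d: "deriv (\<lambda>t. u t p) 0 = u' p" if "p \<in> fst c" for p
    using DERIV_imp_deriv that by blast
  show "p \<in> fst c \<Longrightarrow> ((\<lambda>t. u t p) has_real_derivative deriv (\<lambda>t. u t p) 0) (at 0)"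
    using 1 d by simp
  have "((\<lambda>t. pd c i (u t) p) has_real_derivative pd c i u' p) (at 0)" if "p \<in> fst c"
    using uniform_limit_DERIV[where K="{p}" and u="\<lambda>t. pd c i (u t)" and u'="pd c i u'" and p=p] u'(2)[rule_format, of "{p}" "[i]"] that by simp
  then show "p \<in> fst c \<Longrightarrow> \<exists>D. ((\<lambda>t. pd c i (u t) p) has_real_derivative D) (at 0)" by blast
  have "(u' \<circ> chart_inv c) x = ((\<lambda>p. deriv (\<lambda>t. u t p) 0) \<circ> chart_inv c) x" if "x \<in> chart_image c" for x
    using d chart_inv_in[OF c that] by simp
  then show "smooth_in_chart c (\<lambda>p. deriv (\<lambda>t. u t p) 0)"
    using u'(1) unfolding smooth_in_chart_def smooth_on_def by (metis (no_types, lifting) IntE)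
qed

end

section \<open>Variation of the eigenvalues\<close>

locale metric_weight_variation = compact_manifold M A
  for M :: "'a::{second_countable_topology, t2_space} set" and A :: "('a, 'n::finite) chart set" +
  fixes I :: "real set" and g :: "real \<Rightarrow> ('a, 'n) tensor2" and \<eta> :: "real \<Rightarrow> 'a \<Rightarrow> real"
  assumes open_I: "open I" and zero_I: "0 \<in> I"
    and variation: "metric_variation I A g" and eta_family: "differentiable_family I A \<eta>"
begin

lemma weighted_compact_manifold_at: "t \<in> I \<Longrightarrow> weighted_compact_manifold M A (g t) (\<eta> t)"
proof unfold_locales
  assume t: "t \<in> I"
  show "riemannian_metric A (g t)" using variation t by (simp add: metric_variation_def)
  show "smooth_fun A (\<eta> t)"
    using eta_family t family_smooth unfolding differentiable_family_def smooth_fun_def by blast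
qed

sublocale W0: weighted_compact_manifold M A "g 0" "\<eta> 0"
  by (rule weighted_compact_manifold_at[OF zero_I])

lemma two_weights_at: "t \<in> I \<Longrightarrow> two_weights M A (g 0) (\<eta> 0) (g t) (\<eta> t)"
  using weighted_compact_manifold_at W0.weighted_compact_manifold_axioms by (simp add: two_weights_def)

lemma eventually_I: "\<forall>\<^sub>F t in nhds 0. t \<in> I"
  using open_I zero_I by (rule eventually_nhds_in_open)

lemma metric_family: "c \<in> A \<Longrightarrow> differentiable_family_in_chart I c (\<lambda>t p. g t c p $ i $ j)"
  using variation by (simp add: metric_variation_def)

lemma eta_family_in_chart: "c \<in> A \<Longrightarrow> differentiable_family_in_chart I c \<eta>"
  using eta_family by (simp add: differentiable_family_def)

abbreviation "H \<equiv> metric_derivative g"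
abbreviation "\<eta>' \<equiv> \<lambda>p. deriv (\<lambda>t. \<eta> t p) 0"

lemma eta'_C1: "c \<in> A \<Longrightarrow> C1_chart c \<eta>'"
  by (rule smooth_in_chart_C1) (auto intro: family_DERIV(3) eta_family_in_chart zero_I)

lemma metric_DERIV:
  "c \<in> A \<Longrightarrow> p \<in> fst c \<Longrightarrow> ((\<lambda>t. g t c p $ i $ j) has_real_derivative H c p $ i $ j) (at 0)"
  using family_DERIV(1)[OF _ metric_family zero_I] by (simp add: metric_derivative_def)

lemma det_metric_pos_at: "t \<in> I \<Longrightarrow> c \<in> A \<Longrightarrow> p \<in> fst c \<Longrightarrow> 0 < det (g t c p)"
  using weighted_compact_manifold_at[of t] riemannian_compact_manifold.det_metric_pos
  unfolding weighted_compact_manifold_def by blast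

lemma H_symmetric:
  assumes "c \<in> A" "p \<in> fst c"
  shows "H c p $ i $ j = H c p $ j $ i"
proof -
  have sym: "g t c p $ i $ j = g t c p $ j $ i" if "t \<in> I" for t
  proof -
    interpret W: weighted_compact_manifold M A "g t" "\<eta> t" by (rule weighted_compact_manifold_at[OF that])
    show ?thesis using arg_cong[OF W.metric_symmetric[OF assms], of "\<lambda>m. m $ j $ i"] by (simp add: transpose_def)
  qed
  have "((\<lambda>t. g t c p $ i $ j) has_real_derivative H c p $ j $ i) (at 0)"
    by (rule has_field_derivative_transform_within_open[OF metric_DERIV[OF assms, of j i] open_I zero_I])
      (simp add: sym)
  then show ?thesis using metric_DERIV[OF assms] DERIV_unique by blast
qed

text \<open>The density of dm_t with respect to dm_0.\<close>

definition \<theta> :: "real \<Rightarrow> 'a \<Rightarrow> real" where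
  "\<theta> t = weight_ratio A (g 0) (\<eta> 0) (g t) (\<eta> t)"

definition \<theta>' :: "'a \<Rightarrow> real" where
  "\<theta>' p = 1/2 * (\<Sum>i\<in>UNIV. \<Sum>j\<in>UNIV. matrix_inv (g 0 (chart_at A p) p) $ j $ i * H (chart_at A p) p $ i $ j) - \<eta>' p"

lemma \<theta>_0: "p \<in> M \<Longrightarrow> \<theta> 0 p = 1"
  unfolding \<theta>_def weight_ratio_def using W0.chart_weight_pos[OF chart_at] by force

lemma \<theta>_DERIV:
  assumes p: "p \<in> M"
  shows "((\<lambda>t. \<theta> t p) has_real_derivative \<theta>' p) (at 0)"
proof -
  define c where "c = chart_at A p"
  have c: "c \<in> A" "p \<in> fst c" using chart_at[OF p] by (simp_all add: c_def)
  define X where "X = (\<Sum>i\<in>UNIV. \<Sum>j\<in>UNIV. matrix_inv (g 0 c p) $ j $ i * H c p $ i $ j)"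
  let ?d = "det (g 0 c p)"
  have d: "0 < ?d" using det_metric_pos_at[OF zero_I c] .
  have 1: "((\<lambda>t. det (g t c p)) has_real_derivative ?d * X) (at 0)"
    unfolding X_def by (rule has_real_derivative_det) (use metric_DERIV[OF c] d in auto)
  have 2: "((\<lambda>t. \<eta> t p) has_real_derivative \<eta>' p) (at 0)"
    by (rule family_DERIV(1)[OF c(1) eta_family_in_chart[OF c(1)] zero_I c(2)])
  note 3 = DERIV_chain2[OF DERIV_real_sqrt[OF d] 1] and 4 = DERIV_chain2[OF DERIV_exp DERIV_minus[OF 2]]
  have "((\<lambda>t. sqrt (det (g t c p)) * exp (- \<eta> t p) / chart_weight (g 0) (\<eta> 0) c p) has_real_derivative
      ((inverse (sqrt ?d) / 2 * (?d * X)) * exp (- \<eta> 0 p) + (exp (- \<eta> 0 p) * (- \<eta>' p)) * sqrt ?d) / chart_weight (g 0) (\<eta> 0) c p) (at 0)"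
    by (rule DERIV_cdivide[OF DERIV_mult[OF 3 4]])
  moreover have "((inverse (sqrt ?d) / 2 * (?d * X)) * exp (- \<eta> 0 p) + (exp (- \<eta> 0 p) * (- \<eta>' p)) * sqrt ?d) / chart_weight (g 0) (\<eta> 0) c p
     = 1/2 * X - \<eta>' p"
  proof -
    have "inverse (sqrt ?d) * ?d = sqrt ?d"
      using d by (simp add: divide_inverse[symmetric] mult.commute real_div_sqrt)
    then have "inverse (sqrt ?d) / 2 * (?d * X) = sqrt ?d * (X / 2)" by (simp add: mult.assoc[symmetric])
    then show ?thesis using d by (simp add: chart_weight_def field_simps)
  qed
  ultimately show ?thesis
    by (simp add: \<theta>_def weight_ratio_def[abs_def] chart_weight_def \<theta>'_def c_def[symmetric] X_def)
qed

lemma metric_inverse_DERIV: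
  assumes "c \<in> A" "p \<in> fst c"
  shows "((\<lambda>t. matrix_inv (g t c p) $ i $ j) has_real_derivative
    - (\<Sum>a\<in>UNIV. \<Sum>b\<in>UNIV. matrix_inv (g 0 c p) $ i $ a * H c p $ a $ b * matrix_inv (g 0 c p) $ b $ j)) (at 0)"
  by (rule has_real_derivative_matrix_inv[OF metric_DERIV[OF assms] open_I zero_I])
    (use det_metric_pos_at[OF _ assms] in force)

lemma det_metric_bound:
  assumes c: "c \<in> A" and K: "compact K" "K \<subseteq> fst c"
  obtains \<epsilon> where "\<epsilon> > 0" "\<forall>p\<in>K. \<epsilon> \<le> det (g 0 c p)"
proof (cases "K = {}")
  case True
  then show ?thesis using that[of 1] by simp
next
  case False
  have dC: "C1_chart c (\<lambda>q. det (g 0 c q))"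
    unfolding C1_chart_def
    by (rule C1_det[OF hs_open_chart_image[OF c]]) (use W0.metric_C1[OF c] in \<open>simp add: C1_chart_def\<close>)
  have "continuous_on K (\<lambda>q. det (g 0 c q))"
    using C1_chart_continuous[OF c dC] K continuous_on_subset by blast
  then obtain p where p: "p \<in> K" "\<forall>q\<in>K. det (g 0 c p) \<le> det (g 0 c q)"
    using continuous_attains_inf[OF K(1) False] by blast
  then show ?thesis using det_metric_pos_at[OF zero_I c, of p] K by (intro that[of "det (g 0 c p)"]) auto
qed

lemma metric_lip0:
  assumes "c \<in> A" "compact K" "K \<subseteq> fst c"
  shows "lip0 K (\<lambda>t p. g t c p $ i $ j)"
  using family_lip0(1)[OF assms(1) metric_family[OF assms(1)] zero_I assms(2,3)] .

lemma metric_inverse_lip0: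
  assumes K: "c \<in> A" "compact K" "K \<subseteq> fst c"
  shows "lip0 K (\<lambda>t p. matrix_inv (g t c p) $ i $ j)"
proof -
  obtain \<epsilon> where "\<epsilon> > 0" "\<forall>p\<in>K. \<epsilon> \<le> det (g 0 c p)" by (rule det_metric_bound[OF K])
  then show ?thesis by (intro lip0_matrix_inv[OF metric_lip0[OF K], of \<epsilon>]) simp_all
qed

lemma \<theta>_lip0:
  assumes K: "c \<in> A" "compact K" "K \<subseteq> fst c"
  shows "lip0 K \<theta>"
proof (rule lip0_cong)
  obtain \<epsilon> where e: "\<epsilon> > 0" "\<forall>p\<in>K. \<epsilon> \<le> det (g 0 c p)" by (rule det_metric_bound[OF K])
  have "lip0 K (\<lambda>t p. sqrt (det (g t c p)))"
    by (rule lip0_sqrt[OF lip0_det[OF metric_lip0[OF K]], of \<epsilon>]) (use e in simp_all)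
  moreover have "lip0 K (\<lambda>t p. exp (- \<eta> t p))"
    by (intro lip0_exp lip0_minus family_lip0(1)[OF K(1) eta_family_in_chart[OF K(1)] zero_I K(2,3)])
  moreover have "lip0 K (\<lambda>t p. inverse (chart_weight (g 0) (\<eta> 0) c p))"
  proof (rule C1_chart_lip0_const[OF K(1) _ K(2,3)])
    show "continuous_on (fst c) (\<lambda>p. inverse (chart_weight (g 0) (\<eta> 0) c p))"
      by (rule continuous_on_inverse[OF C1_chart_continuous[OF K(1) W0.chart_weight_C1[OF K(1)]]])
        (use W0.chart_weight_pos[OF K(1)] in force)
  qed
  ultimately show "lip0 K (\<lambda>t p. sqrt (det (g t c p)) * exp (- \<eta> t p) * inverse (chart_weight (g 0) (\<eta> 0) c p))"
    by (intro lip0_mult)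
  show "\<forall>\<^sub>F t in nhds 0. \<forall>p\<in>K. \<theta> t p = sqrt (det (g t c p)) * exp (- \<eta> t p) * inverse (chart_weight (g 0) (\<eta> 0) c p)"
    using eventually_I
  proof eventually_elim
    case (elim t)
    show ?case
    proof
      fix p assume "p \<in> K"
      then have p: "p \<in> fst c" using K by blast
      show "\<theta> t p = sqrt (det (g t c p)) * exp (- \<eta> t p) * inverse (chart_weight (g 0) (\<eta> 0) c p)"
        unfolding \<theta>_def two_weights.weight_ratio_eq[OF two_weights_at[OF elim] K(1) p]
        by (simp add: chart_weight_def divide_inverse)
    qed
  qed
qed

lemma family_C1:
  assumes "differentiable_family I A u" "t \<in> I"
  shows "smooth_fun A (u t)" "c \<in> A \<Longrightarrow> C1_chart c (u t)"
proof -
  show s: "smooth_fun A (u t)"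
    using assms family_smooth unfolding differentiable_family_def smooth_fun_def by blast
  show "c \<in> A \<Longrightarrow> C1_chart c (u t)" using W0.smooth_fun_C1(1)[OF s] .
qed

text \<open>The family \<open>h\<close> is left open so that both the moving metric and the metric
  frozen at t = 0 are covered.\<close>

lemma chart_ip_lip0:
  assumes K: "c \<in> A" "compact K" "K \<subseteq> fst c" and u: "differentiable_family I A u" and v: "C1_chart c v"
    and G: "\<And>i j. lip0 K (\<lambda>t p. matrix_inv (h t c p) $ i $ j)"
  shows "lip0 K (\<lambda>t. chart_ip (h t) c (u t) v)"
proof -
  have uc: "differentiable_family_in_chart I c u" using u K(1) by (simp add: differentiable_family_def)
  have "lip0 K (\<lambda>t p. \<Sum>i\<in>UNIV. \<Sum>j\<in>UNIV. matrix_inv (h t c p) $ i $ j * pd c i (u t) p * pd c j v p)"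
    by (intro lip0_sum lip0_mult G family_lip0(2)[OF K(1) uc zero_I K(2,3)]
        C1_chart_lip0_const[OF K(1) C1_chart_continuous_pd[OF K(1) v] K(2,3)])
  then show ?thesis by (simp add: chart_ip_def[abs_def] inner_matrix_mult_sum chart_diff_def)
qed

lemma point_ip_lip0:
  assumes K: "c \<in> A" "compact K" "K \<subseteq> fst c" and u: "differentiable_family I A u"
    and v: "\<And>c. c \<in> A \<Longrightarrow> C1_chart c v"
  shows "lip0 K (\<lambda>t. point_ip A (g t) (u t) v)" "lip0 K (\<lambda>t. point_ip A (g 0) (u t) v)"
proof -
  have eq: "point_ip A (g s) (u t) v p = chart_ip (g s) c (u t) v p" if "s \<in> I" "t \<in> I" "p \<in> K" for s t p
  proof -
    interpret W: weighted_compact_manifold M A "g s" "\<eta> s" by (rule weighted_compact_manifold_at[OF that(1)])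
    show ?thesis using W.point_ip_eq_chart_ip[OF K(1) _ family_C1(2)[OF u that(2) K(1)] v[OF K(1)]] that K by blast
  qed
  show "lip0 K (\<lambda>t. point_ip A (g t) (u t) v)"
  proof (rule lip0_cong)
    show "lip0 K (\<lambda>t. chart_ip (g t) c (u t) v)" by (rule chart_ip_lip0[where h=g, OF K u v[OF K(1)] metric_inverse_lip0[OF K]])
    show "\<forall>\<^sub>F t in nhds 0. \<forall>p\<in>K. point_ip A (g t) (u t) v p = chart_ip (g t) c (u t) v p"
      using eventually_I by eventually_elim (simp add: eq)
  qed
  show "lip0 K (\<lambda>t. point_ip A (g 0) (u t) v)"
  proof (rule lip0_cong)
    show "lip0 K (\<lambda>t. chart_ip (g 0) c (u t) v)"
      by (rule chart_ip_lip0[where h="\<lambda>_. g 0", OF K u v[OF K(1)]])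
        (rule C1_chart_lip0_const[OF K(1) C1_chart_continuous[OF K(1) W0.metric_inverse_C1[OF K(1)]] K(2,3)])
    show "\<forall>\<^sub>F t in nhds 0. \<forall>p\<in>K. point_ip A (g 0) (u t) v p = chart_ip (g 0) c (u t) v p"
      using eventually_I by eventually_elim (simp add: eq zero_I)
  qed
qed

text \<open>The value of H on the gradients of \<open>u\<close> and \<open>v\<close>. The bracket is
  minus the derivative at t = 0 of the inverse metric, the form in which it arises.\<close>

definition H_grad :: "('a \<Rightarrow> real) \<Rightarrow> ('a \<Rightarrow> real) \<Rightarrow> 'a \<Rightarrow> real" where
  "H_grad u v p = (let c = chart_at A p; G = matrix_inv (g 0 c p) in
     \<Sum>i\<in>UNIV. \<Sum>j\<in>UNIV. (\<Sum>a\<in>UNIV. \<Sum>b\<in>UNIV. G $ i $ a * H c p $ a $ b * G $ b $ j) * pd c i u p * pd c j v p)"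

lemma metric_inverse_sym0:
  assumes "c \<in> A" "p \<in> fst c"
  shows "matrix_inv (g 0 c p) $ i $ j = matrix_inv (g 0 c p) $ j $ i"
  using arg_cong[OF W0.metric_inverse_symmetric[OF assms], of "\<lambda>m. m $ j $ i"] by (simp add: transpose_def)

lemma H_grad_sym:
  assumes p: "p \<in> M"
  shows "H_grad u v p = H_grad v u p"
proof -
  define c where "c = chart_at A p"
  have c: "c \<in> A" "p \<in> fst c" using chart_at[OF p] by (simp_all add: c_def)
  let ?G = "matrix_inv (g 0 c p)"
  have B: "(\<Sum>a\<in>UNIV. \<Sum>b\<in>UNIV. ?G $ i $ a * H c p $ a $ b * ?G $ b $ j)
      = (\<Sum>a\<in>UNIV. \<Sum>b\<in>UNIV. ?G $ j $ a * H c p $ a $ b * ?G $ b $ i)" for i j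
  proof -
    have "(\<Sum>a\<in>UNIV. \<Sum>b\<in>UNIV. ?G $ i $ a * H c p $ a $ b * ?G $ b $ j)
       = (\<Sum>b\<in>UNIV. \<Sum>a\<in>UNIV. ?G $ i $ a * H c p $ a $ b * ?G $ b $ j)" by (rule sum.swap)
    also have "\<dots> = (\<Sum>a\<in>UNIV. \<Sum>b\<in>UNIV. ?G $ j $ a * H c p $ a $ b * ?G $ b $ i)"
    proof (intro sum.cong refl)
      fix b a
      show "?G $ i $ a * H c p $ a $ b * ?G $ b $ j = ?G $ j $ b * H c p $ b $ a * ?G $ a $ i"
        using metric_inverse_sym0[OF c, of i a] metric_inverse_sym0[OF c, of b j] H_symmetric[OF c, of a b] by simp
    qed
    finally show ?thesis .
  qed
  have "H_grad u v p = (\<Sum>j\<in>UNIV. \<Sum>i\<in>UNIV. (\<Sum>a\<in>UNIV. \<Sum>b\<in>UNIV. ?G $ i $ a * H c p $ a $ b * ?G $ b $ j) * pd c i u p * pd c j v p)"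
    unfolding H_grad_def Let_def c_def[symmetric] by (rule sum.swap)
  also have "\<dots> = (\<Sum>j\<in>UNIV. \<Sum>i\<in>UNIV. (\<Sum>a\<in>UNIV. \<Sum>b\<in>UNIV. ?G $ j $ a * H c p $ a $ b * ?G $ b $ i) * pd c j v p * pd c i u p)"
  proof (intro sum.cong refl)
    fix j i
    show "(\<Sum>a\<in>UNIV. \<Sum>b\<in>UNIV. ?G $ i $ a * H c p $ a $ b * ?G $ b $ j) * pd c i u p * pd c j v p
      = (\<Sum>a\<in>UNIV. \<Sum>b\<in>UNIV. ?G $ j $ a * H c p $ a $ b * ?G $ b $ i) * pd c j v p * pd c i u p"
      unfolding B[of i j] by simp
  qed
  finally show ?thesis unfolding H_grad_def Let_def c_def[symmetric] .
qed

text \<open>The derivatives \<open>D i\<close> of the coordinate derivatives of u_t occur in both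
  inner products and cancel because \<open>\<theta> 0 p = 1\<close>; only the variations of density
  and metric remain.\<close>

lemma point_ip_DERIV:
  assumes p: "p \<in> M" and u: "differentiable_family I A u"
  shows "((\<lambda>t. \<theta> t p * point_ip A (g t) (u t) v p - point_ip A (g 0) (u t) v p) has_real_derivative
    \<theta>' p * point_ip A (g 0) (u 0) v p - H_grad (u 0) v p) (at 0)"
proof -
  define c where "c = chart_at A p"
  have c: "c \<in> A" "p \<in> fst c" using chart_at[OF p] by (simp_all add: c_def)
  let ?G = "matrix_inv (g 0 c p)"
  let ?B = "\<lambda>i j. \<Sum>a\<in>UNIV. \<Sum>b\<in>UNIV. ?G $ i $ a * H c p $ a $ b * ?G $ b $ j"
  have uc: "differentiable_family_in_chart I c u" using u c(1) by (simp add: differentiable_family_def)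
  obtain D where D: "\<And>i. ((\<lambda>t. pd c i (u t) p) has_real_derivative D i) (at 0)"
    using family_DERIV(2)[OF c(1) uc zero_I c(2)] by metis
  have ip: "point_ip A (g s) (u t) v p = (\<Sum>i\<in>UNIV. \<Sum>j\<in>UNIV. matrix_inv (g s c p) $ i $ j * pd c i (u t) p * pd c j v p)" for s t
    by (simp add: point_ip_def c_def[symmetric] chart_ip_def inner_matrix_mult_sum chart_diff_def)
  have 1: "((\<lambda>t. point_ip A (g t) (u t) v p) has_real_derivative
     (\<Sum>i\<in>UNIV. \<Sum>j\<in>UNIV. (- ?B i j * pd c i (u 0) p + D i * ?G $ i $ j) * pd c j v p)) (at 0)"
    unfolding ip by (intro DERIV_sum DERIV_cmult_right DERIV_mult metric_inverse_DERIV[OF c] D)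
  have 2: "((\<lambda>t. point_ip A (g 0) (u t) v p) has_real_derivative
     (\<Sum>i\<in>UNIV. \<Sum>j\<in>UNIV. ?G $ i $ j * D i * pd c j v p)) (at 0)"
    unfolding ip by (intro DERIV_sum DERIV_cmult_right DERIV_cmult D)
  have "((\<lambda>t. \<theta> t p * point_ip A (g t) (u t) v p - point_ip A (g 0) (u t) v p) has_real_derivative
     \<theta>' p * point_ip A (g 0) (u 0) v p
      + (\<Sum>i\<in>UNIV. \<Sum>j\<in>UNIV. (- ?B i j * pd c i (u 0) p + D i * ?G $ i $ j) * pd c j v p) * \<theta> 0 p
      - (\<Sum>i\<in>UNIV. \<Sum>j\<in>UNIV. ?G $ i $ j * D i * pd c j v p)) (at 0)"
    by (intro DERIV_diff DERIV_mult \<theta>_DERIV[OF p] 1 2)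
  moreover have "(\<Sum>i\<in>UNIV. \<Sum>j\<in>UNIV. (- ?B i j * pd c i (u 0) p + D i * ?G $ i $ j) * pd c j v p)
     = (\<Sum>i\<in>UNIV. \<Sum>j\<in>UNIV. ?G $ i $ j * D i * pd c j v p) - H_grad (u 0) v p"
  proof -
    have e: "(- b * x + d * G) * y = G * d * y - b * x * y" for b x d G y :: real by (simp add: algebra_simps)
    show ?thesis
      unfolding H_grad_def Let_def c_def[symmetric] sum_subtractf[symmetric]
      by (intro sum.cong refl) (rule e)
  qed
  ultimately show ?thesis by (simp add: \<theta>_0[OF p])
qed

lemma continuous_C1:
  assumes "\<And>c. c \<in> A \<Longrightarrow> C1_chart c f"
  shows "continuous_on M f"
  by (rule continuous_on_M) (rule C1_chart_continuous[OF _ assms])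

lemma continuous_\<theta>: "t \<in> I \<Longrightarrow> continuous_on M (\<theta> t)"
  unfolding \<theta>_def by (rule two_weights.continuous_weight_ratio[OF two_weights_at])

text \<open>The integrand in the formula for the derivative of the eigenvalue, with the common
  eigenvalue as \<mu>.\<close>

definition variation_density :: "real \<Rightarrow> ('a \<Rightarrow> real) \<Rightarrow> ('a \<Rightarrow> real) \<Rightarrow> 'a \<Rightarrow> real" where
  "variation_density \<mu> u v p = \<theta>' p * (point_ip A (g 0) u v p - \<mu> * (u p * v p)) - H_grad u v p"

text \<open>The proof differentiates
  \<open>a\<^sub>t(u\<^sub>t, v\<^sub>0) - a\<^sub>0(u\<^sub>t, v\<^sub>0) = (\<lambda>(t) - \<lambda>(0)) b\<^sub>t(u\<^sub>t, v\<^sub>0) + \<lambda>(0) (b\<^sub>t(u\<^sub>t, v\<^sub>0) - b\<^sub>0(u\<^sub>t, v\<^sub>0))\<close>.\<close>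

lemma eigenvalue_derivative:
  assumes u: "differentiable_family I A u" and v: "smooth_fun A v"
    and eu: "\<And>t p. t \<in> I \<Longrightarrow> p \<in> M \<Longrightarrow> - drift_laplacian A (g t) (\<eta> t) (u t) p = l t * u t p"
    and ev: "\<And>p. p \<in> M \<Longrightarrow> - drift_laplacian A (g 0) (\<eta> 0) v p = l 0 * v p"
    and bu: "\<And>t p. t \<in> I \<Longrightarrow> p \<in> manifold_boundary A \<Longrightarrow> u t p = 0"
    and bv: "\<And>p. p \<in> manifold_boundary A \<Longrightarrow> v p = 0"
    and l: "(l has_real_derivative l') (at 0)"
  shows "integrable W0.m (variation_density (l 0) (u 0) v)"
    and "(\<integral>p. variation_density (l 0) (u 0) v p \<partial>W0.m) = l' * (\<integral>p. u 0 p * v p \<partial>W0.m)"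
proof -
  note vC = W0.smooth_fun_C1(1)[OF v]
  have cv: "continuous_on M v" by (rule continuous_C1[OF vC])
  have cu: "continuous_on M (u t)" if "t \<in> I" for t by (rule continuous_C1[OF family_C1(2)[OF u that]])
  have cip: "continuous_on M (point_ip A (g s) (u t) v)" if "s \<in> I" "t \<in> I" for s t
  proof -
    interpret W: weighted_compact_manifold M A "g s" "\<eta> s" by (rule weighted_compact_manifold_at[OF that(1)])
    show ?thesis by (rule W.continuous_point_ip[OF family_C1(2)[OF u that(2)] vC])
  qed
  \<comment> \<open>The integrands, all over dm_0, of a_t - a_0 (\<open>Z\<close>), of b_t - b_0
    (\<open>Y\<close>) and of b_t (\<open>X\<close>), each at the pair u_t, v.\<close>
  define Z where "Z t p = \<theta> t p * point_ip A (g t) (u t) v p - point_ip A (g 0) (u t) v p" for t p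
  define Y where "Y t p = (\<theta> t p - 1) * u t p * v p" for t p
  define X where "X t p = \<theta> t p * u t p * v p" for t p
  have green_t: "(\<integral>p. \<theta> t p * point_ip A (g t) (u t) v p \<partial>W0.m) = l t * (\<integral>p. X t p \<partial>W0.m)" if t: "t \<in> I" for t
  proof -
    interpret W: weighted_compact_manifold M A "g t" "\<eta> t" by (rule weighted_compact_manifold_at[OF t])
    interpret T: two_weights M A "g 0" "\<eta> 0" "g t" "\<eta> t" by (rule two_weights_at[OF t])
    have "(\<integral>p. \<theta> t p * point_ip A (g t) (u t) v p \<partial>W0.m) = (\<integral>p. point_ip A (g t) (u t) v p \<partial>W.m)"
      unfolding \<theta>_def by (rule T.integral_change_weight[symmetric, OF cip[OF t t]])
    \<comment> \<open>Green's identity takes the test function on the left, and here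
      \<open>v\<close> is tested against the eigenvalue equation of u_t for the metric at time
      t.\<close>
    also have "\<dots> = (\<integral>p. point_ip A (g t) v (u t) p \<partial>W.m)"
      by (rule Bochner_Integration.integral_cong) (simp_all add: W.point_ip_sym[of _ v])
    also have "\<dots> = - (\<integral>p. v p * drift_laplacian A (g t) (\<eta> t) (u t) p \<partial>W.m)"
      using W.green_identity[OF family_C1(1)[OF u t] vC bv] by simp
    also have "\<dots> = (\<integral>p. l t * (u t p * v p) \<partial>W.m)"
      unfolding Bochner_Integration.integral_minus[symmetric]
    proof (rule Bochner_Integration.integral_cong[OF refl])
      fix p assume "p \<in> space W.m"
      then show "- (v p * drift_laplacian A (g t) (\<eta> t) (u t) p) = l t * (u t p * v p)"
        using eu[OF t, of p] by (metis W0.space_m W.space_m minus_mult_right mult.left_commute mult.commute)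
    qed
    also have "\<dots> = l t * (\<integral>p. u t p * v p \<partial>W.m)" by simp
    also have "(\<integral>p. u t p * v p \<partial>W.m) = (\<integral>p. X t p \<partial>W0.m)"
      unfolding X_def \<theta>_def mult.assoc
      by (rule T.integral_change_weight) (intro continuous_on_mult cu[OF t] cv)
    finally show ?thesis .
  qed
  have green_0: "(\<integral>p. point_ip A (g 0) (u t) v p \<partial>W0.m) = l 0 * (\<integral>p. u t p * v p \<partial>W0.m)" if t: "t \<in> I" for t
  proof -
    \<comment> \<open>The roles are reversed: \<open>v\<close> satisfies the eigenvalue equation at
      time 0, and u_t, for every t, is merely a test function vanishing on the boundary.\<close>
    have "(\<integral>p. point_ip A (g 0) (u t) v p \<partial>W0.m) = - (\<integral>p. u t p * drift_laplacian A (g 0) (\<eta> 0) v p \<partial>W0.m)"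
      using W0.green_identity[OF v family_C1(2)[OF u t] bu[OF t]] by simp
    also have "\<dots> = (\<integral>p. l 0 * (u t p * v p) \<partial>W0.m)"
      unfolding Bochner_Integration.integral_minus[symmetric]
    proof (rule Bochner_Integration.integral_cong[OF refl])
      fix p assume "p \<in> space W0.m"
      then show "- (u t p * drift_laplacian A (g 0) (\<eta> 0) v p) = l 0 * (u t p * v p)"
        using ev[of p] by (metis W0.space_m minus_mult_right mult.left_commute)
    qed
    finally show ?thesis by simp
  qed
  have cX: "continuous_on M (X t)" and cY: "continuous_on M (Y t)" and cZ: "continuous_on M (Z t)" if "t \<in> I" for t
    unfolding X_def[abs_def] Y_def[abs_def] Z_def[abs_def]
    by (intro continuous_intros continuous_\<theta> cu cv cip that zero_I)+
  have eq: "(\<integral>p. Z t p \<partial>W0.m) = (l t - l 0) * (\<integral>p. X t p \<partial>W0.m) + l 0 * (\<integral>p. Y t p \<partial>W0.m)" if t: "t \<in> I" for t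
  proof -
    have i: "integrable W0.m (\<lambda>p. \<theta> t p * point_ip A (g t) (u t) v p)" "integrable W0.m (point_ip A (g 0) (u t) v)"
      "integrable W0.m (X t)" "integrable W0.m (\<lambda>p. u t p * v p)"
      by (intro W0.integrable_continuous_M continuous_on_mult continuous_\<theta> cip cX cu cv t zero_I)+
    have a: "(\<integral>p. Z t p \<partial>W0.m) = l t * (\<integral>p. X t p \<partial>W0.m) - l 0 * (\<integral>p. u t p * v p \<partial>W0.m)"
      unfolding Z_def using i green_t[OF t] green_0[OF t] by simp
    have b: "(\<integral>p. Y t p \<partial>W0.m) = (\<integral>p. X t p \<partial>W0.m) - (\<integral>p. u t p * v p \<partial>W0.m)"
    proof -
      have "integrable W0.m (\<lambda>p. \<theta> t p * (u t p * v p))"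
        using i(3) by (simp add: X_def[abs_def] mult.assoc)
      then show ?thesis using i(4) by (simp add: Y_def X_def left_diff_distrib mult.assoc)
    qed
    show ?thesis unfolding a b by (simp add: algebra_simps)
  qed
  have uK: "lip0 K u" if "c \<in> A" "compact K" "K \<subseteq> fst c" for c K
    using family_lip0(1)[OF that(1) _ zero_I that(2,3), of u] u that(1) by (simp add: differentiable_family_def)
  have vK: "lip0 K (\<lambda>t. v)" if "c \<in> A" "compact K" "K \<subseteq> fst c" for c K
    by (rule C1_chart_lip0_const[OF that(1) C1_chart_continuous[OF that(1) vC[OF that(1)]] that(2,3)])
  have lX: "lip0 M X"
    unfolding X_def[abs_def] by (rule lip0_M) (intro lip0_mult \<theta>_lip0 uK vK; assumption)
  have lY: "lip0 M Y"
  proof (rule lip0_M)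
    fix c K assume K: "c \<in> A" "compact K" "K \<subseteq> fst c"
    have "lip0 K (\<lambda>t p. (\<theta> t p + - 1) * u t p * v p)"
      by (intro lip0_mult lip0_add \<theta>_lip0[OF K] uK[OF K] vK[OF K] lip0_const[of K "\<lambda>_. - 1" 1]) simp
    then show "lip0 K Y" by (simp add: Y_def[abs_def])
  qed
  have lZ: "lip0 M Z"
  proof (rule lip0_M)
    fix c K assume K: "c \<in> A" "compact K" "K \<subseteq> fst c"
    have "lip0 K (\<lambda>t p. \<theta> t p * point_ip A (g t) (u t) v p + - point_ip A (g 0) (u t) v p)"
      by (intro lip0_add lip0_mult lip0_minus \<theta>_lip0[OF K] point_ip_lip0[OF K u vC])
    then show "lip0 K Z" by (simp add: Z_def[abs_def])
  qed
  have uD: "((\<lambda>t. u t p) has_real_derivative deriv (\<lambda>t. u t p) 0) (at 0)" if p: "p \<in> M" for p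
    using family_DERIV(1)[OF chart_at(1)[OF p] _ zero_I chart_at(2)[OF p], of u] u chart_at(1)[OF p]
    by (simp add: differentiable_family_def)
  have ev: "\<forall>\<^sub>F t in nhds 0. continuous_on M (F t)" if "\<And>t. t \<in> I \<Longrightarrow> continuous_on M (F t)" for F :: "real \<Rightarrow> 'a \<Rightarrow> real"
    using eventually_I by eventually_elim (rule that)
  define X' where "X' p = (\<theta>' p * u 0 p + deriv (\<lambda>t. u t p) 0 * \<theta> 0 p) * v p" for p
  have dX: "((\<lambda>t. X t p) has_real_derivative X' p) (at 0)" if "p \<in> M" for p
    unfolding X_def X'_def by (intro DERIV_cmult_right DERIV_mult \<theta>_DERIV uD that)
  have dY: "((\<lambda>t. Y t p) has_real_derivative \<theta>' p * u 0 p * v p) (at 0)" if p: "p \<in> M" for p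
  proof -
    \<comment> \<open>The derivative of u_t is multiplied by \<open>\<theta> 0 p - 1\<close>, which
      is 0.\<close>
    have "((\<lambda>t. Y t p) has_real_derivative ((\<theta>' p - 0) * u 0 p + deriv (\<lambda>t. u t p) 0 * (\<theta> 0 p - 1)) * v p) (at 0)"
      unfolding Y_def by (intro DERIV_cmult_right DERIV_mult DERIV_diff DERIV_const \<theta>_DERIV uD p)
    then show ?thesis by (simp add: \<theta>_0[OF p])
  qed
  have dZ: "((\<lambda>t. Z t p) has_real_derivative \<theta>' p * point_ip A (g 0) (u 0) v p - H_grad (u 0) v p) (at 0)" if "p \<in> M" for p
    unfolding Z_def by (rule point_ip_DERIV[OF that u])
  have evX: "\<forall>\<^sub>F t in nhds 0. continuous_on M (X t)" by (rule ev) (rule cX)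
  have evY: "\<forall>\<^sub>F t in nhds 0. continuous_on M (Y t)" by (rule ev) (rule cY)
  have evZ: "\<forall>\<^sub>F t in nhds 0. continuous_on M (Z t)" by (rule ev) (rule cZ)
  have IX: "integrable W0.m (\<lambda>p. X' p)"
    "((\<lambda>t. \<integral>p. X t p \<partial>W0.m) has_real_derivative (\<integral>p. X' p \<partial>W0.m)) (at 0)"
    by (rule W0.has_derivative_integral[OF evX lX dX]; assumption)+
  have IY: "integrable W0.m (\<lambda>p. \<theta>' p * u 0 p * v p)"
    "((\<lambda>t. \<integral>p. Y t p \<partial>W0.m) has_real_derivative (\<integral>p. \<theta>' p * u 0 p * v p \<partial>W0.m)) (at 0)"
    by (rule W0.has_derivative_integral[OF evY lY dY]; assumption)+
  have IZ: "integrable W0.m (\<lambda>p. \<theta>' p * point_ip A (g 0) (u 0) v p - H_grad (u 0) v p)"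
    "((\<lambda>t. \<integral>p. Z t p \<partial>W0.m) has_real_derivative (\<integral>p. \<theta>' p * point_ip A (g 0) (u 0) v p - H_grad (u 0) v p \<partial>W0.m)) (at 0)"
    by (rule W0.has_derivative_integral[OF evZ lZ dZ]; assumption)+
  have vd: "variation_density (l 0) (u 0) v p
     = (\<theta>' p * point_ip A (g 0) (u 0) v p - H_grad (u 0) v p) - l 0 * (\<theta>' p * u 0 p * v p)" for p
    by (simp add: variation_density_def algebra_simps)
  show "integrable W0.m (variation_density (l 0) (u 0) v)"
    unfolding vd[abs_def] by (intro Bochner_Integration.integrable_diff[OF IZ(1)] integrable_mult_right IY(1))
  \<comment> \<open>The factor \<open>l t - l 0\<close> vanishes at 0, so the integral of
    \<open>X'\<close>, with its derivative of u_t, drops out. Comparison with the derivative of the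
    integral of \<open>Z\<close> then gives the formula.\<close>
  have "((\<lambda>t. (l t - l 0) * (\<integral>p. X t p \<partial>W0.m) + l 0 * (\<integral>p. Y t p \<partial>W0.m)) has_real_derivative
     ((l' - 0) * (\<integral>p. X 0 p \<partial>W0.m) + (\<integral>p. X' p \<partial>W0.m) * (l 0 - l 0)) + l 0 * (\<integral>p. \<theta>' p * u 0 p * v p \<partial>W0.m)) (at 0)"
    by (intro DERIV_add DERIV_mult DERIV_diff DERIV_const l DERIV_cmult IX(2) IY(2))
  moreover have "((\<lambda>t. (l t - l 0) * (\<integral>p. X t p \<partial>W0.m) + l 0 * (\<integral>p. Y t p \<partial>W0.m)) has_real_derivative
     (\<integral>p. \<theta>' p * point_ip A (g 0) (u 0) v p - H_grad (u 0) v p \<partial>W0.m)) (at 0)"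
    by (rule has_field_derivative_transform_within_open[OF IZ(2) open_I zero_I]) (rule eq)
  ultimately have "(\<integral>p. \<theta>' p * point_ip A (g 0) (u 0) v p - H_grad (u 0) v p \<partial>W0.m)
     = l' * (\<integral>p. X 0 p \<partial>W0.m) + l 0 * (\<integral>p. \<theta>' p * u 0 p * v p \<partial>W0.m)"
    using DERIV_unique by fastforce
  moreover have "(\<integral>p. X 0 p \<partial>W0.m) = (\<integral>p. u 0 p * v p \<partial>W0.m)"
    by (rule Bochner_Integration.integral_cong) (simp_all add: X_def \<theta>_0)
  ultimately show "(\<integral>p. variation_density (l 0) (u 0) v p \<partial>W0.m) = l' * (\<integral>p. u 0 p * v p \<partial>W0.m)"
    unfolding vd using IZ(1) IY(1) by simp
qed

text \<open>The sum \<open>\<theta>' p + \<eta>' p\<close> is half the trace of H, which is what the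
  metric part of the tensor contracts to.\<close>

lemma inner_tensor_eq:
  assumes p: "p \<in> M"
  shows "inner_tensor A (g 0) (\<lambda>c q. (1/2 * s q) *\<^sub>R g 0 c q - 2 *\<^sub>R diff_tensor_diff u v c q) H p
    = s p * (\<theta>' p + \<eta>' p) - 2 * H_grad u v p"
proof -
  define c where "c = chart_at A p"
  have c: "c \<in> A" "p \<in> fst c" using chart_at[OF p] by (simp_all add: c_def)
  let ?G = "matrix_inv (g 0 c p)"
  have d: "det (g 0 c p) \<noteq> 0" using det_metric_pos_at[OF zero_I c] by simp
  have "inner_tensor A (g 0) (\<lambda>c q. (1/2 * s q) *\<^sub>R g 0 c q - 2 *\<^sub>R diff_tensor_diff u v c q) H p
    = (\<Sum>i\<in>UNIV. \<Sum>j\<in>UNIV. \<Sum>k\<in>UNIV. \<Sum>l\<in>UNIV. ?G $ i $ k * ?G $ j $ l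
        * ((1/2 * s p) * g 0 c p $ i $ j - 2 * (pd c i u p * pd c j v p)) * H c p $ k $ l)"
    by (simp add: inner_tensor_def Let_def metric_inverse_def diff_tensor_diff_def c_def[symmetric])
  also have "\<dots> = (1/2 * s p) * (\<Sum>k\<in>UNIV. \<Sum>l\<in>UNIV. ?G $ k $ l * H c p $ k $ l) - 2 * H_grad u v p"
    unfolding inner_tensor_algebra[OF matrix_inv_sums(2)[OF d] metric_inverse_sym0[OF c]]
    by (simp add: H_grad_def Let_def c_def[symmetric])
  also have "(\<Sum>k\<in>UNIV. \<Sum>l\<in>UNIV. ?G $ k $ l * H c p $ k $ l) = 2 * (\<theta>' p + \<eta>' p)"
  proof -
    have "(\<Sum>k\<in>UNIV. \<Sum>l\<in>UNIV. ?G $ k $ l * H c p $ k $ l) = (\<Sum>k\<in>UNIV. \<Sum>l\<in>UNIV. ?G $ l $ k * H c p $ k $ l)"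
      by (intro sum.cong refl) (metis metric_inverse_sym0[OF c])
    then show ?thesis by (simp add: \<theta>'_def c_def[symmetric])
  qed
  finally show ?thesis by simp
qed

end

theorem proposition2:
  fixes M :: "'a::{second_countable_topology, t2_space} set"
    and A :: "('a, 'n::finite) chart set"
    and I :: "real set"
    and g :: "real \<Rightarrow> ('a, 'n) tensor2"
    and \<eta> :: "real \<Rightarrow> 'a \<Rightarrow> real"
    and m :: nat
    and \<phi> :: "nat \<Rightarrow> real \<Rightarrow> 'a \<Rightarrow> real"
    and lam :: "nat \<Rightarrow> real \<Rightarrow> real"
    and lam0 :: real
  assumes "manifold_with_boundary M A" and "oriented_atlas A" and "compact M"
    and "open I" and "is_interval I" and "0 \<in> I"
    and "metric_variation I A g"
    and "differentiable_family I A \<eta>"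
    and "\<And>i. i \<in> {1..m} \<Longrightarrow> differentiable_family I A (\<phi> i)"
    and "\<And>i. i \<in> {1..m} \<Longrightarrow> lam i differentiable_on I"
    and "\<And>i. i \<in> {1..m} \<Longrightarrow> lam i 0 = lam0"
    and "\<And>i t p. i \<in> {1..m} \<Longrightarrow> t \<in> I \<Longrightarrow> p \<in> M \<Longrightarrow>
           - drift_laplacian A (g t) (\<eta> t) (\<phi> i t) p = lam i t * \<phi> i t p"
    and "\<And>i t p. i \<in> {1..m} \<Longrightarrow> t \<in> I \<Longrightarrow> p \<in> manifold_boundary A \<Longrightarrow> \<phi> i t p = 0"
    and "\<And>i j t. i \<in> {1..m} \<Longrightarrow> j \<in> {1..m} \<Longrightarrow> t \<in> I \<Longrightarrow>
           (\<integral>p. \<phi> i t p * \<phi> j t p \<partial>weighted_measure M A (g t) (\<eta> t)) = (if i = j then 1 else 0)"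
    and "i \<in> {1..m}" and "j \<in> {1..m}"
  shows "((\<lambda>t. (lam i t + lam j t) * (if i = j then 1 else 0)) has_real_derivative
      (\<integral>p. inner_tensor A (g 0)
              (\<lambda>c q. (1/2 * drift_laplacian A (g 0) (\<eta> 0) (\<lambda>r. \<phi> i 0 r * \<phi> j 0 r) q) *\<^sub>R g 0 c q
                     - 2 *\<^sub>R diff_tensor_diff (\<phi> i 0) (\<phi> j 0) c q)
              (metric_derivative g) p
          \<partial>weighted_measure M A (g 0) (\<eta> 0))
      + (\<integral>p. inner_vec A (g 0)
              (gradient (g 0) (\<lambda>q. deriv (\<lambda>t. \<eta> t q) 0))
              (gradient (g 0) (\<lambda>q. \<phi> i 0 q * \<phi> j 0 q)) p
          \<partial>weighted_measure M A (g 0) (\<eta> 0))) (at 0)"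
proof -
  interpret metric_weight_variation M A I g \<eta>
    by unfold_locales (fact assms)+
  note fam = assms(9) and lam_diff = assms(10) and lam_0 = assms(11) and eig = assms(12) and bd = assms(13)
    and orth = assms(14) and i = assms(15) and j = assms(16)
  let ?\<delta> = "if i = j then 1 else 0 :: real" and ?u = "\<phi> i 0" and ?v = "\<phi> j 0"
  \<comment> \<open>As \<open>I\<close> is open, the derivative within \<open>I\<close> is the full
    derivative at 0.\<close>
  have D: "\<exists>D. (lam k has_real_derivative D) (at 0)" if "k \<in> {1..m}" for k
    using lam_diff[OF that] assms(4,6) unfolding differentiable_on_def
    by (metis at_within_open real_differentiable_def)
  obtain li lj where li: "(lam i has_real_derivative li) (at 0)" and lj: "(lam j has_real_derivative lj) (at 0)"
    using D[OF i] D[OF j] by blast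
  have l0: "lam i 0 = lam0" "lam j 0 = lam0" using lam_0 i j by auto
  have su: "smooth_fun A ?u" "smooth_fun A ?v" using family_C1(1)[OF fam zero_I] i j by auto
  let ?R = "variation_density lam0 ?u ?v"
  have Ri: "integrable W0.m ?R" "(\<integral>p. ?R p \<partial>W0.m) = li * ?\<delta>"
    using eigenvalue_derivative[OF fam[OF i] su(2) eig[OF i] _ bd[OF i] bd[OF j zero_I] li]
      eig[OF j zero_I] orth[OF i j zero_I] l0 by simp_all
  \<comment> \<open>The same formula with i and j exchanged; it has the same integrand because both
    eigenvalues equal \<open>lam0\<close> at t = 0 and the density is symmetric.\<close>
  have "(\<integral>p. variation_density lam0 ?v ?u p \<partial>W0.m) = lj * (\<integral>p. ?v p * ?u p \<partial>W0.m)"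
    using eigenvalue_derivative(2)[OF fam[OF j] su(1) eig[OF j] _ bd[OF j] bd[OF i zero_I] lj]
      eig[OF i zero_I] l0 by simp
  moreover have "(\<integral>p. variation_density lam0 ?v ?u p \<partial>W0.m) = (\<integral>p. ?R p \<partial>W0.m)"
    by (rule Bochner_Integration.integral_cong[OF refl])
      (simp add: variation_density_def W0.point_ip_sym[of _ ?v] H_grad_sym[of _ ?v] mult.commute)
  ultimately have Rj: "(\<integral>p. ?R p \<partial>W0.m) = lj * ?\<delta>"
    using orth[OF j i zero_I] by auto
  let ?L = "drift_laplacian A (g 0) (\<eta> 0)" and ?uv = "\<lambda>q. \<phi> i 0 q * \<phi> j 0 q"
  have bdu: "\<And>p. p \<in> manifold_boundary A \<Longrightarrow> ?u p = 0" "\<And>p. p \<in> manifold_boundary A \<Longrightarrow> ?v p = 0"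
    using bd i j zero_I by auto
  note IL = W0.integral_mult_drift_laplacian[OF su eta'_C1 bdu]
  \<comment> \<open>The product rule together with the two eigenvalue equations identifies half of
    L(u v) with the bracket multiplying \<open>\<theta>'\<close> in the variation density.\<close>
  have L: "?L ?uv p = 2 * (point_ip A (g 0) ?u ?v p - lam0 * (?u p * ?v p))" if p: "p \<in> M" for p
  proof -
    have "?L ?u p = - (lam0 * ?u p)" "?L ?v p = - (lam0 * ?v p)"
      using eig[OF i zero_I p] eig[OF j zero_I p] l0 by auto
    then show ?thesis using W0.drift_laplacian_mult[OF p su] by (simp add: algebra_simps)
  qed
  have "(\<integral>p. inner_tensor A (g 0) (\<lambda>c q. (1/2 * ?L ?uv q) *\<^sub>R g 0 c q - 2 *\<^sub>R diff_tensor_diff ?u ?v c q) H p \<partial>W0.m)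
      = (\<integral>p. 2 * ?R p + \<eta>' p * ?L ?uv p \<partial>W0.m)"
  proof (rule Bochner_Integration.integral_cong[OF refl])
    fix p assume "p \<in> space W0.m"
    then have p: "p \<in> M" by simp
    show "inner_tensor A (g 0) (\<lambda>c q. (1/2 * ?L ?uv q) *\<^sub>R g 0 c q - 2 *\<^sub>R diff_tensor_diff ?u ?v c q) H p
        = 2 * ?R p + \<eta>' p * ?L ?uv p"
      unfolding inner_tensor_eq[OF p] L[OF p] variation_density_def by (simp add: algebra_simps)
  qed
  also have "\<dots> = 2 * (\<integral>p. ?R p \<partial>W0.m) + (\<integral>p. \<eta>' p * ?L ?uv p \<partial>W0.m)"
    using Ri(1) IL(2) by simp
  \<comment> \<open>Twice the integral of \<open>?R\<close> is the sum of its two evaluations, one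
    for each eigenvalue; this is where the symmetric expression in i and j comes from.\<close>
  also have "\<dots> = (li + lj) * ?\<delta> - (\<integral>p. point_ip A (g 0) \<eta>' ?uv p \<partial>W0.m)"
    using Ri(2) Rj IL(1) by (simp add: distrib_right)
  also have "(\<integral>p. point_ip A (g 0) \<eta>' ?uv p \<partial>W0.m)
      = (\<integral>p. inner_vec A (g 0) (gradient (g 0) \<eta>') (gradient (g 0) ?uv) p \<partial>W0.m)"
    by (rule Bochner_Integration.integral_cong) (simp_all add: W0.inner_vec_gradient point_ip_def)
  finally have eq: "(\<integral>p. inner_tensor A (g 0) (\<lambda>c q. (1/2 * ?L ?uv q) *\<^sub>R g 0 c q - 2 *\<^sub>R diff_tensor_diff ?u ?v c q) H p \<partial>W0.m)
      + (\<integral>p. inner_vec A (g 0) (gradient (g 0) \<eta>') (gradient (g 0) ?uv) p \<partial>W0.m) = (li + lj) * ?\<delta>"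
    by simp
  show ?thesis
    unfolding eq by (intro DERIV_cmult_right DERIV_add li lj)
qed

end
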